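(* Let $M$ be a symplectic manifold equipped with a smooth family of natural star products $\{\star_\sigma\}_{\sigma\in\mathcal{T}}$ parametrized by a manifold $\mathcal{T}$, and assume that the family admits a compatible formal connection. Then the space $\mathcal{F}(M,\star_\sigma)$ of formal connections on $M$ that are compatible with the family of star products is an affine space over the space of $1$-forms on $\mathcal{T}$ with values in formal symplectic vector fields on $M$ that vanish modulo $h$; that is, $$\mathcal{F}(M,\star_\sigma)=D_0+\Omega^1(\mathcal{T},h\Gamma_{\mathrm{sym}}(M)[[h]])$$ for a fixed compatible formal connection $D_0$.
   Context: Functions and vector fields on $M$ have complex coefficients. $\Gamma_{\mathrm{sym}}(M)$ is the space of symplectic vector fields $Y$ on $(M,\omega)$ ($L_Y\omega=0$). $\mathcal{D}_h(M)=\mathcal{D}(M)[[h]]$, where $\mathcal{D}(M)$ is the space of differential operators on $M$. A star product on $(M,\omega)$ is a $\mathbb{C}[[h]]$-bilinear product $f\star g=\sum_{k\ge 0}c^k(f,g)h^k$ on $C^\infty(M)[[h]]$ which is associative, has $1$ as unit, and satisfies $c^0(f,g)=fg$ and $c^1(f,g)-c^1(g,f)=i\{f,g\}$. It is natural if each $c^k$ is a bidifferential operator of order at most $k$ in each argument. A formal connection is a connection on $\mathcal{T}\times C^\infty(M)[[h]]\to\mathcal{T}$ of the form $D_Vf=V[f]+A(V)(f)$, where $V$ is a vector field on $\mathcal{T}$, $V[f]$ is the derivative of the smooth section $f$ along $V$, and $A=\sum_{k\ge1}A^kh^k$ is a smooth $1$-form on $\mathcal{T}$ with values in $\mathcal{D}_h(M)$,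 with $A=0\bmod h$. It is compatible with $\{\star_\sigma\}$ if $D_V(f\star_\sigma g)=D_V(f)\star_\sigma g+f\star_\sigma D_V(g)$ for all $\sigma,V$ and all smooth sections $f,g$. For natural star products one also requires $A^k(V)$ to be a differential operator of order at most $k$. A formal symplectic vector field is a series $Y=\sum_kY_kh^k$ with each $Y_k$ symplectic. In the displayed formula, formal symplectic vector fields are identified with derivations of $\star_\sigma$ (Gutt-Rawnsley): $Y$ corresponds, for each $\sigma$, to the derivation $B=\sum_kB_kh^k$ of $\star_\sigma$ which on any contractible open $U\subset M$ is given by $B_k(f)|_U=\frac1h(b_k\star_\sigma f-f\star_\sigma b_k)$, where $b_k\in C^\infty(U)$ satisfies $Y_k(f)|_U=\{b_k,f\}|_U$. Under this correspondence $h\Gamma_{\mathrm{sym}}(M)[[h]]$ corresponds to the derivations that are trivial modulo $h$, and a $1$-form with values in formal symplectic vector fields is added to $D_0$ by adding the corresponding derivation-valued $1$-form to its connection form. *)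

theory Defs
  imports "HOL-Analysis.Analysis" "HOL-Library.Function_Algebras"
begin

section \<open>Manifolds\<close>

text \<open>A manifold is a Hausdorff, second countable topological type together with a smooth atlas.
  The model space is a type of sort \<open>{real_inner, heine_borel, banach}\<close>: by Riesz' theorem such a
  space is finite-dimensional, and every Euclidean space is of this kind. In contrast to
  \<open>euclidean_space\<close>, dimension 0 is not excluded.

  A chart is a pair of its domain and its coordinate map; values of the map outside the domain are
  irrelevant.\<close>

type_synonym ('a, 'e) atlas = "('a set \<times> ('a \<Rightarrow> 'e)) set"

text \<open>\<open>Ck_on k S f\<close> is only used for open \<open>S\<close> in a finite-dimensional space.\<close>

primrec Ck_on ::
  "nat \<Rightarrow> 'a::real_normed_vector set \<Rightarrow> ('a \<Rightarrow> 'b::real_normed_vector) \<Rightarrow> bool" where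
  "Ck_on 0 S f \<longleftrightarrow> continuous_on S f"
| "Ck_on (Suc k) S f \<longleftrightarrow> (\<forall>x\<in>S. f differentiable (at x)) \<and>
     (\<forall>v. Ck_on k S (\<lambda>x. frechet_derivative f (at x) v))"

definition smooth_on ::
  "'a::real_normed_vector set \<Rightarrow> ('a \<Rightarrow> 'b::real_normed_vector) \<Rightarrow> bool" where
  "smooth_on S f \<longleftrightarrow> (\<forall>k. Ck_on k S f)"

definition smooth_atlas ::
  "('a::{t2_space,second_countable_topology}, 'e::{real_inner,heine_borel,banach}) atlas \<Rightarrow> bool"
  where
  "smooth_atlas \<A> \<longleftrightarrow>
     (\<Union>(U, \<phi>)\<in>\<A>. U) = UNIV \<and>
     (\<forall>(U, \<phi>)\<in>\<A>. open U \<and> open (\<phi> ` U) \<and> homeomorphism U (\<phi> ` U) \<phi> (inv_into U \<phi>)) \<and>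
     (\<forall>(U, \<phi>)\<in>\<A>. \<forall>(U', \<phi>')\<in>\<A>. smooth_on (\<phi> ` (U \<inter> U')) (\<phi>' \<circ> inv_into U \<phi>))"

definition prod_atlas :: "('a, 'e) atlas \<Rightarrow> ('b, 'f) atlas \<Rightarrow> ('a \<times> 'b, 'e \<times> 'f) atlas" where
  "prod_atlas \<A> \<B> = {(U \<times> V, map_prod \<phi> \<psi>) | U \<phi> V \<psi>. (U, \<phi>) \<in> \<A> \<and> (V, \<psi>) \<in> \<B>}"

text \<open>Smooth functions on an open set \<open>W\<close>; values outside \<open>W\<close> are irrelevant.\<close>

definition Cinf_on ::
  "('a, 'e::real_normed_vector) atlas \<Rightarrow> 'a set \<Rightarrow> ('a \<Rightarrow> 'k::real_normed_vector) set" where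
  "Cinf_on \<A> W = {f. \<forall>(U, \<phi>)\<in>\<A>. smooth_on (\<phi> ` (U \<inter> W)) (f \<circ> inv_into U \<phi>)}"

abbreviation Cinf ::
  "('a, 'e::real_normed_vector) atlas \<Rightarrow> ('a \<Rightarrow> 'k::real_normed_vector) set" where
  "Cinf \<A> \<equiv> Cinf_on \<A> UNIV"

text \<open>Tangent vectors at a point are point derivations. For \<open>'k = real\<close> this is the tangent space,
  for \<open>'k = complex\<close> its complexification. Here and below, operators on \<open>Cinf \<A>\<close> are
  functionals on all functions and are normalised to vanish on nonsmooth ones, so that equality of
  operators is equality on smooth functions.\<close>

definition tangent ::
  "('a, 'e::real_normed_vector) atlas \<Rightarrow> 'a \<Rightarrow> (('a \<Rightarrow> 'k::real_normed_field) \<Rightarrow> 'k) set" where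
  "tangent \<A> p = {v.
     (\<forall>f. f \<notin> Cinf \<A> \<longrightarrow> v f = 0) \<and>
     (\<forall>f\<in>Cinf \<A>. \<forall>g\<in>Cinf \<A>. \<forall>a b. v (\<lambda>x. a * f x + b * g x) = a * v f + b * v g) \<and>
     (\<forall>f\<in>Cinf \<A>. \<forall>g\<in>Cinf \<A>. v (\<lambda>x. f x * g x) = v f * g p + f p * v g)}"

text \<open>A vector field is written as the operator \<open>f \<mapsto> X f\<close>; \<open>vat X p\<close> is its value at \<open>p\<close>.\<close>

definition vat :: "(('a \<Rightarrow> 'k) \<Rightarrow> 'a \<Rightarrow> 'k) \<Rightarrow> 'a \<Rightarrow> ('a \<Rightarrow> 'k) \<Rightarrow> 'k" where
  "vat X p = (\<lambda>f. X f p)"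

definition vfields ::
  "('a, 'e::real_normed_vector) atlas \<Rightarrow> (('a \<Rightarrow> 'k::real_normed_field) \<Rightarrow> 'a \<Rightarrow> 'k) set" where
  "vfields \<A> = {X. (\<forall>p. vat X p \<in> tangent \<A> p) \<and> (\<forall>f\<in>Cinf \<A>. X f \<in> Cinf \<A>)}"

definition lie_bracket ::
  "(('a \<Rightarrow> 'k::real_normed_field) \<Rightarrow> 'a \<Rightarrow> 'k) \<Rightarrow> (('a \<Rightarrow> 'k) \<Rightarrow> 'a \<Rightarrow> 'k) \<Rightarrow> ('a \<Rightarrow> 'k) \<Rightarrow> 'a \<Rightarrow> 'k"
  where
  "lie_bracket X Y = (\<lambda>f. X (Y f) - Y (X f))"

section \<open>Symplectic manifolds\<close>

type_synonym 'm cvec = "('m \<Rightarrow> complex) \<Rightarrow> complex"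
type_synonym 'm cop = "('m \<Rightarrow> complex) \<Rightarrow> 'm \<Rightarrow> complex"

text \<open>A real 2-form is represented by its complex bilinear extension to complex tangent vectors.\<close>

type_synonym 'm form2 = "'m \<Rightarrow> 'm cvec \<Rightarrow> 'm cvec \<Rightarrow> complex"

definition real_vec :: "('m, 'e::real_normed_vector) atlas \<Rightarrow> 'm cvec \<Rightarrow> bool" where
  "real_vec \<A> v \<longleftrightarrow> (\<forall>f\<in>Cinf \<A>. (\<forall>x. f x \<in> \<real>) \<longrightarrow> v f \<in> \<real>)"

definition eval2 :: "'m form2 \<Rightarrow> 'm cop \<Rightarrow> 'm cop \<Rightarrow> 'm \<Rightarrow> complex" where
  "eval2 \<omega> X Y = (\<lambda>p. \<omega> p (vat X p) (vat Y p))"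

definition real_two_form :: "('m, 'e::real_normed_vector) atlas \<Rightarrow> 'm form2 \<Rightarrow> bool" where
  "real_two_form \<A> \<omega> \<longleftrightarrow>
     (\<forall>p. \<forall>u\<in>tangent \<A> p. \<forall>v\<in>tangent \<A> p. \<forall>w\<in>tangent \<A> p. \<forall>a b.
        \<omega> p (\<lambda>f. a * u f + b * v f) w = a * \<omega> p u w + b * \<omega> p v w) \<and>
     (\<forall>p. \<forall>v\<in>tangent \<A> p. \<forall>w\<in>tangent \<A> p. \<omega> p v w = - \<omega> p w v) \<and>
     (\<forall>p. \<forall>v\<in>tangent \<A> p. \<forall>w\<in>tangent \<A> p.
        real_vec \<A> v \<longrightarrow> real_vec \<A> w \<longrightarrow> \<omega> p v w \<in> \<real>) \<and>
     (\<forall>X\<in>vfields \<A>. \<forall>Y\<in>vfields \<A>. eval2 \<omega> X Y \<in> Cinf \<A>)"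

definition closed_two_form :: "('m, 'e::real_normed_vector) atlas \<Rightarrow> 'm form2 \<Rightarrow> bool" where
  "closed_two_form \<A> \<omega> \<longleftrightarrow> (\<forall>X\<in>vfields \<A>. \<forall>Y\<in>vfields \<A>. \<forall>Z\<in>vfields \<A>.
     X (eval2 \<omega> Y Z) - Y (eval2 \<omega> X Z) + Z (eval2 \<omega> X Y)
     - eval2 \<omega> (lie_bracket X Y) Z + eval2 \<omega> (lie_bracket X Z) Y
     - eval2 \<omega> (lie_bracket Y Z) X = 0)"

definition nondegenerate_form :: "('m, 'e::real_normed_vector) atlas \<Rightarrow> 'm form2 \<Rightarrow> bool" where
  "nondegenerate_form \<A> \<omega> \<longleftrightarrow>
     (\<forall>p. \<forall>v\<in>tangent \<A> p. (\<forall>w\<in>tangent \<A> p. \<omega> p v w = 0) \<longrightarrow> v = 0)"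

definition symplectic_manifold ::
  "('m::{t2_space,second_countable_topology}, 'e::{real_inner,heine_borel,banach}) atlas
    \<Rightarrow> 'm form2 \<Rightarrow> bool" where
  "symplectic_manifold \<A> \<omega> \<longleftrightarrow>
     smooth_atlas \<A> \<and> real_two_form \<A> \<omega> \<and> closed_two_form \<A> \<omega> \<and> nondegenerate_form \<A> \<omega>"

text \<open>The condition is the vanishing of the Lie derivative of \<open>\<omega>\<close> along \<open>Y\<close>.\<close>

definition symplectic_fields :: "('m, 'e::real_normed_vector) atlas \<Rightarrow> 'm form2 \<Rightarrow> 'm cop set" where
  "symplectic_fields \<A> \<omega> = {Y\<in>vfields \<A>. \<forall>X\<in>vfields \<A>. \<forall>Z\<in>vfields \<A>.
     Y (eval2 \<omega> X Z) - eval2 \<omega> (lie_bracket Y X) Z - eval2 \<omega> X (lie_bracket Y Z) = 0}"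

text \<open>Sign conventions: \<open>\<omega>(X\<^sub>f, \<cdot>) = df\<close> and \<open>{f, g} = \<omega>(X\<^sub>f, X\<^sub>g)\<close>. The opposite
  sign of the bracket is obtained by replacing \<open>\<omega>\<close> by \<open>-\<omega>\<close>, which has the same symplectic
  vector fields.\<close>

definition hamiltonian_field ::
  "('m, 'e::real_normed_vector) atlas \<Rightarrow> 'm form2 \<Rightarrow> ('m \<Rightarrow> complex) \<Rightarrow> 'm cop" where
  "hamiltonian_field \<A> \<omega> f =
     (\<lambda>g p. (THE v. v \<in> tangent \<A> p \<and> (\<forall>w\<in>tangent \<A> p. \<omega> p v w = w f)) g)"

definition poisson ::
  "('m, 'e::real_normed_vector) atlas \<Rightarrow> 'm form2 \<Rightarrow> ('m \<Rightarrow> complex) \<Rightarrow> ('m \<Rightarrow> complex)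
    \<Rightarrow> 'm \<Rightarrow> complex" where
  "poisson \<A> \<omega> f g = eval2 \<omega> (hamiltonian_field \<A> \<omega> f) (hamiltonian_field \<A> \<omega> g)"

section \<open>Differential operators\<close>

text \<open>\<open>iter_deriv [v1, \<dots>, vr] g = \<partial>\<^bsub>v1\<^esub> \<dots> \<partial>\<^bsub>vr\<^esub> g\<close>, and \<open>local_deriv U \<phi> vs f\<close>
  is the corresponding derivative of \<open>f\<close> in the chart \<open>(U, \<phi>)\<close>.\<close>

primrec iter_deriv ::
  "'e::real_normed_vector list \<Rightarrow> ('e \<Rightarrow> complex) \<Rightarrow> 'e \<Rightarrow> complex" where
  "iter_deriv [] g = g"
| "iter_deriv (v # vs) g = (\<lambda>y. frechet_derivative (iter_deriv vs g) (at y) v)"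

definition local_deriv ::
  "'m set \<Rightarrow> ('m \<Rightarrow> 'e::real_normed_vector) \<Rightarrow> 'e list \<Rightarrow> ('m \<Rightarrow> complex) \<Rightarrow> 'm \<Rightarrow> complex" where
  "local_deriv U \<phi> vs f = (\<lambda>x. iter_deriv vs (f \<circ> inv_into U \<phi>) (\<phi> x))"

text \<open>Differential operators of order at most \<open>k\<close>, and bidifferential operators of order at most
  \<open>k\<close> in each argument: in any chart and near any point, a finite sum of products of smooth
  coefficients and at most \<open>k\<close>-fold derivatives (of each argument).\<close>

definition diff_ops ::
  "('m::topological_space, 'e::real_normed_vector) atlas \<Rightarrow> nat \<Rightarrow> 'm cop set" where
  "diff_ops \<A> k = {D.
     (\<forall>f. f \<notin> Cinf \<A> \<longrightarrow> D f = 0) \<and>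
     (\<forall>(U, \<phi>)\<in>\<A>. \<forall>p\<in>U. \<exists>W J a. open W \<and> p \<in> W \<and> W \<subseteq> U \<and>
        finite J \<and> (\<forall>vs\<in>J. length vs \<le> k \<and> a vs \<in> Cinf_on \<A> W) \<and>
        (\<forall>f\<in>Cinf \<A>. \<forall>x\<in>W. D f x = (\<Sum>vs\<in>J. a vs x * local_deriv U \<phi> vs f x)))}"

definition bidiff_op ::
  "('m::topological_space, 'e::real_normed_vector) atlas \<Rightarrow> nat
    \<Rightarrow> (('m \<Rightarrow> complex) \<Rightarrow> 'm cop) \<Rightarrow> bool" where
  "bidiff_op \<A> k c \<longleftrightarrow>
     (\<forall>(U, \<phi>)\<in>\<A>. \<forall>p\<in>U. \<exists>W J a. open W \<and> p \<in> W \<and> W \<subseteq> U \<and>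
        finite J \<and>
        (\<forall>(vs, ws)\<in>J. length vs \<le> k \<and> length ws \<le> k \<and> a (vs, ws) \<in> Cinf_on \<A> W) \<and>
        (\<forall>f\<in>Cinf \<A>. \<forall>g\<in>Cinf \<A>. \<forall>x\<in>W. c f g x =
           (\<Sum>(vs, ws)\<in>J. a (vs, ws) x * local_deriv U \<phi> vs f x * local_deriv U \<phi> ws g x)))"

section \<open>Star products\<close>

text \<open>A formal power series in \<open>h\<close> is the sequence of its coefficients. The coefficients \<open>c\<close>
  determine a \<open>\<complex>[[h]]\<close>-bilinear product, and a series of operators determines a
  \<open>\<complex>[[h]]\<close>-linear operator.\<close>

type_synonym 'm star_coeffs = "nat \<Rightarrow> ('m \<Rightarrow> complex) \<Rightarrow> 'm cop"

definition formal_functions ::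
  "('m, 'e::real_normed_vector) atlas \<Rightarrow> (nat \<Rightarrow> 'm \<Rightarrow> complex) set" where
  "formal_functions \<A> = {f. \<forall>n. f n \<in> Cinf \<A>}"

definition constant_series :: "'b \<Rightarrow> nat \<Rightarrow> 'b::zero" where
  "constant_series f = (\<lambda>n. if n = 0 then f else 0)"

definition star ::
  "'m star_coeffs \<Rightarrow> (nat \<Rightarrow> 'm \<Rightarrow> complex) \<Rightarrow> (nat \<Rightarrow> 'm \<Rightarrow> complex) \<Rightarrow> nat \<Rightarrow> 'm \<Rightarrow> complex" where
  "star c f g = (\<lambda>n x. \<Sum>k\<le>n. \<Sum>i\<le>n - k. c k (f i) (g (n - k - i)) x)"

definition apply_series ::
  "(nat \<Rightarrow> 'm cop) \<Rightarrow> (nat \<Rightarrow> 'm \<Rightarrow> complex) \<Rightarrow> nat \<Rightarrow> 'm \<Rightarrow> complex" where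
  "apply_series B f = (\<lambda>n x. \<Sum>i\<le>n. B i (f (n - i)) x)"

definition star_product ::
  "('m, 'e::real_normed_vector) atlas \<Rightarrow> 'm form2 \<Rightarrow> 'm star_coeffs \<Rightarrow> bool" where
  "star_product \<A> \<omega> c \<longleftrightarrow>
     (\<forall>k. \<forall>f\<in>Cinf \<A>. \<forall>g\<in>Cinf \<A>. c k f g \<in> Cinf \<A>) \<and>
     (\<forall>k. \<forall>f\<in>Cinf \<A>. \<forall>g\<in>Cinf \<A>. \<forall>w\<in>Cinf \<A>. \<forall>a b.
        c k (\<lambda>x. a * f x + b * g x) w = (\<lambda>x. a * c k f w x + b * c k g w x) \<and>
        c k w (\<lambda>x. a * f x + b * g x) = (\<lambda>x. a * c k w f x + b * c k w g x)) \<and>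
     (\<forall>f\<in>formal_functions \<A>. \<forall>g\<in>formal_functions \<A>. \<forall>w\<in>formal_functions \<A>.
        star c (star c f g) w = star c f (star c g w)) \<and>
     (\<forall>f\<in>formal_functions \<A>.
        star c (constant_series (\<lambda>x. 1)) f = f \<and> star c f (constant_series (\<lambda>x. 1)) = f) \<and>
     (\<forall>f\<in>Cinf \<A>. \<forall>g\<in>Cinf \<A>. c 0 f g = (\<lambda>x. f x * g x)) \<and>
     (\<forall>f\<in>Cinf \<A>. \<forall>g\<in>Cinf \<A>. c 1 f g - c 1 g f = (\<lambda>x. \<i> * poisson \<A> \<omega> f g x))"

definition natural_star_product ::
  "('m::topological_space, 'e::real_normed_vector) atlas \<Rightarrow> 'm form2 \<Rightarrow> 'm star_coeffs \<Rightarrow> bool" where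
  "natural_star_product \<A> \<omega> c \<longleftrightarrow> star_product \<A> \<omega> c \<and> (\<forall>k. bidiff_op \<A> k (c k))"

definition smooth_natural_family ::
  "('t, 'f::real_normed_vector) atlas \<Rightarrow> ('m::topological_space, 'e::real_normed_vector) atlas
    \<Rightarrow> 'm form2 \<Rightarrow> ('t \<Rightarrow> 'm star_coeffs) \<Rightarrow> bool" where
  "smooth_natural_family \<T> \<A> \<omega> c \<longleftrightarrow>
     (\<forall>\<sigma>. natural_star_product \<A> \<omega> (c \<sigma>)) \<and>
     (\<forall>k. \<forall>f\<in>Cinf (prod_atlas \<T> \<A>). \<forall>g\<in>Cinf (prod_atlas \<T> \<A>).
        (\<lambda>(\<sigma>, x). c \<sigma> k (\<lambda>y. f (\<sigma>, y)) (\<lambda>y. g (\<sigma>, y)) x) \<in> Cinf (prod_atlas \<T> \<A>))"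

section \<open>Formal symplectic vector fields and derivations\<close>

text \<open>A globally defined smooth function with the same germ at \<open>x\<close> as \<open>b\<close>. It serves to restrict
  local operators to open sets: for \<open>b\<close> smooth on an open set \<open>U\<close> and \<open>x \<in> U\<close>, such a function
  exists, and the value at \<open>x\<close> of a bidifferential operator (or of the Poisson bracket) applied to
  it does not depend on the choice.\<close>

definition germ_ext ::
  "('m::topological_space, 'e::real_normed_vector) atlas \<Rightarrow> ('m \<Rightarrow> complex) \<Rightarrow> 'm \<Rightarrow> 'm \<Rightarrow> complex"
  where
  "germ_ext \<A> b x = (SOME g. g \<in> Cinf \<A> \<and> (\<exists>W. open W \<and> x \<in> W \<and> (\<forall>y\<in>W. g y = b y)))"

definition star_derivation ::
  "('m, 'e::real_normed_vector) atlas \<Rightarrow> 'm star_coeffs \<Rightarrow> (nat \<Rightarrow> 'm cop) \<Rightarrow> bool" where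
  "star_derivation \<A> c B \<longleftrightarrow>
     (\<forall>n f. f \<notin> Cinf \<A> \<longrightarrow> B n f = 0) \<and>
     (\<forall>n. \<forall>f\<in>Cinf \<A>. B n f \<in> Cinf \<A>) \<and>
     (\<forall>n. \<forall>f\<in>Cinf \<A>. \<forall>g\<in>Cinf \<A>. \<forall>a b.
        B n (\<lambda>x. a * f x + b * g x) = (\<lambda>x. a * B n f x + b * B n g x)) \<and>
     (\<forall>f\<in>formal_functions \<A>. \<forall>g\<in>formal_functions \<A>.
        apply_series B (star c f g) = star c (apply_series B f) g + star c f (apply_series B g))"

text \<open>The derivation of a symplectic vector field \<open>Y\<close>, locally \<open>h\<^sup>-\<^sup>1 (b \<star> f - f \<star> b)\<close> with
  \<open>Y = {b, \<cdot>}\<close>. Division by \<open>h\<close> appears as the index shift \<open>Suc n\<close>.\<close>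

definition symplectic_derivation ::
  "('m::topological_space, 'e::real_normed_vector) atlas \<Rightarrow> 'm form2 \<Rightarrow> 'm star_coeffs
    \<Rightarrow> 'm cop \<Rightarrow> nat \<Rightarrow> 'm cop" where
  "symplectic_derivation \<A> \<omega> c Y = (THE B. star_derivation \<A> c B \<and>
     (\<forall>U b. open U \<and> contractible U \<and> b \<in> Cinf_on \<A> U \<and>
        (\<forall>f\<in>Cinf \<A>. \<forall>x\<in>U. Y f x = poisson \<A> \<omega> (germ_ext \<A> b x) f x) \<longrightarrow>
        (\<forall>f\<in>Cinf \<A>. \<forall>x\<in>U. \<forall>n. B n f x =
           star c (constant_series (germ_ext \<A> b x)) (constant_series f) (Suc n) x
           - star c (constant_series f) (constant_series (germ_ext \<A> b x)) (Suc n) x)))"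

text \<open>For \<open>Y = \<Sum>\<^sub>k Y\<^sub>k h\<^sup>k\<close> the associated derivation is \<open>\<Sum>\<^sub>k B\<^sub>k h\<^sup>k\<close>, where each \<open>B\<^sub>k\<close> is
  itself a series in \<open>h\<close>.\<close>

definition formal_derivation ::
  "('m::topological_space, 'e::real_normed_vector) atlas \<Rightarrow> 'm form2 \<Rightarrow> 'm star_coeffs
    \<Rightarrow> (nat \<Rightarrow> 'm cop) \<Rightarrow> nat \<Rightarrow> 'm cop" where
  "formal_derivation \<A> \<omega> c Y =
     (\<lambda>n f x. \<Sum>k\<le>n. symplectic_derivation \<A> \<omega> c (Y k) (n - k) f x)"

definition formal_symplectic_fields ::
  "('m, 'e::real_normed_vector) atlas \<Rightarrow> 'm form2 \<Rightarrow> (nat \<Rightarrow> 'm cop) set" where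
  "formal_symplectic_fields \<A> \<omega> = {Y. \<forall>k. Y k \<in> symplectic_fields \<A> \<omega>}"

section \<open>Formal connections\<close>

text \<open>Smooth 1-forms on the parameter manifold with values in a space \<open>Q\<close> of series of operators on
  \<open>C\<^sup>\<infinity>(M)\<close>: real linear on each tangent space, and mapping smooth vector fields and smooth sections
  of \<open>\<T> \<times> C\<^sup>\<infinity>(M)\<close> to smooth sections.\<close>

type_synonym ('t, 'm) op_form = "'t \<Rightarrow> (('t \<Rightarrow> real) \<Rightarrow> real) \<Rightarrow> nat \<Rightarrow> 'm cop"

definition one_forms ::
  "('t, 'f::real_normed_vector) atlas \<Rightarrow> ('m, 'e::real_normed_vector) atlas
    \<Rightarrow> (nat \<Rightarrow> 'm cop) set \<Rightarrow> ('t, 'm) op_form set" where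
  "one_forms \<T> \<A> Q = {A.
     (\<forall>\<sigma> v. v \<notin> tangent \<T> \<sigma> \<longrightarrow> A \<sigma> v = 0) \<and>
     (\<forall>\<sigma>. \<forall>v\<in>tangent \<T> \<sigma>. A \<sigma> v \<in> Q) \<and>
     (\<forall>\<sigma>. \<forall>v\<in>tangent \<T> \<sigma>. \<forall>w\<in>tangent \<T> \<sigma>. \<forall>a b. A \<sigma> (\<lambda>f. a * v f + b * w f) =
        (\<lambda>k f x. of_real a * A \<sigma> v k f x + of_real b * A \<sigma> w k f x)) \<and>
     (\<forall>V\<in>vfields \<T>. \<forall>k. \<forall>f\<in>Cinf (prod_atlas \<T> \<A>).
        (\<lambda>(\<sigma>, x). A \<sigma> (vat V \<sigma>) k (\<lambda>y. f (\<sigma>, y)) x) \<in> Cinf (prod_atlas \<T> \<A>))}"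

text \<open>Smooth sections of \<open>\<T> \<times> C\<^sup>\<infinity>(M)[[h]]\<close>: formal series of smooth functions on \<open>\<T> \<times> M\<close>.\<close>

type_synonym ('t, 'm) formal_section = "nat \<Rightarrow> 't \<times> 'm \<Rightarrow> complex"

type_synonym ('t, 'm) connection =
  "(('t \<Rightarrow> real) \<Rightarrow> 't \<Rightarrow> real) \<Rightarrow> ('t, 'm) formal_section \<Rightarrow> ('t, 'm) formal_section"

abbreviation sections ::
  "('t, 'f::real_normed_vector) atlas \<Rightarrow> ('m, 'e::real_normed_vector) atlas
    \<Rightarrow> ('t, 'm) formal_section set" where
  "sections \<T> \<A> \<equiv> formal_functions (prod_atlas \<T> \<A>)"

definition section_at :: "('t, 'm) formal_section \<Rightarrow> 't \<Rightarrow> nat \<Rightarrow> 'm \<Rightarrow> complex" where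
  "section_at f \<sigma> = (\<lambda>n x. f n (\<sigma>, x))"

definition family_star ::
  "('t \<Rightarrow> 'm star_coeffs) \<Rightarrow> ('t, 'm) formal_section \<Rightarrow> ('t, 'm) formal_section \<Rightarrow> ('t, 'm) formal_section" where
  "family_star c f g = (\<lambda>n (\<sigma>, x). star (c \<sigma>) (section_at f \<sigma>) (section_at g \<sigma>) n x)"

definition section_deriv ::
  "(('t \<Rightarrow> real) \<Rightarrow> 't \<Rightarrow> real) \<Rightarrow> ('t, 'm) formal_section \<Rightarrow> ('t, 'm) formal_section" where
  "section_deriv V f = (\<lambda>n (\<sigma>, x).
     Complex (V (\<lambda>\<tau>. Re (f n (\<tau>, x))) \<sigma>) (V (\<lambda>\<tau>. Im (f n (\<tau>, x))) \<sigma>))"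

text \<open>The operator \<open>f \<mapsto> A(V)(f)\<close>, normalised (like connections below) to vanish unless \<open>V\<close> is a
  smooth vector field and \<open>f\<close> a smooth section.\<close>

definition form_action ::
  "('t, 'f::real_normed_vector) atlas \<Rightarrow> ('m, 'e::real_normed_vector) atlas
    \<Rightarrow> ('t, 'm) op_form \<Rightarrow> ('t, 'm) connection" where
  "form_action \<T> \<A> A = (\<lambda>V f. if V \<in> vfields \<T> \<and> f \<in> sections \<T> \<A>
     then (\<lambda>n (\<sigma>, x). apply_series (A \<sigma> (vat V \<sigma>)) (section_at f \<sigma>) n x) else 0)"

definition connection_of_form ::
  "('t, 'f::real_normed_vector) atlas \<Rightarrow> ('m, 'e::real_normed_vector) atlas
    \<Rightarrow> ('t, 'm) op_form \<Rightarrow> ('t, 'm) connection" where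
  "connection_of_form \<T> \<A> A = (\<lambda>V f. if V \<in> vfields \<T> \<and> f \<in> sections \<T> \<A>
     then section_deriv V f + form_action \<T> \<A> A V f else 0)"

text \<open>Formal connections for natural star products: \<open>A = 0 mod h\<close> and \<open>A\<^sup>k(V)\<close> has order at most
  \<open>k\<close>.\<close>

definition formal_connections ::
  "('t, 'f::real_normed_vector) atlas \<Rightarrow> ('m::topological_space, 'e::real_normed_vector) atlas
    \<Rightarrow> ('t, 'm) connection set" where
  "formal_connections \<T> \<A> =
     connection_of_form \<T> \<A> ` one_forms \<T> \<A> {A. A 0 = 0 \<and> (\<forall>k. A k \<in> diff_ops \<A> k)}"

definition compatible ::
  "('t, 'f::real_normed_vector) atlas \<Rightarrow> ('m, 'e::real_normed_vector) atlas
    \<Rightarrow> ('t \<Rightarrow> 'm star_coeffs) \<Rightarrow> ('t, 'm) connection \<Rightarrow> bool" where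
  "compatible \<T> \<A> c D \<longleftrightarrow>
     (\<forall>V\<in>vfields \<T>. \<forall>f\<in>sections \<T> \<A>. \<forall>g\<in>sections \<T> \<A>.
        D V (family_star c f g) = family_star c (D V f) g + family_star c f (D V g))"

definition compatible_connections ::
  "('t, 'f::real_normed_vector) atlas \<Rightarrow> ('m::topological_space, 'e::real_normed_vector) atlas
    \<Rightarrow> ('t \<Rightarrow> 'm star_coeffs) \<Rightarrow> ('t, 'm) connection set" where
  "compatible_connections \<T> \<A> c = {D \<in> formal_connections \<T> \<A>. compatible \<T> \<A> c D}"

definition symplectic_one_forms ::
  "('t, 'f::real_normed_vector) atlas \<Rightarrow> ('m, 'e::real_normed_vector) atlas \<Rightarrow> 'm form2
    \<Rightarrow> ('t, 'm) op_form set" where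
  "symplectic_one_forms \<T> \<A> \<omega> = one_forms \<T> \<A> {Y\<in>formal_symplectic_fields \<A> \<omega>. Y 0 = 0}"

definition add_symplectic_form ::
  "('t, 'f::real_normed_vector) atlas \<Rightarrow> ('m::topological_space, 'e::real_normed_vector) atlas
    \<Rightarrow> 'm form2 \<Rightarrow> ('t \<Rightarrow> 'm star_coeffs)
    \<Rightarrow> ('t, 'm) connection \<Rightarrow> ('t, 'm) op_form \<Rightarrow> ('t, 'm) connection" where
  "add_symplectic_form \<T> \<A> \<omega> c D Y =
     D + form_action \<T> \<A> (\<lambda>\<sigma> v. formal_derivation \<A> \<omega> (c \<sigma>) (Y \<sigma> v))"

definition scale_form :: "complex \<Rightarrow> ('t, 'm) op_form \<Rightarrow> ('t, 'm) op_form" where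
  "scale_form a Y = (\<lambda>\<sigma> v k f x. a * Y \<sigma> v k f x)"

section \<open>Affine spaces\<close>

text \<open>\<open>P\<close> is an affine space over the subspace \<open>V\<close> of a vector space, with translations \<open>act\<close>.\<close>

definition affine_space_over ::
  "('k::field \<Rightarrow> 'v::ab_group_add \<Rightarrow> 'v) \<Rightarrow> 'v set \<Rightarrow> 'p set \<Rightarrow> ('p \<Rightarrow> 'v \<Rightarrow> 'p) \<Rightarrow> bool" where
  "affine_space_over smul V P act \<longleftrightarrow>
     vector_space smul \<and> module.subspace smul V \<and> P \<noteq> {} \<and>
     (\<forall>p\<in>P. act p 0 = p) \<and>
     (\<forall>p\<in>P. \<forall>v\<in>V. \<forall>w\<in>V. act (act p v) w = act p (v + w)) \<and>
     (\<forall>p\<in>P. bij_betw (act p) V P)"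

end

theory Submission
  imports Defs
begin

text \<open>Two compatible connections differ by a form whose values are derivations of the star products
  that vanish modulo \<open>h\<close>, so the theorem amounts to the correspondence between such derivations and
  formal symplectic vector fields, smoothly in the parameter.

  If a derivation starts in order \<open>n\<close>, the Leibniz rule in order \<open>n\<close> says that its leading
  coefficient is a vector field, and the antisymmetric part of the rule in order \<open>n + 1\<close> that this
  field is a derivation of the Poisson bracket, hence symplectic. Subtracting the derivation of this
  field and iterating yields the formal symplectic vector field.

  Conversely, a symplectic vector field has local potentials \<open>b\<close> by the Poincare lemma. The
  commutators \<open>h\<^sup>-\<^sup>1 (b \<star> f - f \<star> b)\<close> are local and insensitive to constants in \<open>b\<close>, so they
  glue to a derivation. Integration along rays in a chart gives potentials that depend smoothly on
  the parameter, so smooth forms correspond to smooth forms.\<close>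

section \<open>Smooth maps between normed spaces\<close>

text \<open>The grading by \<open>h\<close> makes the two sides match. By naturality the derivation
  of a symplectic field has order at most \<open>n + 1\<close> in degree \<open>n\<close>, one more
  than a natural connection allows; vanishing of the field modulo \<open>h\<close> shifts the degree
  by one and restores order \<open>n\<close>. Since the antisymmetric part of \<open>c 1\<close> is
  i times the Poisson bracket, the derivation of \<open>Y\<close> begins with i \<open>Y\<close>,
  whence the factors i and - i in the recursions.

  Operators act on global functions only and tangent vectors are abstract derivations, so local
  arguments pass through bump functions: Hadamard's formula identifies tangent vectors with
  coordinate vectors, and potentials are extended to global functions. On a general contractible set
  the potential is given by the definition; existence of potentials is needed on small balls in
  charts only.

  The vector fields belonging to a difference of connections are first chosen separately at every
  parameter and tangent vector. Injectivity of the correspondence makes the choice linear, and the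
  recursion for its coefficients makes it smooth.\<close>

definition orthonormal_basis :: "'a::real_inner set \<Rightarrow> bool" where
  "orthonormal_basis B \<longleftrightarrow> finite B \<and> (\<forall>b\<in>B. \<forall>c\<in>B. b \<bullet> c = (if b = c then 1 else 0)) \<and>
     (\<forall>x. (\<Sum>b\<in>B. (x \<bullet> b) *\<^sub>R b) = x)"

text \<open>Distinct members of an orthonormal set have squared distance 2, so a ball of radius 1/2
  contains at most one of them, and a finite cover of the compact unit ball by such balls bounds the
  cardinality. An orthonormal set of maximal cardinality spans: otherwise the normalised remainder
  of an expansion could be added to it.\<close>

lemma ex_orthonormal_basis: "\<exists>B::'a::{real_inner,heine_borel} set. orthonormal_basis B"
proof -
  define ON where "ON B \<longleftrightarrow> finite B \<and> (\<forall>b\<in>B. \<forall>c\<in>B. b \<bullet> c = (if b = c then 1 else 0))"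
    for B :: "'a set"
  have "compact (cball (0::'a) 1)"
    by (simp add: compact_eq_bounded_closed)
  then obtain K where K: "finite K" "cball (0::'a) 1 \<subseteq> (\<Union>x\<in>K. ball x (1/2))"
    unfolding compact_eq_totally_bounded by (meson half_gt_zero zero_less_one)
  have bound: "card B < Suc (card K)" if B: "ON B" for B
  proof -
    have nb: "norm b = 1" if "b \<in> B" for b
      using B that by (simp add: ON_def norm_eq_1)
    have "\<exists>x\<in>K. dist x b < 1/2" if "b \<in> B" for b
    proof -
      have "b \<in> cball 0 1" using nb[OF that] by simp
      then have "b \<in> (\<Union>x\<in>K. ball x (1/2))" using K(2) by (rule subsetD[rotated])
      then show ?thesis by (simp only: UN_iff mem_ball)
    qed
    then obtain h where h: "\<And>b. b \<in> B \<Longrightarrow> h b \<in> K \<and> dist (h b) b < 1/2" by metis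
    have "inj_on h B"
    proof (rule inj_onI, rule ccontr)
      fix b c assume bc: "b \<in> B" "c \<in> B" "h b = h c" "b \<noteq> c"
      have "dist b c < 1"
        using dist_triangle_half_r[of "h b" b 1 c] h[OF bc(1)] h[OF bc(2)] bc(3) by simp
      moreover have "(dist b c)\<^sup>2 = 2"
      proof -
        have "b \<bullet> b = 1" "c \<bullet> c = 1" "b \<bullet> c = 0" "c \<bullet> b = 0" using B bc by (auto simp: ON_def)
        then show ?thesis
          by (simp add: dist_norm power2_norm_eq_inner inner_diff_left inner_diff_right)
      qed
      ultimately show False
        using power_strict_mono[of "dist b c" 1 2] by simp
    qed
    then have "card B \<le> card K"
      by (rule card_inj_on_le) (use h K in auto)
    then show ?thesis by simp
  qed
  have "ON {}" by (simp add: ON_def)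
  then obtain B where B: "ON B" "\<And>C. ON C \<Longrightarrow> card C \<le> card B"
    using ex_has_greatest_nat[of ON "{}" card "Suc (card K)"] bound by (metis less_or_eq_imp_le)
  have "(\<Sum>b\<in>B. (x \<bullet> b) *\<^sub>R b) = x" for x
  proof (rule ccontr)
    assume neq: "(\<Sum>b\<in>B. (x \<bullet> b) *\<^sub>R b) \<noteq> x"
    define y where "y = x - (\<Sum>b\<in>B. (x \<bullet> b) *\<^sub>R b)"
    have yB: "y \<bullet> c = 0" if "c \<in> B" for c
    proof -
      have "(\<Sum>b\<in>B. (x \<bullet> b) *\<^sub>R b) \<bullet> c = (\<Sum>b\<in>B. (x \<bullet> b) * (if b = c then 1 else 0))"
        unfolding inner_sum_left by (rule sum.cong) (use B that in \<open>auto simp: ON_def\<close>)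
      also have "\<dots> = (\<Sum>b\<in>B. if b = c then x \<bullet> b else 0)"
        by (rule sum.cong) auto
      also have "\<dots> = x \<bullet> c"
        using B that by (subst sum.delta) (auto simp: ON_def)
      finally show ?thesis by (simp add: y_def inner_diff_left)
    qed
    define u where "u = y /\<^sub>R norm y"
    have y0: "y \<noteq> 0" using neq by (simp add: y_def)
    have uu: "u \<bullet> u = 1" using y0 by (simp add: u_def dot_square_norm power2_eq_square)
    have uB: "u \<bullet> c = 0 \<and> c \<bullet> u = 0" if "c \<in> B" for c
      using yB[OF that] by (simp add: u_def inner_commute)
    have "u \<notin> B" using uu uB by fastforce
    moreover have "ON (insert u B)"
      using B(1) uu uB by (auto simp: ON_def)
    ultimately show False using B(1) B(2)[of "insert u B"] by (auto simp: ON_def)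
  qed
  then show ?thesis using B(1) unfolding orthonormal_basis_def ON_def by blast
qed

text \<open>A fixed choice that plays the role of \<open>Basis\<close>: the model spaces are not of
  class \<open>euclidean_space\<close>, and in dimension 0 this set is empty.\<close>

definition onb :: "'a::{real_inner,heine_borel} set" where
  "onb = (SOME B. orthonormal_basis B)"

lemma orthonormal_basis_onb: "orthonormal_basis onb"
  unfolding onb_def by (rule someI_ex) (rule ex_orthonormal_basis)

lemma finite_onb [simp, intro]: "finite onb"
  using orthonormal_basis_onb by (auto simp: orthonormal_basis_def)

lemma inner_onb: "b \<in> onb \<Longrightarrow> c \<in> onb \<Longrightarrow> b \<bullet> c = (if b = c then 1 else 0)"
  using orthonormal_basis_onb by (auto simp: orthonormal_basis_def)

lemma onb_expansion: "(\<Sum>b\<in>onb. (x \<bullet> b) *\<^sub>R b) = x"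
  using orthonormal_basis_onb by (auto simp: orthonormal_basis_def)

lemma linear_onb_expansion:
  assumes "linear L"
  shows "L x = (\<Sum>b\<in>onb. (x \<bullet> b) *\<^sub>R L b)"
proof -
  have "L x = L (\<Sum>b\<in>onb. (x \<bullet> b) *\<^sub>R b)" by (simp add: onb_expansion)
  also have "\<dots> = (\<Sum>b\<in>onb. (x \<bullet> b) *\<^sub>R L b)"
    using assms by (simp add: linear_sum linear_scale)
  finally show ?thesis .
qed

section \<open>Calculus of smooth maps on open sets\<close>

abbreviation pd :: "'a \<Rightarrow> ('a::real_normed_vector \<Rightarrow> 'b::real_normed_vector) \<Rightarrow> 'a \<Rightarrow> 'b" where
  "pd v f \<equiv> (\<lambda>x. frechet_derivative f (at x) v)"

lemma pd_eqI: "(f has_derivative f') (at x) \<Longrightarrow> pd v f x = f' v"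
  by (metis frechet_derivative_at)

lemma Ck_on_SucD: "Ck_on (Suc k) S f \<Longrightarrow> Ck_on k S f"
proof (induction k arbitrary: f)
  case 0
  then show ?case
    by (auto intro!: continuous_at_imp_continuous_on differentiable_imp_continuous_within)
qed auto

lemma Ck_on_mono: "Ck_on n S f \<Longrightarrow> m \<le> n \<Longrightarrow> Ck_on m S f"
proof (induction n)
  case (Suc n)
  then show ?case by (metis Ck_on_SucD le_Suc_eq)
qed simp

lemma Ck_on_subset: "Ck_on k S f \<Longrightarrow> T \<subseteq> S \<Longrightarrow> Ck_on k T f"
  by (induction k arbitrary: f) (auto intro: continuous_on_subset)

lemma Ck_on_cong:
  assumes "Ck_on k S f" "open S" "\<And>x. x \<in> S \<Longrightarrow> f x = g x"
  shows "Ck_on k S g"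
  using assms(1,3)
proof (induction k arbitrary: f g)
  case 0
  then show ?case by (simp cong: continuous_on_cong)
next
  case (Suc k)
  have d: "(g has_derivative frechet_derivative f (at x)) (at x)" if "x \<in> S" for x
  proof (rule has_derivative_transform_within_open[OF _ assms(2) that])
    show "(f has_derivative frechet_derivative f (at x)) (at x)"
      using Suc.prems(1) that by (simp add: frechet_derivative_works[symmetric])
  qed (rule Suc.prems(2))
  have "pd v f x = pd v g x" if "x \<in> S" for x v
    by (simp add: pd_eqI[OF d[OF that]])
  then have "Ck_on k S (pd v g)" for v
    by (rule Suc.IH[rotated]) (use Suc.prems(1) in auto)
  then show ?case using d by (auto simp: differentiable_def)
qed

lemma Ck_on_local:
  assumes "\<And>x. x \<in> S \<Longrightarrow> \<exists>T. open T \<and> x \<in> T \<and> Ck_on k T f"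
  shows "Ck_on k S f"
  using assms
proof (induction k arbitrary: f)
  case 0
  have "continuous (at x) f" if "x \<in> S" for x
    using 0[OF that] by (auto simp: continuous_on_eq_continuous_at)
  then show ?case by (simp add: continuous_at_imp_continuous_on)
next
  case (Suc k)
  have "Ck_on k S (pd v f)" for v
  proof (rule Suc.IH)
    fix x assume "x \<in> S"
    from Suc.prems[OF this] show "\<exists>T. open T \<and> x \<in> T \<and> Ck_on k T (pd v f)" by auto
  qed
  then show ?case using Suc.prems by auto
qed

lemma Ck_on_const: "Ck_on k S (\<lambda>x. c)"
  by (induction k arbitrary: c) auto

lemma Ck_on_bounded_linear_compose:
  assumes "bounded_linear L" "open S" "Ck_on k S f"
  shows "Ck_on k S (\<lambda>x. L (f x))"
  using assms(3)
proof (induction k arbitrary: f)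
  case 0
  then show ?case using assms(1) by (simp add: bounded_linear.continuous_on)
next
  case (Suc k)
  have d: "((\<lambda>x. L (f x)) has_derivative (\<lambda>v. L (pd v f x))) (at x)" if "x \<in> S" for x
    using Suc.prems that assms(1)
    by (auto intro!: bounded_linear.has_derivative[OF assms(1)] simp: frechet_derivative_works)
  have "Ck_on k S (pd v (\<lambda>x. L (f x)))" for v
    by (rule Ck_on_cong[of _ _ "\<lambda>x. L (pd v f x)"]) (use Suc assms(2) pd_eqI[OF d] in auto)
  then show ?case using d by (auto simp: differentiable_def)
qed

lemma Ck_on_bounded_linear:
  assumes "bounded_linear L"
  shows "Ck_on k S L"
proof (cases k)
  case 0
  then show ?thesis using assms by (simp add: linear_continuous_on)
next
  case (Suc n)
  have "(L has_derivative L) (at x)" for x using assms by (rule bounded_linear_imp_has_derivative)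
  moreover from this have "pd v L = (\<lambda>x. L v)" for v by (metis frechet_derivative_at)
  ultimately show ?thesis using Suc by (auto simp: Ck_on_const differentiable_def)
qed

lemma Ck_on_add:
  assumes "open S" "Ck_on k S f" "Ck_on k S g"
  shows "Ck_on k S (\<lambda>x. f x + g x)"
  using assms(2,3)
proof (induction k arbitrary: f g)
  case 0
  then show ?case by (simp add: continuous_on_add)
next
  case (Suc k)
  have d: "((\<lambda>x. f x + g x) has_derivative (\<lambda>v. pd v f x + pd v g x)) (at x)" if "x \<in> S" for x
    using Suc.prems that by (auto intro!: has_derivative_add simp: frechet_derivative_works)
  have "Ck_on k S (pd v (\<lambda>x. f x + g x))" for v
    by (rule Ck_on_cong[of _ _ "\<lambda>x. pd v f x + pd v g x"]) (use Suc assms(1) pd_eqI[OF d] in auto)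
  then show ?case using d by (auto simp: differentiable_def)
qed

lemma Ck_on_sum:
  assumes "open S" "\<And>i. i \<in> I \<Longrightarrow> Ck_on k S (f i)"
  shows "Ck_on k S (\<lambda>x. \<Sum>i\<in>I. f i x)"
  using assms(2)
  by (induction I rule: infinite_finite_induct) (auto simp: Ck_on_const intro!: Ck_on_add assms(1))

lemma Ck_on_bilinear:
  assumes "bounded_bilinear B" "open S" "Ck_on k S f" "Ck_on k S g"
  shows "Ck_on k S (\<lambda>x. B (f x) (g x))"
  using assms(3,4)
proof (induction k arbitrary: f g)
  case 0
  then show ?case by (simp add: bounded_bilinear.continuous_on[OF assms(1)])
next
  case (Suc k)
  have d: "((\<lambda>x. B (f x) (g x)) has_derivative (\<lambda>v. B (f x) (pd v g x) + B (pd v f x) (g x))) (at x)"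
    if "x \<in> S" for x
    by (rule bounded_bilinear.FDERIV[OF assms(1)])
      (use Suc.prems that in \<open>simp_all add: frechet_derivative_works[symmetric]\<close>)
  have "Ck_on k S (\<lambda>x. B (f x) (pd v g x) + B (pd v f x) (g x))" for v
  proof (intro Ck_on_add Suc.IH assms(2))
    show "Ck_on k S f" "Ck_on k S g" using Suc.prems by (blast intro: Ck_on_SucD)+
    show "Ck_on k S (pd v f)" "Ck_on k S (pd v g)" using Suc.prems by simp_all
  qed
  then have "Ck_on k S (pd v (\<lambda>x. B (f x) (g x)))" for v
    by (rule Ck_on_cong) (use assms(2) pd_eqI[OF d] in auto)
  then show ?case using d by (auto simp: differentiable_def)
qed

text \<open>\<open>Ck_on\<close> speaks of derivatives in fixed directions, whereas the chain rule
  evaluates the outer derivative in the varying direction \<open>pd v g x\<close>. Expanding that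
  direction in the orthonormal basis gives a finite sum of products, to which the induction
  applies.\<close>

lemma Ck_on_compose:
  fixes g :: "'a::real_normed_vector \<Rightarrow> 'b::{real_inner,heine_borel}"
  assumes "open S" "open T" "Ck_on k T f" "Ck_on k S g" "g ` S \<subseteq> T"
  shows "Ck_on k S (\<lambda>x. f (g x))"
  using assms(3,4)
proof (induction k arbitrary: f)
  case 0
  then show ?case using assms(5) by (auto intro: continuous_on_compose2)
next
  case (Suc k)
  have d: "((\<lambda>x. f (g x)) has_derivative (\<lambda>v. frechet_derivative f (at (g x)) (pd v g x))) (at x)"
    if "x \<in> S" for x
    by (rule has_derivative_compose[of g])
      (use Suc.prems that assms(5) in
        \<open>simp_all add: frechet_derivative_works[symmetric] image_subset_iff\<close>)
  have e: "frechet_derivative f (at (g x)) w = (\<Sum>b\<in>onb. (w \<bullet> b) *\<^sub>R pd b f (g x))" if "x \<in> S" for x w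
    by (rule linear_onb_expansion)
      (use Suc.prems that assms(5) in \<open>simp add: linear_frechet_derivative image_subset_iff\<close>)
  have "Ck_on k S (\<lambda>x. \<Sum>b\<in>onb. (pd v g x \<bullet> b) *\<^sub>R pd b f (g x))" for v
    by (intro Ck_on_sum Ck_on_bilinear[OF bounded_bilinear_scaleR] assms(1) Suc.IH
        Ck_on_bounded_linear_compose[OF bounded_linear_inner_left] Ck_on_SucD[OF Suc.prems(2)])
      (use Suc.prems in simp_all)
  then have "Ck_on k S (pd v (\<lambda>x. f (g x)))" for v
    by (rule Ck_on_cong) (use assms(1) pd_eqI[OF d] e in auto)
  then show ?case using d by (auto simp: differentiable_def)
qed

lemma smooth_on_subset: "smooth_on S f \<Longrightarrow> T \<subseteq> S \<Longrightarrow> smooth_on T f"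
  by (auto simp: smooth_on_def intro: Ck_on_subset)

lemma smooth_on_cong:
  "smooth_on S f \<Longrightarrow> open S \<Longrightarrow> (\<And>x. x \<in> S \<Longrightarrow> f x = g x) \<Longrightarrow> smooth_on S g"
  unfolding smooth_on_def by (intro allI Ck_on_cong[of _ S f g]) auto

lemma smooth_on_local:
  "(\<And>x. x \<in> S \<Longrightarrow> \<exists>T. open T \<and> x \<in> T \<and> smooth_on T f) \<Longrightarrow> smooth_on S f"
  unfolding smooth_on_def by (intro allI Ck_on_local) meson

lemma smooth_on_const [simp]: "smooth_on S (\<lambda>x. c)"
  by (simp add: smooth_on_def Ck_on_const)

lemma smooth_on_bounded_linear: "bounded_linear L \<Longrightarrow> smooth_on S L"
  by (simp add: smooth_on_def Ck_on_bounded_linear)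

lemma smooth_on_id [simp]: "smooth_on S (\<lambda>x. x)"
  by (rule smooth_on_bounded_linear) (rule bounded_linear_ident)

lemma smooth_on_bounded_linear_compose:
  "bounded_linear L \<Longrightarrow> open S \<Longrightarrow> smooth_on S f \<Longrightarrow> smooth_on S (\<lambda>x. L (f x))"
  by (simp add: smooth_on_def Ck_on_bounded_linear_compose)

lemma smooth_on_add: "open S \<Longrightarrow> smooth_on S f \<Longrightarrow> smooth_on S g \<Longrightarrow> smooth_on S (\<lambda>x. f x + g x)"
  by (simp add: smooth_on_def Ck_on_add)

lemma smooth_on_diff:
  "open S \<Longrightarrow> smooth_on S f \<Longrightarrow> smooth_on S g \<Longrightarrow> smooth_on S (\<lambda>x. f x - g x)"
  using smooth_on_add[of S f "\<lambda>x. - g x"]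
    smooth_on_bounded_linear_compose[OF bounded_linear_minus[OF bounded_linear_ident], of S g]
  by simp

lemma smooth_on_sum:
  "open S \<Longrightarrow> (\<And>i. i \<in> I \<Longrightarrow> smooth_on S (f i)) \<Longrightarrow> smooth_on S (\<lambda>x. \<Sum>i\<in>I. f i x)"
  by (simp add: smooth_on_def Ck_on_sum)

lemma smooth_on_bilinear:
  "bounded_bilinear B \<Longrightarrow> open S \<Longrightarrow> smooth_on S f \<Longrightarrow> smooth_on S g
    \<Longrightarrow> smooth_on S (\<lambda>x. B (f x) (g x))"
  by (simp add: smooth_on_def Ck_on_bilinear)

lemmas smooth_on_scaleR = smooth_on_bilinear[OF bounded_bilinear_scaleR]
lemmas smooth_on_mult = smooth_on_bilinear[OF bounded_bilinear_mult]

lemma smooth_on_compose: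
  fixes g :: "'a::real_normed_vector \<Rightarrow> 'b::{real_inner,heine_borel}"
  shows "smooth_on T f \<Longrightarrow> smooth_on S g \<Longrightarrow> open S \<Longrightarrow> open T \<Longrightarrow> g ` S \<subseteq> T
    \<Longrightarrow> smooth_on S (\<lambda>x. f (g x))"
  unfolding smooth_on_def by (intro allI, rule Ck_on_compose[of S T _ f g]) auto

lemma smooth_on_Pair:
  assumes "open S" "smooth_on S f" "smooth_on S g"
  shows "smooth_on S (\<lambda>x. (f x, g x))"
proof -
  have "smooth_on S (\<lambda>x. (f x, 0) + (0, g x))"
  proof (rule smooth_on_add[OF assms(1)])
    show "smooth_on S (\<lambda>x. (f x, 0))"
      by (rule smooth_on_bounded_linear_compose[of "\<lambda>x. (x, 0)"])
        (simp_all add: assms bounded_linear_Pair bounded_linear_ident)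
    show "smooth_on S (\<lambda>x. (0, g x))"
      by (rule smooth_on_bounded_linear_compose[of "\<lambda>x. (0, x)"])
        (simp_all add: assms bounded_linear_Pair bounded_linear_ident)
  qed
  then show ?thesis by simp
qed

lemma smooth_on_fst [simp]: "smooth_on S fst" and smooth_on_snd [simp]: "smooth_on S snd"
  by (simp_all add: smooth_on_bounded_linear bounded_linear_fst bounded_linear_snd)

lemma smooth_on_differentiable: "smooth_on S f \<Longrightarrow> x \<in> S \<Longrightarrow> f differentiable (at x)"
  unfolding smooth_on_def by (metis Ck_on.simps(2))

lemma smooth_on_pd: "smooth_on S f \<Longrightarrow> smooth_on S (pd v f)"
  unfolding smooth_on_def by (metis Ck_on.simps(2))

lemma smooth_on_continuous: "smooth_on S f \<Longrightarrow> continuous_on S f"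
  unfolding smooth_on_def by (metis Ck_on.simps(1))

lemma pd_onb_expansion:
  fixes f :: "'a::{real_inner,heine_borel} \<Rightarrow> 'b::real_normed_vector"
  shows "f differentiable (at x) \<Longrightarrow> pd v f x = (\<Sum>b\<in>onb. (v \<bullet> b) *\<^sub>R pd b f x)"
  by (rule linear_onb_expansion) (rule linear_frechet_derivative)

text \<open>The Leibniz rule asks for a derivative that is continuous as a \<open>blinfun\<close>;
  \<open>F\<close> assembles one from the finitely many basis derivatives, which are continuous by
  \<open>Ck_on\<close>. The open set \<open>I\<close> around the unit interval makes
  \<open>f\<close> differentiable at the end points too.\<close>

lemma integral_param_has_derivative:
  fixes f :: "'a::{real_inner,heine_borel,banach} \<times> real \<Rightarrow> 'c::banach"
  assumes "open S" "open I" "{0..1} \<subseteq> I" "Ck_on (Suc 0) (S \<times> I) f" "x \<in> S"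
  shows "((\<lambda>x. integral {0..1} (\<lambda>t. f (x, t))) has_derivative
           (\<lambda>v. integral {0..1} (\<lambda>t. pd (v, 0) f (x, t)))) (at x)"
proof -
  define F where "F x t = (\<Sum>b\<in>onb. blinfun_scaleR_left (pd (b, 0) f (x, t)) o\<^sub>L blinfun_inner_left b)"
    for x t
  have diff: "(f has_derivative frechet_derivative f (at (y, t))) (at (y, t))"
    if "y \<in> S" "t \<in> {0..1}" for y t
  proof -
    have "t \<in> I" using that assms(3) by blast
    then show ?thesis using that assms(4) by (simp add: frechet_derivative_works[symmetric])
  qed
  have app: "blinfun_apply (F y t) v = pd (v, 0) f (y, t)" if "y \<in> S" "t \<in> {0..1}" for y t v
  proof -
    have "linear (\<lambda>v. frechet_derivative f (at (y, t)) (v, 0))"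
      by (rule bounded_linear.linear)
        (intro bounded_linear_compose[OF has_derivative_bounded_linear[OF diff[OF that]]]
          bounded_linear_Pair bounded_linear_ident bounded_linear_zero)
    from linear_onb_expansion[OF this, of v] show ?thesis
      by (simp add: F_def blinfun.sum_left)
  qed
  obtain r where r: "r > 0" "ball x r \<subseteq> S"
    using assms(1,5) openE by blast
  have contf: "continuous_on (S \<times> I) f" using Ck_on_SucD[OF assms(4)] by simp
  have contpd: "continuous_on (S \<times> I) (pd v f)" for v
    using assms(4) by (cases v) simp
  have contF: "continuous_on (ball x r \<times> cbox 0 1) (\<lambda>(y, t). F y t)"
  proof -
    have "continuous_on (ball x r \<times> cbox 0 1) (pd v f)" for v
      by (rule continuous_on_subset[OF contpd]) (use r assms(3) in auto)
    then have "continuous_on (ball x r \<times> cbox 0 1) (\<lambda>z. \<Sum>b\<in>onb. blinfun_scaleR_left (pd (b, 0) f z)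
        o\<^sub>L blinfun_inner_left b)"
      by (intro continuous_intros)
    then show ?thesis by (simp add: F_def case_prod_unfold)
  qed
  have "((\<lambda>y. integral (cbox 0 1) (\<lambda>t. f (y, t))) has_derivative
       blinfun_apply (integral (cbox 0 1) (F x))) (at x within ball x r)"
  proof (rule leibniz_rule[OF _ _ contF])
    fix y t assume "y \<in> ball x r" "t \<in> cbox (0::real) 1"
    then have yt: "y \<in> S" "t \<in> {0..1}" using r by auto
    have "((\<lambda>y. f (y, t)) has_derivative (\<lambda>v. frechet_derivative f (at (y, t)) (v, 0))) (at y)"
      by (rule has_derivative_compose[of "\<lambda>y. (y, t)", OF _ diff[OF yt]])
        (auto intro!: derivative_eq_intros)
    also have "(\<lambda>v. frechet_derivative f (at (y, t)) (v, 0)) = blinfun_apply (F y t)"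
      using app[OF yt] by auto
    finally show "((\<lambda>y. f (y, t)) has_derivative blinfun_apply (F y t)) (at y within ball x r)"
      by (rule has_derivative_at_withinI)
  next
    fix y assume "y \<in> ball x r"
    then have "y \<in> S" using r by auto
    then have "continuous_on (cbox 0 1) (\<lambda>t. f (y, t))"
      by (intro continuous_on_compose2[OF contf] continuous_intros) (use assms(3) in auto)
    then show "(\<lambda>t. f (y, t)) integrable_on cbox 0 1" by (rule integrable_continuous)
  qed (use r in auto)
  moreover have "blinfun_apply (integral (cbox 0 1) (F x)) v = integral {0..1} (\<lambda>t. pd (v, 0) f (x, t))" for v
  proof -
    have "continuous_on (cbox 0 1) (F x)"
      using continuous_on_compose2[OF contF, of "cbox 0 1" "\<lambda>t. (x, t)"] r
      by (simp add: continuous_on_Pair continuous_on_id image_subset_iff)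
    then have "F x integrable_on cbox 0 1" by (rule integrable_continuous)
    from integral_linear[OF this blinfun.bounded_linear_left[of v]]
    have "blinfun_apply (integral (cbox 0 1) (F x)) v = integral (cbox 0 1) (\<lambda>t. blinfun_apply (F x t) v)"
      by (simp add: o_def)
    also have "\<dots> = integral (cbox 0 1) (\<lambda>t. pd (v, 0) f (x, t))"
      by (rule integral_cong) (use app assms(5) in simp)
    finally show ?thesis by simp
  qed
  then have "blinfun_apply (integral (cbox 0 1) (F x)) = (\<lambda>v. integral {0..1} (\<lambda>t. pd (v, 0) f (x, t)))"
    by (rule ext)
  ultimately show ?thesis
    using r at_within_open[of x "ball x r"] by simp
qed

lemma smooth_on_integral_param:
  fixes f :: "'a::{real_inner,heine_borel,banach} \<times> real \<Rightarrow> 'c::banach"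
  assumes "open S" "open I" "{0..1} \<subseteq> I" "smooth_on (S \<times> I) f"
  shows "smooth_on S (\<lambda>x. integral {0..1} (\<lambda>t. f (x, t)))"
  unfolding smooth_on_def
proof
  fix k
  have "Ck_on k (S \<times> I) f" using assms(4) by (simp add: smooth_on_def)
  then show "Ck_on k S (\<lambda>x. integral {0..1} (\<lambda>t. f (x, t)))"
  proof (induction k arbitrary: f)
    case 0
    have "continuous_on (S \<times> cbox 0 1) (\<lambda>(x, t). f (x, t))"
      by (rule continuous_on_subset[of "S \<times> I"]) (use 0 assms(3) in auto)
    from integral_continuous_on_param[OF this] show ?case by simp
  next
    case (Suc k)
    have d: "((\<lambda>x. integral {0..1} (\<lambda>t. f (x, t))) has_derivative
           (\<lambda>v. integral {0..1} (\<lambda>t. pd (v, 0) f (x, t)))) (at x)" if "x \<in> S" for x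
      by (rule integral_param_has_derivative[OF assms(1-3) _ that])
        (rule Ck_on_mono[OF Suc.prems], simp)
    have "Ck_on k S (pd v (\<lambda>x. integral {0..1} (\<lambda>t. f (x, t))))" for v
    proof (rule Ck_on_cong[OF _ assms(1)])
      show "Ck_on k S (\<lambda>x. integral {0..1} (\<lambda>t. pd (v, 0) f (x, t)))"
        by (rule Suc.IH[of "pd (v, 0) f"]) (use Suc.prems in simp)
    qed (simp add: pd_eqI[OF d])
    then show ?case using d by (auto simp: differentiable_def)
  qed
qed

subsection \<open>Bump functions\<close>

text \<open>Dividing by powers of \<open>t\<close> makes the family closed under differentiation up
  to linear combinations, so one induction shows that all members are smooth.\<close>

definition flat_exp :: "nat \<Rightarrow> real \<Rightarrow> real" where
  "flat_exp n t = (if t \<le> 0 then 0 else exp (- (1 / t)) / t ^ n)"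

lemma flat_exp_tendsto: "(flat_exp n \<longlongrightarrow> 0) (at_right 0)"
proof -
  have "((\<lambda>t. (1 / t) ^ n / exp (1 / t)) \<longlongrightarrow> (0::real)) (at_right 0)"
    by (rule filterlim_compose[OF tendsto_power_div_exp_0])
      (simp add: filterlim_inverse_at_top_right flip: inverse_eq_divide)
  moreover have "eventually (\<lambda>t::real. (1 / t) ^ n / exp (1 / t) = flat_exp n t) (at_right 0)"
    by (auto simp: eventually_at_right_less flat_exp_def exp_minus field_simps
        intro!: eventually_at_rightI[of 0 1])
  ultimately show ?thesis by (rule Lim_transform_eventually)
qed

lemma flat_exp_has_derivative:
  "(flat_exp n has_real_derivative (flat_exp (n + 2) t - real n * flat_exp (n + 1) t)) (at t)"
proof -
  consider "t < 0" | "t > 0" | "t = 0" by linarith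
  then show ?thesis
  proof cases
    case 1
    have "((\<lambda>t. 0) has_real_derivative 0) (at t)" by simp
    then have "(flat_exp n has_real_derivative 0) (at t)"
      by (rule has_field_derivative_transform_within_open[of _ _ _ "{..<0}"]) (use 1 in \<open>auto simp: flat_exp_def\<close>)
    then show ?thesis using 1 by (simp add: flat_exp_def)
  next
    case 2
    have "((\<lambda>t. exp (- (1 / t)) / t ^ n) has_real_derivative
        (exp (- (1 / t)) / t ^ (n + 2) - real n * (exp (- (1 / t)) / t ^ (n + 1)))) (at t)"
    proof -
      have "((\<lambda>t::real. exp (- (1 / t))) has_real_derivative exp (- (1 / t)) * (1 / t\<^sup>2)) (at t)"
        using 2 by (auto intro!: derivative_eq_intros simp: power2_eq_square)
      from DERIV_divide[OF this DERIV_pow[of n t UNIV]] show ?thesis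
      proof (rule DERIV_cong)
        show "(exp (- (1 / t)) * (1 / t\<^sup>2) * t ^ n - exp (- (1 / t)) * (real n * t ^ (n - Suc 0))) / (t ^ n * t ^ n)
          = exp (- (1 / t)) / t ^ (n + 2) - real n * (exp (- (1 / t)) / t ^ (n + 1))"
          using 2 by (cases n) (simp_all add: field_simps power2_eq_square)
      qed (use 2 in simp)
    qed
    then have "(flat_exp n has_real_derivative
        (exp (- (1 / t)) / t ^ (n + 2) - real n * (exp (- (1 / t)) / t ^ (n + 1)))) (at t)"
      by (rule has_field_derivative_transform_within_open[of _ _ _ "{0<..}"]) (use 2 in \<open>auto simp: flat_exp_def\<close>)
    then show ?thesis using 2 by (simp add: flat_exp_def)
  next
    case 3
    have "((\<lambda>h. (flat_exp n (0 + h) - flat_exp n 0) / h) \<longlongrightarrow> 0) (at 0)"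
    proof (rule filterlim_split_at)
      have "eventually (\<lambda>h. 0 = (flat_exp n (0 + h) - flat_exp n 0) / h) (at_left 0)"
        by (auto simp: flat_exp_def intro!: eventually_at_leftI[of "-1"])
      then show "((\<lambda>h. (flat_exp n (0 + h) - flat_exp n 0) / h) \<longlongrightarrow> 0) (at_left 0)"
        by (rule Lim_transform_eventually[rotated]) simp
      \<comment> \<open>From the right, the difference quotient at 0 is the next member of the
        family.\<close>
      have "eventually (\<lambda>h. flat_exp (Suc n) h = (flat_exp n (0 + h) - flat_exp n 0) / h) (at_right 0)"
        by (auto simp: flat_exp_def field_simps intro!: eventually_at_rightI[of _ 1])
      then show "((\<lambda>h. (flat_exp n (0 + h) - flat_exp n 0) / h) \<longlongrightarrow> 0) (at_right 0)"
        by (rule Lim_transform_eventually[OF flat_exp_tendsto])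
    qed
    then show ?thesis using 3 by (simp add: DERIV_def flat_exp_def)
  qed
qed

lemma smooth_flat_exp: "smooth_on UNIV (flat_exp n)"
  unfolding smooth_on_def
proof
  fix k
  show "Ck_on k UNIV (flat_exp n)"
  proof (induction k arbitrary: n)
    case 0
    have "continuous (at x) (flat_exp n)" for x
      using flat_exp_has_derivative by (rule DERIV_isCont)
    then show ?case by (simp add: continuous_at_imp_continuous_on)
  next
    case (Suc k)
    have d: "(flat_exp n has_derivative (\<lambda>v. v *\<^sub>R (flat_exp (n + 2) t + (- real n) *\<^sub>R flat_exp (n + 1) t))) (at t)"
      for t
      using flat_exp_has_derivative[of n t] by (simp add: has_field_derivative_def mult_commute_abs)
    have "Ck_on k UNIV (\<lambda>t. v *\<^sub>R (flat_exp (n + 2) t + (- real n) *\<^sub>R flat_exp (n + 1) t))" for v :: real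
      by (intro Ck_on_bounded_linear_compose[OF bounded_linear_scaleR_right] Ck_on_add Suc.IH open_UNIV)
    then have "Ck_on k UNIV (pd v (flat_exp n))" for v
      by (rule Ck_on_cong) (auto simp: pd_eqI[OF d])
    then show ?case using d by (auto simp: differentiable_def)
  qed
qed

lemma smooth_bump_ball:
  fixes p :: "'a::real_inner"
  assumes "0 < r"
  obtains \<rho> :: "'a \<Rightarrow> real" where "smooth_on UNIV \<rho>" "\<And>y. dist p y < r / 2 \<Longrightarrow> \<rho> y = 1"
    "\<And>y. r \<le> dist p y \<Longrightarrow> \<rho> y = 0"
proof -
  define e where "e = flat_exp 0"
  define m where "m = e (r\<^sup>2 - (r / 2)\<^sup>2)"
  define q where "q y = e (r\<^sup>2 - (y - p) \<bullet> (y - p))" for y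
  \<comment> \<open>\<open>q\<close> vanishes outside the ball and is at least \<open>m\<close> on
    the half ball. Hence \<open>e (m - q y)\<close> is 0 on the half ball and \<open>e m\<close>
    outside the ball.\<close>
  define \<rho> where "\<rho> y = 1 - e (m - q y) * (1 / e m)" for y
  have e: "smooth_on UNIV e" by (simp add: e_def smooth_flat_exp)
  have sq: "smooth_on UNIV q"
    unfolding q_def
    by (rule smooth_on_compose[OF e])
      (intro smooth_on_diff smooth_on_const open_UNIV smooth_on_bilinear[OF bounded_bilinear_inner] smooth_on_id subset_UNIV)+
  have s: "smooth_on UNIV (\<lambda>y. e (m - q y))"
    by (rule smooth_on_compose[OF e]) (intro smooth_on_diff smooth_on_const open_UNIV sq subset_UNIV)+
  have "smooth_on UNIV \<rho>"
    unfolding \<rho>_def by (intro smooth_on_diff smooth_on_mult s open_UNIV smooth_on_const)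
  moreover have "0 < r\<^sup>2 - (r / 2)\<^sup>2" using assms by (simp add: power2_eq_square field_simps)
  then have m: "m > 0" by (simp add: m_def e_def flat_exp_def)
  have dq: "(y - p) \<bullet> (y - p) = (dist p y)\<^sup>2" for y
    by (metis dist_commute dist_norm power2_norm_eq_inner)
  have "\<rho> y = 1" if "dist p y < r / 2" for y
  proof -
    have "(dist p y)\<^sup>2 \<le> (r / 2)\<^sup>2" using that by (intro power_mono) auto
    then have "m \<le> q y" using \<open>0 < r\<^sup>2 - (r / 2)\<^sup>2\<close>
      by (simp add: m_def q_def e_def flat_exp_def dq frac_le)
    then show ?thesis by (simp add: \<rho>_def e_def flat_exp_def)
  qed
  moreover have "\<rho> y = 0" if "r \<le> dist p y" for y
  proof -
    have "r\<^sup>2 \<le> (dist p y)\<^sup>2" using that assms by (intro power_mono) auto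
    then have "q y = 0" by (simp add: q_def e_def flat_exp_def dq)
    then show ?thesis using m by (simp add: \<rho>_def e_def flat_exp_def)
  qed
  ultimately show thesis using that by blast
qed

subsection \<open>The lemmas of Hadamard and Poincare\<close>

text \<open>\<open>g b y\<close> is the mean of \<open>pd b f\<close> over the segment from
  \<open>p\<close> to \<open>y\<close>, and the expansion is the fundamental theorem of calculus on
  that segment. The radius \<open>2 * r\<close> keeps the ray in the domain for parameters between
  -1 and 2, an open interval around the range of integration.\<close>

lemma hadamard:
  fixes f :: "'a::{real_inner,heine_borel,banach} \<Rightarrow> 'c::banach"
  assumes "0 < r" "smooth_on (ball p (2 * r)) f"
  obtains g where "\<And>b. smooth_on (ball p r) (g b)" "\<And>b. g b p = pd b f p"
    "\<And>y. y \<in> ball p r \<Longrightarrow> f y = f p + (\<Sum>b\<in>onb. ((y - p) \<bullet> b) *\<^sub>R g b y)"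
proof -
  define g where "g b y = integral {0..1} (\<lambda>t. pd b f (p + t *\<^sub>R (y - p)))" for b y
  have inb: "p + t *\<^sub>R (y - p) \<in> ball p (2 * r)" if "y \<in> ball p r" "\<bar>t\<bar> < 2" for y t
  proof -
    have "\<bar>t\<bar> * norm (y - p) < 2 * r"
      using that by (intro mult_strict_mono') (auto simp: dist_norm norm_minus_commute)
    then show ?thesis by (simp add: dist_norm)
  qed
  have "smooth_on (ball p r) (g b)" for b
    unfolding g_def
  proof (rule smooth_on_integral_param[of _ "{-1<..<2}"
        "\<lambda>z. pd b f (p + snd z *\<^sub>R (fst z - p))", simplified])
    show "smooth_on (ball p r \<times> {- 1<..<2}) (\<lambda>z. pd b f (p + snd z *\<^sub>R (fst z - p)))"
    proof (rule smooth_on_compose[OF smooth_on_pd[OF assms(2)]])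
      show "smooth_on (ball p r \<times> {-1<..<2}) (\<lambda>z. p + snd z *\<^sub>R (fst z - p))"
        by (intro smooth_on_add smooth_on_scaleR smooth_on_diff smooth_on_const smooth_on_fst
            smooth_on_snd open_Times open_ball open_greaterThanLessThan)
      show "(\<lambda>z. p + snd z *\<^sub>R (fst z - p)) ` (ball p r \<times> {-1<..<2}) \<subseteq> ball p (2 * r)"
        using inb by (auto simp del: mem_ball)
    qed (intro open_Times open_ball open_greaterThanLessThan)+
  qed auto
  moreover have "g b p = pd b f p" for b by (simp add: g_def)
  moreover have "f y = f p + (\<Sum>b\<in>onb. ((y - p) \<bullet> b) *\<^sub>R g b y)" if y: "y \<in> ball p r" for y
  proof -
    have diff: "f differentiable (at (p + t *\<^sub>R (y - p)))" if "t \<in> {0..1}" for t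
      by (rule smooth_on_differentiable[OF assms(2)]) (rule inb[OF y], use that in auto)
    have "((\<lambda>t. f (p + t *\<^sub>R (y - p))) has_vector_derivative pd (y - p) f (p + t *\<^sub>R (y - p)))
        (at t within {0..1})" if t: "t \<in> {0..1}" for t
    proof -
      have "((\<lambda>t. p + t *\<^sub>R (y - p)) has_derivative (\<lambda>h. h *\<^sub>R (y - p))) (at t)"
        by (auto intro!: derivative_eq_intros)
      from has_derivative_compose[OF this diff[OF t, unfolded frechet_derivative_works]]
      have "((\<lambda>t. f (p + t *\<^sub>R (y - p))) has_derivative
          (\<lambda>h. h *\<^sub>R pd (y - p) f (p + t *\<^sub>R (y - p)))) (at t)"
        by (simp add: linear_scale[OF linear_frechet_derivative[OF diff[OF t]]])
      then show ?thesis
        by (simp add: has_vector_derivative_def has_derivative_at_withinI)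
    qed
    from fundamental_theorem_of_calculus[OF zero_le_one this]
    have "((\<lambda>t. pd (y - p) f (p + t *\<^sub>R (y - p))) has_integral (f y - f p)) {0..1}" by simp
    then have "f y - f p = integral {0..1} (\<lambda>t. pd (y - p) f (p + t *\<^sub>R (y - p)))"
      by (simp add: integral_unique)
    also have "\<dots> = integral {0..1} (\<lambda>t. \<Sum>b\<in>onb. ((y - p) \<bullet> b) *\<^sub>R pd b f (p + t *\<^sub>R (y - p)))"
      by (rule integral_cong) (rule pd_onb_expansion[OF diff])
    also have "\<dots> = (\<Sum>b\<in>onb. integral {0..1} (\<lambda>t. ((y - p) \<bullet> b) *\<^sub>R pd b f (p + t *\<^sub>R (y - p))))"
    proof (rule integral_sum)
      fix b :: 'a
      have "continuous_on {0..1} (\<lambda>t. pd b f (p + t *\<^sub>R (y - p)))"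
        by (rule continuous_on_compose2[OF smooth_on_continuous[OF smooth_on_pd[OF assms(2)]]])
          (auto intro!: continuous_intros inb[OF y] simp del: mem_ball)
      then show "(\<lambda>t. ((y - p) \<bullet> b) *\<^sub>R pd b f (p + t *\<^sub>R (y - p))) integrable_on {0..1}"
        by (intro integrable_continuous_interval continuous_intros)
    qed simp
    finally have "f y - f p = (\<Sum>b\<in>onb. ((y - p) \<bullet> b) *\<^sub>R g b y)" by (simp add: g_def)
    then show ?thesis by (simp add: diff_eq_eq add.commute)
  qed
  ultimately show thesis using that by blast
qed

text \<open>The primitive of a closed 1-form with components \<open>\<alpha> e\<close>, depending on a parameter, is its
  integral along rays; the larger ball leaves room to differentiate at the end points.\<close>

lemma poincare_ball:
  fixes \<alpha> :: "'a \<Rightarrow> 's::{real_inner,heine_borel,banach} \<times> 'a::{real_inner,heine_borel,banach} \<Rightarrow> 'c::banach"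
  assumes "open P" "0 < r"
    and smooth: "\<And>e. e \<in> onb \<Longrightarrow> smooth_on (P \<times> ball p (2 * r)) (\<alpha> e)"
    and closed: "\<And>d e s y. d \<in> onb \<Longrightarrow> e \<in> onb \<Longrightarrow> s \<in> P \<Longrightarrow> y \<in> ball p (2 * r)
      \<Longrightarrow> pd (0, d) (\<alpha> e) (s, y) = pd (0, e) (\<alpha> d) (s, y)"
  obtains b where "smooth_on (P \<times> ball p r) b"
    "\<And>e s y. e \<in> onb \<Longrightarrow> s \<in> P \<Longrightarrow> y \<in> ball p r \<Longrightarrow> pd (0, e) b (s, y) = \<alpha> e (s, y)"
proof -
  define l where "l z = (fst (fst z), p + snd z *\<^sub>R (snd (fst z) - p))" for z :: "('s \<times> 'a) \<times> real"
  define G where "G z = (\<Sum>e\<in>onb. ((snd (fst z) - p) \<bullet> e) *\<^sub>R \<alpha> e (l z))" for z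
  define b where "b x = integral {0..1} (\<lambda>t. G (x, t))" for x
  let ?I = "{-1<..<2::real}"
  have inb: "p + t *\<^sub>R (y - p) \<in> ball p (2 * r)" if "y \<in> ball p r" "\<bar>t\<bar> < 2" for y t
  proof -
    have "\<bar>t\<bar> * norm (y - p) < 2 * r"
      using that by (intro mult_strict_mono') (auto simp: dist_norm norm_minus_commute)
    then show ?thesis by (simp add: dist_norm)
  qed
  have op: "open ((P \<times> ball p r) \<times> ?I)" "open (P \<times> ball p r)" "open (P \<times> ball p (2 * r))"
    using assms(1) by (auto intro!: open_Times)
  have sm[simp]: "smooth_on X (\<lambda>z :: ('s \<times> 'a) \<times> real. snd (fst z))"
    "smooth_on X (\<lambda>z :: ('s \<times> 'a) \<times> real. fst (fst z))" for X
    by (auto intro!: smooth_on_bounded_linear bounded_linear_intros)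
  have sl: "smooth_on ((P \<times> ball p r) \<times> ?I) l"
    unfolding l_def using op
    by (intro smooth_on_Pair smooth_on_add smooth_on_scaleR smooth_on_diff) simp_all
  have sal: "smooth_on ((P \<times> ball p r) \<times> ?I) (\<lambda>z. \<alpha> e (l z))" if "e \<in> onb" for e
    by (rule smooth_on_compose[OF smooth[OF that] sl]) (use op inb in \<open>auto simp: l_def simp del: mem_ball\<close>)
  have sG: "smooth_on ((P \<times> ball p r) \<times> ?I) G"
    unfolding G_def
    by (intro smooth_on_sum op smooth_on_scaleR sal smooth_on_diff
        smooth_on_bounded_linear_compose[OF bounded_linear_inner_left]) simp_all
  have "smooth_on (P \<times> ball p r) b"
    unfolding b_def by (rule smooth_on_integral_param[of _ ?I]) (use op sG in auto)
  moreover have "pd (0, d) b (s, y) = \<alpha> d (s, y)"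
    if d: "d \<in> onb" and sy: "s \<in> P" "y \<in> ball p r" for d s y
  proof -
    let ?q = "\<lambda>t. (s, p + t *\<^sub>R (y - p))"
    have q: "?q t \<in> P \<times> ball p (2 * r)" if "t \<in> {0..1}" for t
      using inb[OF sy(2), of t] that sy(1) by simp
    have dal: "\<alpha> e differentiable (at (?q t))" if "e \<in> onb" "t \<in> {0..1}" for e t
      using smooth_on_differentiable[OF smooth q] that by blast
    have "pd (0, d) b (s, y) = integral {0..1} (\<lambda>t. pd ((0, d), 0) G ((s, y), t))"
      unfolding b_def
      by (rule pd_eqI, rule integral_param_has_derivative[of "P \<times> ball p r" ?I])
        (use op sG sy in \<open>auto simp: smooth_on_def simp del: Ck_on.simps\<close>)
    \<comment> \<open>Closedness exchanges \<open>d\<close> and \<open>e\<close> under the sum,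
      which becomes the derivative of \<open>\<alpha> d\<close> in the radial direction. The
      integrand is then the derivative of \<open>t *\<^sub>R \<alpha> d (?q t)\<close>, so the
      integral is the value at 1.\<close>
    also have "\<dots> = integral {0..1} (\<lambda>t. \<alpha> d (?q t) + t *\<^sub>R pd (0, y - p) (\<alpha> d) (?q t))"
    proof (rule integral_cong)
      fix t :: real assume t: "t \<in> {0..1}"
      have dl: "(l has_derivative (\<lambda>h. (fst (fst h), snd h *\<^sub>R (y - p) + t *\<^sub>R snd (fst h)))) (at ((s, y), t))"
        unfolding l_def by (auto intro!: derivative_eq_intros simp: algebra_simps)
      have lq: "l ((s, y), t) = ?q t" by (simp add: l_def)
      have "((\<lambda>z. \<alpha> e (l z)) has_derivative
          (\<lambda>h. frechet_derivative (\<alpha> e) (at (?q t)) (fst (fst h), snd h *\<^sub>R (y - p) + t *\<^sub>R snd (fst h))))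
          (at ((s, y), t))" if "e \<in> onb" for e
        using has_derivative_compose[OF dl, of "\<alpha> e" "frechet_derivative (\<alpha> e) (at (?q t))"]
          dal[OF that t] lq by (simp add: frechet_derivative_works)
      then have "(G has_derivative (\<lambda>h. \<Sum>e\<in>onb. ((y - p) \<bullet> e) *\<^sub>R
            frechet_derivative (\<alpha> e) (at (?q t)) (fst (fst h), snd h *\<^sub>R (y - p) + t *\<^sub>R snd (fst h))
          + (snd (fst h) \<bullet> e) *\<^sub>R \<alpha> e (?q t))) (at ((s, y), t))"
        unfolding G_def by (auto intro!: derivative_eq_intros simp: lq)
      then have "pd ((0, d), 0) G ((s, y), t) = (\<Sum>e\<in>onb. ((y - p) \<bullet> e) *\<^sub>R
            frechet_derivative (\<alpha> e) (at (?q t)) (0, t *\<^sub>R d) + (d \<bullet> e) *\<^sub>R \<alpha> e (?q t))"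
        by (simp add: pd_eqI)
      also have "\<dots> = (\<Sum>e\<in>onb. t *\<^sub>R ((y - p) \<bullet> e) *\<^sub>R pd (0, e) (\<alpha> d) (?q t))
          + (\<Sum>e\<in>onb. (if d = e then 1 else 0) *\<^sub>R \<alpha> e (?q t))"
        unfolding sum.distrib
      proof (rule arg_cong2[where f = "(+)"]; rule sum.cong[OF refl])
        fix e :: 'a assume e: "e \<in> onb"
        have "frechet_derivative (\<alpha> e) (at (?q t)) (0, t *\<^sub>R d) = t *\<^sub>R pd (0, d) (\<alpha> e) (?q t)"
          using linear_scale[OF linear_frechet_derivative[OF dal[OF e t]], of t "(0, d)"] by simp
        also have "pd (0, d) (\<alpha> e) (?q t) = pd (0, e) (\<alpha> d) (?q t)"
          using closed[OF d e] q[OF t] by auto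
        finally show "((y - p) \<bullet> e) *\<^sub>R frechet_derivative (\<alpha> e) (at (?q t)) (0, t *\<^sub>R d) =
            t *\<^sub>R ((y - p) \<bullet> e) *\<^sub>R pd (0, e) (\<alpha> d) (?q t)"
          by simp
        show "(d \<bullet> e) *\<^sub>R \<alpha> e (?q t) = (if d = e then 1 else 0) *\<^sub>R \<alpha> e (?q t)"
          using inner_onb[OF d e] by simp
      qed
      also have "(\<Sum>e\<in>onb. (if d = e then 1 else 0) *\<^sub>R \<alpha> e (?q t)) = (\<Sum>e\<in>onb. if d = e then \<alpha> e (?q t) else 0)"
        by (rule sum.cong) auto
      also have "\<dots> = \<alpha> d (?q t)" using d by (simp add: sum.delta)
      also have "(\<Sum>e\<in>onb. t *\<^sub>R ((y - p) \<bullet> e) *\<^sub>R pd (0, e) (\<alpha> d) (?q t)) = t *\<^sub>R pd (0, y - p) (\<alpha> d) (?q t)"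
      proof -
        have "linear (\<lambda>v. frechet_derivative (\<alpha> d) (at (?q t)) (0, v))"
          using linear_compose[of "\<lambda>v. (0, v)", OF _ linear_frechet_derivative[OF dal[OF d t]]]
          by (simp add: o_def linear_iff)
        from linear_onb_expansion[OF this, of "y - p"] show ?thesis by (simp add: scaleR_sum_right)
      qed
      finally show "pd ((0, d), 0) G ((s, y), t) = \<alpha> d (?q t) + t *\<^sub>R pd (0, y - p) (\<alpha> d) (?q t)"
        by simp
    qed
    also have "\<dots> = 1 *\<^sub>R \<alpha> d (?q 1) - 0 *\<^sub>R \<alpha> d (?q 0)"
    proof (rule integral_unique, rule fundamental_theorem_of_calculus)
      fix t :: real assume t: "t \<in> {0..1}"
      have "(?q has_derivative (\<lambda>h. h *\<^sub>R (0, y - p))) (at t)"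
        by (auto intro!: derivative_eq_intros)
      from has_derivative_compose[OF this dal[OF d t, unfolded frechet_derivative_works]]
      have "((\<lambda>t. \<alpha> d (?q t)) has_vector_derivative pd (0, y - p) (\<alpha> d) (?q t)) (at t within {0..1})"
        unfolding has_vector_derivative_def
        using linear_scale[OF linear_frechet_derivative[OF dal[OF d t]], of _ "(0, y - p)"]
        by (simp add: has_derivative_at_withinI)
      then show "((\<lambda>t. t *\<^sub>R \<alpha> d (?q t)) has_vector_derivative
          \<alpha> d (?q t) + t *\<^sub>R pd (0, y - p) (\<alpha> d) (?q t)) (at t within {0..1})"
        by (auto intro!: derivative_eq_intros)
    qed simp
    finally show ?thesis by simp
  qed
  ultimately show thesis using that by blast
qed

section \<open>Smooth functions on manifolds\<close>

locale smooth_manifold =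
  fixes \<A> :: "('a::{t2_space,second_countable_topology}, 'e::{real_inner,heine_borel,banach}) atlas"
  assumes smooth_atlas: "smooth_atlas \<A>"
begin

lemma chart_at: obtains U \<phi> where "(U, \<phi>) \<in> \<A>" "p \<in> U"
proof -
  have "p \<in> (\<Union>(U, \<phi>)\<in>\<A>. U)" using smooth_atlas unfolding smooth_atlas_def by simp
  then show thesis using that by blast
qed

context
  fixes U \<phi> assumes chart: "(U, \<phi>) \<in> \<A>"
begin

lemma chart_open: "open U" and chart_open_image: "open (\<phi> ` U)"
  and chart_homeomorphism: "homeomorphism U (\<phi> ` U) \<phi> (inv_into U \<phi>)"
  using smooth_atlas chart unfolding smooth_atlas_def by auto

lemma chart_continuous: "continuous_on U \<phi>"
  and chart_inv_continuous: "continuous_on (\<phi> ` U) (inv_into U \<phi>)"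
  using chart_homeomorphism by (auto simp: homeomorphism_def)

lemma chart_inv [simp]: "x \<in> U \<Longrightarrow> inv_into U \<phi> (\<phi> x) = x"
  using chart_homeomorphism by (auto simp: homeomorphism_def)

lemma chart_inv_mem: "y \<in> \<phi> ` U \<Longrightarrow> inv_into U \<phi> y \<in> U"
  by auto

lemma chart_image_eq: "\<phi> ` (U \<inter> W) = \<phi> ` U \<inter> inv_into U \<phi> -` W"
  by auto

lemma chart_image_open: "open W \<Longrightarrow> open (\<phi> ` (U \<inter> W))"
  unfolding chart_image_eq
  by (rule continuous_open_preimage[OF chart_inv_continuous chart_open_image])

lemma chart_preimage_open: "open T \<Longrightarrow> open {x \<in> U. \<phi> x \<in> T}"
  using continuous_open_preimage[OF chart_continuous chart_open, of T]
  by (simp add: vimage_def Int_def)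

end

lemma chart_transition:
  "(U, \<phi>) \<in> \<A> \<Longrightarrow> (U', \<phi>') \<in> \<A> \<Longrightarrow> smooth_on (\<phi> ` (U \<inter> U')) (\<phi>' \<circ> inv_into U \<phi>)"
  using smooth_atlas unfolding smooth_atlas_def by blast

lemma Cinf_onD: "f \<in> Cinf_on \<A> W \<Longrightarrow> (U, \<phi>) \<in> \<A> \<Longrightarrow> smooth_on (\<phi> ` (U \<inter> W)) (f \<circ> inv_into U \<phi>)"
  unfolding Cinf_on_def by auto

lemma CinfD: "f \<in> Cinf \<A> \<Longrightarrow> (U, \<phi>) \<in> \<A> \<Longrightarrow> smooth_on (\<phi> ` U) (f \<circ> inv_into U \<phi>)"
  using Cinf_onD[of f UNIV] by simp

lemma Cinf_on_subset: "f \<in> Cinf_on \<A> W \<Longrightarrow> V \<subseteq> W \<Longrightarrow> f \<in> Cinf_on \<A> V"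
  unfolding Cinf_on_def by (fast intro: smooth_on_subset)

lemma Cinf_imp_Cinf_on: "f \<in> Cinf \<A> \<Longrightarrow> f \<in> Cinf_on \<A> V"
  by (erule Cinf_on_subset) simp

lemma Cinf_on_local:
  assumes "\<And>p. p \<in> W \<Longrightarrow> \<exists>V. open V \<and> p \<in> V \<and> f \<in> Cinf_on \<A> V"
  shows "f \<in> Cinf_on \<A> W"
  unfolding Cinf_on_def
proof (clarify)
  fix U \<phi> assume ch: "(U, \<phi>) \<in> \<A>"
  show "smooth_on (\<phi> ` (U \<inter> W)) (f \<circ> inv_into U \<phi>)"
  proof (rule smooth_on_local)
    fix y assume "y \<in> \<phi> ` (U \<inter> W)"
    then obtain p where p: "p \<in> U" "p \<in> W" "y = \<phi> p" by auto
    obtain V where V: "open V" "p \<in> V" "f \<in> Cinf_on \<A> V" using assms p by blast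
    have "open (\<phi> ` (U \<inter> V))" "y \<in> \<phi> ` (U \<inter> V)" "smooth_on (\<phi> ` (U \<inter> V)) (f \<circ> inv_into U \<phi>)"
      using chart_image_open[OF ch V(1)] p V Cinf_onD[OF V(3) ch] by auto
    then show "\<exists>T. open T \<and> y \<in> T \<and> smooth_on T (f \<circ> inv_into U \<phi>)" by blast
  qed
qed

lemma Cinf_on_cong:
  assumes "f \<in> Cinf_on \<A> W" "open W" "\<And>x. x \<in> W \<Longrightarrow> f x = g x"
  shows "g \<in> Cinf_on \<A> W"
  unfolding Cinf_on_def
proof (clarify)
  fix U \<phi> assume ch: "(U, \<phi>) \<in> \<A>"
  show "smooth_on (\<phi> ` (U \<inter> W)) (g \<circ> inv_into U \<phi>)"
    by (rule smooth_on_cong[OF Cinf_onD[OF assms(1) ch] chart_image_open[OF ch assms(2)]])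
      (use assms(3) ch in auto)
qed

text \<open>One chart suffices: in any other chart the function is the given local expression
  composed with a transition map.\<close>

lemma Cinf_on_chartI:
  assumes ch: "(U, \<phi>) \<in> \<A>" and "open T" "T \<subseteq> \<phi> ` U" and sm: "smooth_on T (f \<circ> inv_into U \<phi>)"
  shows "f \<in> Cinf_on \<A> {x \<in> U. \<phi> x \<in> T}"
  unfolding Cinf_on_def
proof (clarify)
  fix U' \<phi>' assume ch': "(U', \<phi>') \<in> \<A>"
  let ?W = "{x \<in> U. \<phi> x \<in> T}"
  have W: "open ?W" by (rule chart_preimage_open[OF ch assms(2)])
  have "smooth_on (\<phi>' ` (U' \<inter> ?W)) (\<lambda>z. (f \<circ> inv_into U \<phi>) ((\<phi> \<circ> inv_into U' \<phi>') z))"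
  proof (rule smooth_on_compose[OF sm _ chart_image_open[OF ch' W] assms(2)])
    show "smooth_on (\<phi>' ` (U' \<inter> ?W)) (\<phi> \<circ> inv_into U' \<phi>')"
      by (rule smooth_on_subset[OF chart_transition[OF ch' ch]]) auto
    show "(\<phi> \<circ> inv_into U' \<phi>') ` \<phi>' ` (U' \<inter> ?W) \<subseteq> T" using ch' by auto
  qed
  then show "smooth_on (\<phi>' ` (U' \<inter> ?W)) (f \<circ> inv_into U' \<phi>')"
    by (rule smooth_on_cong[OF _ chart_image_open[OF ch' W]]) (use ch ch' in auto)
qed

lemma Cinf_on_const [simp]: "(\<lambda>x. c) \<in> Cinf_on \<A> W"
  unfolding Cinf_on_def by (auto simp: o_def)

lemma Cinf_on_add:
  assumes "f \<in> Cinf_on \<A> W" "g \<in> Cinf_on \<A> W" "open W"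
  shows "(\<lambda>x. f x + g x) \<in> Cinf_on \<A> W"
  unfolding Cinf_on_def
  using smooth_on_add[OF chart_image_open[OF _ assms(3)] Cinf_onD[OF assms(1)] Cinf_onD[OF assms(2)]]
  by (auto simp: o_def)

lemma Cinf_on_bilinear:
  assumes "bounded_bilinear B" "f \<in> Cinf_on \<A> W" "g \<in> Cinf_on \<A> W" "open W"
  shows "(\<lambda>x. B (f x) (g x)) \<in> Cinf_on \<A> W"
  unfolding Cinf_on_def
  using smooth_on_bilinear[OF assms(1) chart_image_open[OF _ assms(4)] Cinf_onD[OF assms(2)] Cinf_onD[OF assms(3)]]
  by (auto simp: o_def)

lemmas Cinf_on_mult = Cinf_on_bilinear[OF bounded_bilinear_mult]
lemmas Cinf_on_scaleR = Cinf_on_bilinear[OF bounded_bilinear_scaleR]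

lemma Cinf_on_bounded_linear:
  assumes "bounded_linear L" "f \<in> Cinf_on \<A> W" "open W"
  shows "(\<lambda>x. L (f x)) \<in> Cinf_on \<A> W"
  unfolding Cinf_on_def
  using smooth_on_bounded_linear_compose[OF assms(1) chart_image_open[OF _ assms(3)] Cinf_onD[OF assms(2)]]
  by (auto simp: o_def)

lemma Cinf_on_sum:
  assumes "\<And>i. i \<in> I \<Longrightarrow> f i \<in> Cinf_on \<A> W" "open W"
  shows "(\<lambda>x. \<Sum>i\<in>I. f i x) \<in> Cinf_on \<A> W"
  using assms by (induction I rule: infinite_finite_induct) (auto intro: Cinf_on_add)

lemma Cinf_on_compose:
  fixes g :: "'a \<Rightarrow> 'c::{real_inner,heine_borel}"
  assumes "smooth_on T F" "g \<in> Cinf_on \<A> W" "open T" "open W" "g ` W \<subseteq> T"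
  shows "(\<lambda>x. F (g x)) \<in> Cinf_on \<A> W"
  unfolding Cinf_on_def
proof (clarify)
  fix U \<phi> assume ch: "(U, \<phi>) \<in> \<A>"
  have "smooth_on (\<phi> ` (U \<inter> W)) (\<lambda>z. F ((g \<circ> inv_into U \<phi>) z))"
    by (rule smooth_on_compose[OF assms(1) Cinf_onD[OF assms(2) ch] chart_image_open[OF ch assms(4)] assms(3)])
      (use assms(5) ch in auto)
  then show "smooth_on (\<phi> ` (U \<inter> W)) ((\<lambda>x. F (g x)) \<circ> inv_into U \<phi>)" by (simp add: o_def)
qed

lemma Cinf_on_chart: "(U, \<phi>) \<in> \<A> \<Longrightarrow> \<phi> \<in> Cinf_on \<A> U"
  unfolding Cinf_on_def using chart_transition by blast

lemma Cinf_on_pd: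
  assumes ch: "(U, \<phi>) \<in> \<A>" and f: "f \<in> Cinf_on \<A> W" and W: "open W"
  shows "(\<lambda>x. pd v (f \<circ> inv_into U \<phi>) (\<phi> x)) \<in> Cinf_on \<A> (U \<inter> W)"
proof (rule Cinf_on_compose[OF smooth_on_pd[OF Cinf_onD[OF f ch]]])
  show "\<phi> \<in> Cinf_on \<A> (U \<inter> W)" by (rule Cinf_on_subset[OF Cinf_on_chart[OF ch]]) auto
qed (use chart_open[OF ch] chart_image_open[OF ch W] W in auto)

text \<open>\<open>K\<close> is the image of a compact ball under an inverse chart, hence closed in
  the Hausdorff manifold. So \<open>U\<close> and \<open>- K\<close> are an open cover, and the
  function is smooth on the first and zero on the second. \<open>K\<close> is recorded in the
  statement for use in \<open>Cinf_cutoff\<close>.\<close>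

lemma bump:
  assumes "open W" "p \<in> W"
  obtains \<kappa> :: "'a \<Rightarrow> real" and V K where "\<kappa> \<in> Cinf \<A>" "open V" "p \<in> V" "V \<subseteq> K" "\<And>x. x \<in> V \<Longrightarrow> \<kappa> x = 1"
    "closed K" "K \<subseteq> W" "\<And>x. x \<notin> K \<Longrightarrow> \<kappa> x = 0"
proof -
  obtain U \<phi> where ch: "(U, \<phi>) \<in> \<A>" and pU: "p \<in> U" by (rule chart_at)
  have "open (\<phi> ` (U \<inter> W))" by (rule chart_image_open[OF ch assms(1)])
  then obtain r where r: "r > 0" "cball (\<phi> p) r \<subseteq> \<phi> ` (U \<inter> W)"
    using pU assms(2) open_contains_cball by (metis IntI imageI)
  obtain \<rho> :: "'e \<Rightarrow> real" where \<rho>: "smooth_on UNIV \<rho>" "\<And>y. dist (\<phi> p) y < r / 2 \<Longrightarrow> \<rho> y = 1"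
    "\<And>y. r \<le> dist (\<phi> p) y \<Longrightarrow> \<rho> y = 0"
    using smooth_bump_ball[OF r(1)] by blast
  define \<kappa> where "\<kappa> x = (if x \<in> U then \<rho> (\<phi> x) else 0)" for x
  define K where "K = inv_into U \<phi> ` cball (\<phi> p) r"
  define V where "V = {x \<in> U. \<phi> x \<in> ball (\<phi> p) (r / 2)}"
  have sub: "cball (\<phi> p) r \<subseteq> \<phi> ` U" using r by auto
  have "compact K" unfolding K_def
    by (rule compact_continuous_image[OF continuous_on_subset[OF chart_inv_continuous[OF ch] sub]]) simp
  then have cK: "closed K" by (rule compact_imp_closed)
  have KW: "K \<subseteq> W" "K \<subseteq> U" unfolding K_def using r ch by (auto simp: image_subset_iff subset_iff image_iff)
  have inK: "x \<in> K" if "x \<in> U" "dist (\<phi> p) (\<phi> x) \<le> r" for x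
    unfolding K_def using that ch by (intro image_eqI[of _ _ "\<phi> x"]) auto
  have out: "\<kappa> x = 0" if "x \<notin> K" for x
    using \<rho>(3)[of "\<phi> x"] inK[of x] that by (force simp: \<kappa>_def)
  have "\<kappa> \<in> Cinf_on \<A> U"
  proof (rule Cinf_on_cong[OF _ chart_open[OF ch]])
    show "(\<lambda>x. \<rho> (\<phi> x)) \<in> Cinf_on \<A> U"
      by (rule Cinf_on_compose[OF \<rho>(1) Cinf_on_chart[OF ch]]) (use chart_open[OF ch] in auto)
  qed (simp add: \<kappa>_def)
  moreover have "\<kappa> \<in> Cinf_on \<A> (- K)"
    by (rule Cinf_on_cong[of "\<lambda>x. 0"]) (use out cK in auto)
  ultimately have "\<kappa> \<in> Cinf \<A>"
    by (intro Cinf_on_local) (metis ComplI KW(2) cK chart_open[OF ch] open_Compl subsetD)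
  moreover have "open V" unfolding V_def by (rule chart_preimage_open[OF ch]) simp
  moreover have "p \<in> V" using pU r by (simp add: V_def)
  moreover have "V \<subseteq> K"
  proof
    fix x assume "x \<in> V"
    then show "x \<in> K" using r(1) by (intro inK) (auto simp: V_def)
  qed
  moreover have "\<And>x. x \<in> V \<Longrightarrow> \<kappa> x = 1" using \<rho>(2) by (auto simp: V_def \<kappa>_def)
  ultimately show thesis using that cK KW out by blast
qed

lemma Cinf_cutoff:
  fixes f :: "'a \<Rightarrow> 'c::real_normed_vector"
  assumes "open W" "f \<in> Cinf_on \<A> W" "\<kappa> \<in> Cinf \<A>" "closed K" "K \<subseteq> W" "\<And>x. x \<notin> K \<Longrightarrow> \<kappa> x = 0"
  shows "(\<lambda>x. if x \<in> W then \<kappa> x *\<^sub>R f x else 0) \<in> Cinf \<A>"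
proof -
  let ?g = "\<lambda>x. if x \<in> W then \<kappa> x *\<^sub>R f x else 0"
  have "?g \<in> Cinf_on \<A> W"
    by (rule Cinf_on_cong[OF Cinf_on_scaleR[OF Cinf_imp_Cinf_on[OF assms(3)] assms(2,1)] assms(1)]) simp
  moreover have "?g \<in> Cinf_on \<A> (- K)"
    by (rule Cinf_on_cong[of "\<lambda>x. 0"]) (use assms in auto)
  ultimately show ?thesis
    by (intro Cinf_on_local) (metis ComplI assms(1,4,5) open_Compl subsetD)
qed

lemma Cinf_extend:
  fixes f :: "'a \<Rightarrow> 'c::real_normed_vector"
  assumes "open W" "p \<in> W" "f \<in> Cinf_on \<A> W"
  obtains g V where "g \<in> Cinf \<A>" "open V" "p \<in> V" "V \<subseteq> W" "\<And>x. x \<in> V \<Longrightarrow> g x = f x"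
proof -
  obtain \<kappa> :: "'a \<Rightarrow> real" and V K where b: "\<kappa> \<in> Cinf \<A>" "open V" "p \<in> V" "V \<subseteq> K" "\<And>x. x \<in> V \<Longrightarrow> \<kappa> x = 1"
    "closed K" "K \<subseteq> W" "\<And>x. x \<notin> K \<Longrightarrow> \<kappa> x = 0"
    using bump[OF assms(1,2)] by blast
  show thesis
  proof (rule that[of _ V])
    show "(\<lambda>x. if x \<in> W then \<kappa> x *\<^sub>R f x else 0) \<in> Cinf \<A>"
      by (rule Cinf_cutoff[OF assms(1,3) b(1,6-8)])
  qed (use b in auto)
qed

end

subsection \<open>Products\<close>

lemma prod_atlasE:
  assumes "(S, \<theta>) \<in> prod_atlas \<A> \<B>"
  obtains U \<phi> V \<psi> where "S = U \<times> V" "\<theta> = map_prod \<phi> \<psi>" "(U, \<phi>) \<in> \<A>" "(V, \<psi>) \<in> \<B>"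
  using assms unfolding prod_atlas_def by auto

lemma prod_atlas_iff:
  "c \<in> prod_atlas \<A> \<B> \<longleftrightarrow>
     (\<exists>U \<phi> V \<psi>. c = (U \<times> V, map_prod \<phi> \<psi>) \<and> (U, \<phi>) \<in> \<A> \<and> (V, \<psi>) \<in> \<B>)"
  unfolding prod_atlas_def by auto

lemma prod_atlasI: "(U, \<phi>) \<in> \<A> \<Longrightarrow> (V, \<psi>) \<in> \<B> \<Longrightarrow> (U \<times> V, map_prod \<phi> \<psi>) \<in> prod_atlas \<A> \<B>"
  unfolding prod_atlas_def by auto

lemma inv_into_map_prod:
  assumes "inj_on \<phi> U" "inj_on \<psi> V" "a \<in> \<phi> ` U" "b \<in> \<psi> ` V"
  shows "inv_into (U \<times> V) (map_prod \<phi> \<psi>) (a, b) = (inv_into U \<phi> a, inv_into V \<psi> b)"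
  by (rule inv_into_f_eq) (use assms in \<open>auto intro: map_prod_inj_on\<close>)

locale two_manifolds = T: smooth_manifold \<T> + M: smooth_manifold \<A>
  for \<T> :: "('t::{t2_space,second_countable_topology}, 'f::{real_inner,heine_borel,banach}) atlas"
    and \<A> :: "('a::{t2_space,second_countable_topology}, 'e::{real_inner,heine_borel,banach}) atlas"
begin

lemma inv_chart_prod:
  assumes "(U, \<phi>) \<in> \<T>" "(V, \<psi>) \<in> \<A>" "a \<in> \<phi> ` U" "b \<in> \<psi> ` V"
  shows "inv_into (U \<times> V) (map_prod \<phi> \<psi>) (a, b) = (inv_into U \<phi> a, inv_into V \<psi> b)"
proof (rule inv_into_map_prod[OF _ _ assms(3,4)])
  show "inj_on \<phi> U" by (rule inj_on_inverseI[of _ "inv_into U \<phi>"]) (rule T.chart_inv[OF assms(1)])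
  show "inj_on \<psi> V" by (rule inj_on_inverseI[of _ "inv_into V \<psi>"]) (rule M.chart_inv[OF assms(2)])
qed

lemma map_prod_Times: "map_prod \<phi> \<psi> ` (U \<times> V) = \<phi> ` U \<times> \<psi> ` V"
  by auto

lemma smooth_prod_atlas: "smooth_atlas (prod_atlas \<T> \<A>)"
  unfolding smooth_atlas_def
proof (intro conjI ballI)
  have "z \<in> (\<Union>(U, \<phi>)\<in>prod_atlas \<T> \<A>. U)" for z
  proof -
    obtain U \<phi> where 1: "(U, \<phi>) \<in> \<T>" "fst z \<in> U" by (rule T.chart_at)
    obtain V \<psi> where 2: "(V, \<psi>) \<in> \<A>" "snd z \<in> V" by (rule M.chart_at)
    show ?thesis using prod_atlasI[OF 1(1) 2(1)] 1(2) 2(2)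
      by (intro UN_I[of "(U \<times> V, map_prod \<phi> \<psi>)"]) (auto simp: mem_Times_iff)
  qed
  then show "(\<Union>(U, \<phi>)\<in>prod_atlas \<T> \<A>. U) = UNIV" by auto
next
  fix c assume "c \<in> prod_atlas \<T> \<A>"
  then obtain U \<phi> V \<psi> where c: "c = (U \<times> V, map_prod \<phi> \<psi>)" and 1: "(U, \<phi>) \<in> \<T>" and 2: "(V, \<psi>) \<in> \<A>"
    unfolding prod_atlas_iff by blast
  have "homeomorphism (U \<times> V) (\<phi> ` U \<times> \<psi> ` V) (map_prod \<phi> \<psi>) (inv_into (U \<times> V) (map_prod \<phi> \<psi>))"
  proof (rule homeomorphismI)
    show "continuous_on (U \<times> V) (map_prod \<phi> \<psi>)"
      unfolding map_prod_def case_prod_unfold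
      by (intro continuous_intros continuous_on_compose2[OF T.chart_continuous[OF 1]]
          continuous_on_compose2[OF M.chart_continuous[OF 2]]) auto
    have "continuous_on (\<phi> ` U \<times> \<psi> ` V) (\<lambda>z. (inv_into U \<phi> (fst z), inv_into V \<psi> (snd z)))"
      by (intro continuous_intros continuous_on_compose2[OF T.chart_inv_continuous[OF 1]]
          continuous_on_compose2[OF M.chart_inv_continuous[OF 2]]) auto
    then show "continuous_on (\<phi> ` U \<times> \<psi> ` V) (inv_into (U \<times> V) (map_prod \<phi> \<psi>))"
      by (rule continuous_on_eq) (use inv_chart_prod[OF 1 2] in auto)
  qed (use inv_chart_prod[OF 1 2] 1 2 in \<open>auto simp: T.chart_inv_mem M.chart_inv_mem f_inv_into_f\<close>)
  then show "case c of (U, \<phi>) \<Rightarrow> open U \<and> open (\<phi> ` U) \<and> homeomorphism U (\<phi> ` U) \<phi> (inv_into U \<phi>)"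
    using T.chart_open[OF 1] M.chart_open[OF 2] T.chart_open_image[OF 1] M.chart_open_image[OF 2]
    by (simp add: c map_prod_Times open_Times)
next
  fix c assume "c \<in> prod_atlas \<T> \<A>"
  then obtain U \<phi> V \<psi> where c: "c = (U \<times> V, map_prod \<phi> \<psi>)" and 1: "(U, \<phi>) \<in> \<T>" and 2: "(V, \<psi>) \<in> \<A>"
    unfolding prod_atlas_iff by blast
  show "case c of (U, \<phi>) \<Rightarrow> \<forall>(U', \<phi>')\<in>prod_atlas \<T> \<A>.
      smooth_on (\<phi> ` (U \<inter> U')) (\<phi>' \<circ> inv_into U \<phi>)"
    unfolding c prod.case
  proof (rule ballI)
    fix c' assume "c' \<in> prod_atlas \<T> \<A>"
    then obtain U' \<phi>' V' \<psi>' where c': "c' = (U' \<times> V', map_prod \<phi>' \<psi>')"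
      and 3: "(U', \<phi>') \<in> \<T>" and 4: "(V', \<psi>') \<in> \<A>"
      unfolding prod_atlas_iff by blast
    let ?S = "\<phi> ` (U \<inter> U')" and ?T = "\<psi> ` (V \<inter> V')"
    have op: "open ?S" "open ?T"
      using T.chart_image_open[OF 1 T.chart_open[OF 3]] M.chart_image_open[OF 2 M.chart_open[OF 4]] by auto
    have "smooth_on (?S \<times> ?T) (\<lambda>z. ((\<phi>' \<circ> inv_into U \<phi>) (fst z), (\<psi>' \<circ> inv_into V \<psi>) (snd z)))"
      by (intro smooth_on_Pair smooth_on_compose[OF T.chart_transition[OF 1 3]]
          smooth_on_compose[OF M.chart_transition[OF 2 4]] open_Times op smooth_on_fst smooth_on_snd) auto
    then have "smooth_on (?S \<times> ?T) (map_prod \<phi>' \<psi>' \<circ> inv_into (U \<times> V) (map_prod \<phi> \<psi>))"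
      by (rule smooth_on_cong) (use op inv_chart_prod[OF 1 2] in \<open>auto simp: open_Times\<close>)
    moreover have "map_prod \<phi> \<psi> ` (U \<times> V \<inter> U' \<times> V') = ?S \<times> ?T"
      by (simp add: Times_Int_Times map_prod_Times)
    ultimately show "case c' of (U', \<phi>') \<Rightarrow> smooth_on (map_prod \<phi> \<psi> ` (U \<times> V \<inter> U'))
        (\<phi>' \<circ> inv_into (U \<times> V) (map_prod \<phi> \<psi>))"
      by (simp add: c')
  qed
qed

sublocale P: smooth_manifold "prod_atlas \<T> \<A>"
  by unfold_locales (rule smooth_prod_atlas)

lemma Cinf_slice:
  assumes "f \<in> Cinf (prod_atlas \<T> \<A>)"
  shows "(\<lambda>x. f (\<sigma>, x)) \<in> Cinf \<A>"
  unfolding Cinf_on_def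
proof (clarify)
  fix V \<psi> assume 2: "(V, \<psi>) \<in> \<A>"
  obtain U \<phi> where 1: "(U, \<phi>) \<in> \<T>" "\<sigma> \<in> U" by (rule T.chart_at)
  have op: "open (\<psi> ` V)" "open (\<phi> ` U)"
    using M.chart_open_image[OF 2] T.chart_open_image[OF 1(1)] by auto
  have "smooth_on (\<psi> ` V) (\<lambda>y. (f \<circ> inv_into (U \<times> V) (map_prod \<phi> \<psi>)) (\<phi> \<sigma>, y))"
    by (rule smooth_on_compose[OF P.CinfD[OF assms prod_atlasI[OF 1(1) 2]]])
      (use op 1 in \<open>auto simp: map_prod_Times open_Times intro!: smooth_on_Pair\<close>)
  then show "smooth_on (\<psi> ` (V \<inter> UNIV)) ((\<lambda>x. f (\<sigma>, x)) \<circ> inv_into V \<psi>)"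
    unfolding Int_UNIV_right
    by (rule smooth_on_cong) (use op inv_chart_prod[OF 1(1) 2] 1 2 in auto)
qed

lemma Cinf_on_snd:
  assumes "g \<in> Cinf_on \<A> W" "open W"
  shows "(\<lambda>z. g (snd z)) \<in> Cinf_on (prod_atlas \<T> \<A>) (UNIV \<times> W)"
  unfolding Cinf_on_def
proof (clarify)
  fix S \<theta> assume "(S, \<theta>) \<in> prod_atlas \<T> \<A>"
  then obtain U \<phi> V \<psi> where S: "S = U \<times> V" "\<theta> = map_prod \<phi> \<psi>" and 1: "(U, \<phi>) \<in> \<T>" and 2: "(V, \<psi>) \<in> \<A>"
    by (rule prod_atlasE)
  have op: "open (\<phi> ` U)" "open (\<psi> ` (V \<inter> W))"
    using M.chart_image_open[OF 2 assms(2)] T.chart_open_image[OF 1(1)] by auto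
  have "smooth_on (\<phi> ` U \<times> \<psi> ` (V \<inter> W)) (\<lambda>z. (g \<circ> inv_into V \<psi>) (snd z))"
    by (rule smooth_on_compose[OF M.Cinf_onD[OF assms(1) 2]]) (use op in \<open>auto intro: open_Times\<close>)
  then have "smooth_on (\<phi> ` U \<times> \<psi> ` (V \<inter> W)) ((\<lambda>z. g (snd z)) \<circ> inv_into S \<theta>)"
    by (rule smooth_on_cong) (use op inv_chart_prod[OF 1 2] in \<open>auto simp: S intro: open_Times\<close>)
  moreover have "\<theta> ` (S \<inter> UNIV \<times> W) = \<phi> ` U \<times> \<psi> ` (V \<inter> W)"
    by (simp add: S Times_Int_Times map_prod_Times)
  ultimately show "smooth_on (\<theta> ` (S \<inter> UNIV \<times> W)) ((\<lambda>z. g (snd z)) \<circ> inv_into S \<theta>)" by simp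
qed

lemma Cinf_snd: "g \<in> Cinf \<A> \<Longrightarrow> (\<lambda>z. g (snd z)) \<in> Cinf (prod_atlas \<T> \<A>)"
  using Cinf_on_snd[of g UNIV] by simp

end

section \<open>Tangent vectors and local frames\<close>

lemma pd_linear_combination:
  fixes F G :: "'e::real_normed_vector \<Rightarrow> 'k::real_normed_algebra"
  assumes "F differentiable (at z)" "G differentiable (at z)"
  shows "pd v (\<lambda>z. a * F z + b * G z) z = a * pd v F z + b * pd v G z"
  by (rule pd_eqI) (use assms[unfolded frechet_derivative_works] in \<open>auto intro!: derivative_eq_intros\<close>)

lemma pd_mult:
  fixes F G :: "'e::real_normed_vector \<Rightarrow> 'k::real_normed_algebra"
  assumes "F differentiable (at z)" "G differentiable (at z)"
  shows "pd v (\<lambda>z. F z * G z) z = pd v F z * G z + F z * pd v G z"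
  using pd_eqI[OF has_derivative_mult[OF assms[unfolded frechet_derivative_works]]]
  by (simp add: add.commute)

context smooth_manifold
begin

lemma Cinf_add: "f \<in> Cinf \<A> \<Longrightarrow> g \<in> Cinf \<A> \<Longrightarrow> (\<lambda>x. f x + g x) \<in> Cinf \<A>"
  by (rule Cinf_on_add) auto

lemma Cinf_mult:
  fixes f g :: "'a \<Rightarrow> 'k::real_normed_algebra"
  shows "f \<in> Cinf \<A> \<Longrightarrow> g \<in> Cinf \<A> \<Longrightarrow> (\<lambda>x. f x * g x) \<in> Cinf \<A>"
  by (rule Cinf_on_mult) auto

lemma Cinf_lin:
  fixes f g :: "'a \<Rightarrow> 'k::real_normed_algebra"
  shows "f \<in> Cinf \<A> \<Longrightarrow> g \<in> Cinf \<A> \<Longrightarrow> (\<lambda>x. a * f x + b * g x) \<in> Cinf \<A>"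
  by (intro Cinf_add Cinf_mult Cinf_on_const)

lemma Cinf_diff:
  fixes f g :: "'a \<Rightarrow> 'k::real_normed_algebra_1"
  shows "f \<in> Cinf \<A> \<Longrightarrow> g \<in> Cinf \<A> \<Longrightarrow> (\<lambda>x. f x - g x) \<in> Cinf \<A>"
  using Cinf_lin[of f g 1 "-1"] by simp

lemma Cinf_sum: "(\<And>i. i \<in> I \<Longrightarrow> f i \<in> Cinf \<A>) \<Longrightarrow> (\<lambda>x. \<Sum>i\<in>I. f i x) \<in> Cinf \<A>"
  by (rule Cinf_on_sum) auto

lemma Cinf_of_real:
  "f \<in> Cinf \<A> \<Longrightarrow> (\<lambda>x. of_real (f x) :: 'k::{real_normed_field}) \<in> Cinf \<A>"
  by (rule Cinf_on_bounded_linear[OF bounded_linear_of_real]) auto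

lemma tangentI:
  assumes "\<And>f. f \<notin> Cinf \<A> \<Longrightarrow> v f = 0"
    and "\<And>f g a b. f \<in> Cinf \<A> \<Longrightarrow> g \<in> Cinf \<A> \<Longrightarrow> v (\<lambda>x. a * f x + b * g x) = a * v f + b * v g"
    and "\<And>f g. f \<in> Cinf \<A> \<Longrightarrow> g \<in> Cinf \<A> \<Longrightarrow> v (\<lambda>x. f x * g x) = v f * g p + f p * v g"
  shows "v \<in> tangent \<A> p"
  using assms unfolding tangent_def by blast

context
  fixes v :: "('a \<Rightarrow> 'k::{real_normed_field,banach}) \<Rightarrow> 'k" and p
  assumes v: "v \<in> tangent \<A> p"
begin

lemma tangent_nonsmooth: "f \<notin> Cinf \<A> \<Longrightarrow> v f = 0"
  using v unfolding tangent_def by blast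

lemma tangent_lin:
  "f \<in> Cinf \<A> \<Longrightarrow> g \<in> Cinf \<A> \<Longrightarrow> v (\<lambda>x. a * f x + b * g x) = a * v f + b * v g"
  using v unfolding tangent_def by blast

lemma tangent_mult:
  "f \<in> Cinf \<A> \<Longrightarrow> g \<in> Cinf \<A> \<Longrightarrow> v (\<lambda>x. f x * g x) = v f * g p + f p * v g"
  using v unfolding tangent_def by blast

lemma tangent_add: "f \<in> Cinf \<A> \<Longrightarrow> g \<in> Cinf \<A> \<Longrightarrow> v (\<lambda>x. f x + g x) = v f + v g"
  using tangent_lin[of f g 1 1] by simp

lemma tangent_diff: "f \<in> Cinf \<A> \<Longrightarrow> g \<in> Cinf \<A> \<Longrightarrow> v (\<lambda>x. f x - g x) = v f - v g"
  using tangent_lin[of f g 1 "-1"] by simp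

lemma tangent_const [simp]: "v (\<lambda>x. c) = 0"
proof -
  have "v (\<lambda>x. 1 * 1) = v (\<lambda>x. 1) + v (\<lambda>x. 1)" by (subst tangent_mult) auto
  then have "v (\<lambda>x. 1) = 0" by simp
  then show ?thesis using tangent_lin[of "\<lambda>x. 1" "\<lambda>x. 1" c 0] by simp
qed

lemma tangent_scale: "f \<in> Cinf \<A> \<Longrightarrow> v (\<lambda>x. c * f x) = c * v f"
  using tangent_lin[of f f c 0] by simp

lemma tangent_sum:
  "(\<And>i. i \<in> I \<Longrightarrow> f i \<in> Cinf \<A>) \<Longrightarrow> v (\<lambda>x. \<Sum>i\<in>I. f i x) = (\<Sum>i\<in>I. v (f i))"
  by (induction I rule: infinite_finite_induct) (simp_all add: tangent_add Cinf_sum)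

text \<open>The difference of the two functions equals its own product with 1 minus a bump function
  supported in \<open>V\<close>. Both factors vanish at \<open>p\<close>, so the Leibniz rule gives
  0.\<close>

lemma tangent_local:
  assumes "f \<in> Cinf \<A>" "g \<in> Cinf \<A>" "open V" "p \<in> V" "\<And>x. x \<in> V \<Longrightarrow> f x = g x"
  shows "v f = v g"
proof -
  obtain \<kappa> :: "'a \<Rightarrow> real" and W K where b: "\<kappa> \<in> Cinf \<A>" "p \<in> W" "\<And>x. x \<in> W \<Longrightarrow> \<kappa> x = 1"
    "K \<subseteq> V" "\<And>x. x \<notin> K \<Longrightarrow> \<kappa> x = 0"
    using bump[OF assms(3,4)] by metis
  define d where "d x = f x - g x" for x
  define k where "k x = 1 - (of_real (\<kappa> x) :: 'k)" for x
  have dC: "d \<in> Cinf \<A>" unfolding d_def by (rule Cinf_diff[OF assms(1,2)])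
  have kC: "k \<in> Cinf \<A>" unfolding k_def by (intro Cinf_diff Cinf_of_real Cinf_on_const b)
  have "d x = k x * d x" for x
    using b(4) b(5)[of x] assms(5)[of x] by (cases "x \<in> V") (auto simp: k_def d_def)
  then have "v d = v (\<lambda>x. k x * d x)" by (intro arg_cong[of d _ v] ext)
  also have "\<dots> = v k * d p + k p * v d" by (rule tangent_mult[OF kC dC])
  also have "\<dots> = 0"
    using b(2,3) assms(4,5) by (simp add: k_def d_def)
  finally show ?thesis
    unfolding d_def using tangent_diff[OF assms(1,2)] by simp
qed

end

lemma tangent_comb:
  assumes "v \<in> tangent \<A> p" "w \<in> tangent \<A> p"
  shows "(\<lambda>f. a * v f + b * w f) \<in> tangent \<A> (p :: 'a)"
  using assms unfolding tangent_def
  by (auto simp: algebra_simps)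

lemma tangent_zero: "0 \<in> tangent \<A> p" "(\<lambda>f. 0) \<in> tangent \<A> p"
  by (auto simp: tangent_def)

lemma tangent_comb_sum:
  assumes "\<And>i. i \<in> I \<Longrightarrow> v i \<in> tangent \<A> p"
  shows "(\<lambda>f. \<Sum>i\<in>I. a i * v i f) \<in> tangent \<A> p"
  using assms
proof (induction I rule: infinite_finite_induct)
  case (insert i I)
  then show ?case using tangent_comb[of "v i" p "\<lambda>f. \<Sum>i\<in>I. a i * v i f" "a i" 1] by simp
qed (simp_all add: tangent_zero)

lemma vfields_tangent: "X \<in> vfields \<A> \<Longrightarrow> vat X p \<in> tangent \<A> p"
  and vfields_Cinf: "X \<in> vfields \<A> \<Longrightarrow> f \<in> Cinf \<A> \<Longrightarrow> X f \<in> Cinf \<A>"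
  by (auto simp: vfields_def)

lemma vat_apply [simp]: "vat X p f = X f p"
  by (simp add: vat_def)

lemmas vfields_lin = vfields_tangent[THEN tangent_lin, simplified]
  and vfields_mult = vfields_tangent[THEN tangent_mult, simplified]
  and vfields_add = vfields_tangent[THEN tangent_add, simplified]
  and vfields_const = vfields_tangent[THEN tangent_const, simplified]
  and vfields_sum = vfields_tangent[THEN tangent_sum, simplified]
  and vfields_local = vfields_tangent[THEN tangent_local, simplified]

lemma vfields_nonsmooth:
  fixes X :: "('a \<Rightarrow> 'k::{real_normed_field,banach}) \<Rightarrow> 'a \<Rightarrow> 'k"
  shows "X \<in> vfields \<A> \<Longrightarrow> f \<notin> Cinf \<A> \<Longrightarrow> X f = 0"
  using vfields_tangent[THEN tangent_nonsmooth, of X f] by (auto simp: fun_eq_iff)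

lemma vfields_comb_sum:
  fixes X :: "'i \<Rightarrow> ('a \<Rightarrow> 'k::{real_normed_field,banach}) \<Rightarrow> 'a \<Rightarrow> 'k"
  assumes "\<And>i. i \<in> I \<Longrightarrow> X i \<in> vfields \<A>" "\<And>i. i \<in> I \<Longrightarrow> u i \<in> Cinf \<A>"
  shows "(\<lambda>f x. \<Sum>i\<in>I. u i x * X i f x) \<in> vfields \<A>"
  unfolding vfields_def
proof (intro CollectI conjI allI ballI)
  fix p
  have "(\<lambda>f. \<Sum>i\<in>I. u i p * vat (X i) p f) \<in> tangent \<A> p"
    by (rule tangent_comb_sum) (use assms vfields_tangent in blast)
  then show "vat (\<lambda>f x. \<Sum>i\<in>I. u i x * X i f x) p \<in> tangent \<A> p"
    by (simp add: vat_def)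
next
  fix f :: "'a \<Rightarrow> 'k" assume "f \<in> Cinf \<A>"
  then have "X i f \<in> Cinf \<A>" if "i \<in> I" for i
    by (rule vfields_Cinf[OF assms(1)[OF that]])
  then show "(\<lambda>x. \<Sum>i\<in>I. u i x * X i f x) \<in> Cinf \<A>"
    by (intro Cinf_sum Cinf_mult assms(2))
qed

lemma vfields_lie_bracket:
  fixes X Y :: "('a \<Rightarrow> 'k::{real_normed_field,banach}) \<Rightarrow> 'a \<Rightarrow> 'k"
  assumes X: "X \<in> vfields \<A>" and Y: "Y \<in> vfields \<A>"
  shows "lie_bracket X Y \<in> vfields \<A>"
  unfolding vfields_def
proof (intro CollectI conjI allI ballI)
  note XC = vfields_Cinf[OF X] and YC = vfields_Cinf[OF Y]
  fix p
  show "vat (lie_bracket X Y) p \<in> tangent \<A> p"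
  proof (rule tangentI)
    fix f :: "'a \<Rightarrow> 'k" assume "f \<notin> Cinf \<A>"
    then show "vat (lie_bracket X Y) p f = 0"
      using vfields_const[OF X, of 0] vfields_const[OF Y, of 0]
      by (simp add: lie_bracket_def vfields_nonsmooth X Y zero_fun_def)
  next
    fix f g :: "'a \<Rightarrow> 'k" and a b assume fg: "f \<in> Cinf \<A>" "g \<in> Cinf \<A>"
    have "X (\<lambda>x. a * f x + b * g x) = (\<lambda>x. a * X f x + b * X g x)"
      "Y (\<lambda>x. a * f x + b * g x) = (\<lambda>x. a * Y f x + b * Y g x)"
      using vfields_lin[OF X fg] vfields_lin[OF Y fg] by auto
    then show "vat (lie_bracket X Y) p (\<lambda>x. a * f x + b * g x)
        = a * vat (lie_bracket X Y) p f + b * vat (lie_bracket X Y) p g"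
      using vfields_lin[OF X YC[OF fg(1)] YC[OF fg(2)], of a b p]
        vfields_lin[OF Y XC[OF fg(1)] XC[OF fg(2)], of a b p]
      by (simp add: lie_bracket_def algebra_simps)
    have "X (\<lambda>x. f x * g x) = (\<lambda>x. X f x * g x + f x * X g x)"
      "Y (\<lambda>x. f x * g x) = (\<lambda>x. Y f x * g x + f x * Y g x)"
      using vfields_mult[OF X fg] vfields_mult[OF Y fg] by auto
    moreover have "X (\<lambda>x. Y f x * g x + f x * Y g x) p
        = X (Y f) p * g p + Y f p * X g p + (X f p * Y g p + f p * X (Y g) p)"
      using fg by (simp add: vfields_add[OF X] vfields_mult[OF X] Cinf_mult YC)
    moreover have "Y (\<lambda>x. X f x * g x + f x * X g x) p
        = Y (X f) p * g p + X f p * Y g p + (Y f p * X g p + f p * Y (X g) p)"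
      using fg by (simp add: vfields_add[OF Y] vfields_mult[OF Y] Cinf_mult XC)
    ultimately show "vat (lie_bracket X Y) p (\<lambda>x. f x * g x)
        = vat (lie_bracket X Y) p f * g p + f p * vat (lie_bracket X Y) p g"
      by (simp add: lie_bracket_def algebra_simps)
  qed
next
  fix f :: "'a \<Rightarrow> 'k" assume "f \<in> Cinf \<A>"
  then show "lie_bracket X Y f \<in> Cinf \<A>"
    using Cinf_diff[OF vfields_Cinf[OF X vfields_Cinf[OF Y]] vfields_Cinf[OF Y vfields_Cinf[OF X]]]
    by (simp add: lie_bracket_def fun_diff_def)
qed

text \<open>\<open>X e\<close> are local coordinates, extended from \<open>V\<close> to the whole manifold, and \<open>E e\<close> the
  coordinate vector fields.\<close>

definition frame ::
  "'a set \<Rightarrow> ('e \<Rightarrow> 'a \<Rightarrow> 'k::{real_normed_field,banach}) \<Rightarrow> ('e \<Rightarrow> ('a \<Rightarrow> 'k) \<Rightarrow> 'a \<Rightarrow> 'k) \<Rightarrow> bool"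
  where
  "frame V X E \<longleftrightarrow> open V \<and> (\<forall>e\<in>onb. X e \<in> Cinf \<A> \<and> E e \<in> vfields \<A>) \<and>
     (\<forall>d\<in>onb. \<forall>e\<in>onb. \<forall>y\<in>V. E d (X e) y = (if d = e then 1 else 0)) \<and>
     (\<forall>y\<in>V. \<forall>v\<in>tangent \<A> y. \<forall>f\<in>Cinf \<A>. v f = (\<Sum>e\<in>onb. v (X e) * E e f y))"

text \<open>Around each \<open>y\<close> in \<open>V\<close>, Hadamard's formula writes
  \<open>f\<close> as \<open>f y\<close> plus products of \<open>X b x - X b y\<close>, which vanish
  at \<open>y\<close>, with smooth functions \<open>G b\<close>; the Leibniz rule leaves
  \<open>v (X b) * G b y\<close>. So a tangent vector, though defined as a derivation, is determined
  by its values on the coordinates.\<close>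

lemma ex_frame:
  assumes ch: "(U, \<phi>) \<in> \<A>" and pU: "p \<in> U"
  obtains V and X :: "'e \<Rightarrow> 'a \<Rightarrow> 'k::{real_normed_field,banach}" and E where "frame V X E" "p \<in> V" "V \<subseteq> U"
    "\<And>e f y. e \<in> onb \<Longrightarrow> f \<in> Cinf \<A> \<Longrightarrow> y \<in> V \<Longrightarrow> E e f y = pd e (f \<circ> inv_into U \<phi>) (\<phi> y)"
proof -
  let ?\<psi> = "inv_into U \<phi>"
  have U: "open U" "open (\<phi> ` U)" by (rule chart_open[OF ch], rule chart_open_image[OF ch])
  obtain \<kappa> :: "'a \<Rightarrow> real" and V K where b: "\<kappa> \<in> Cinf \<A>" "open V" "p \<in> V" "V \<subseteq> K"
    "\<And>x. x \<in> V \<Longrightarrow> \<kappa> x = 1" "closed K" "K \<subseteq> U" "\<And>x. x \<notin> K \<Longrightarrow> \<kappa> x = 0"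
    using bump[OF U(1) pU] by blast
  have VU: "V \<subseteq> U" using b by auto
  define X where "X e x = (if x \<in> U then \<kappa> x *\<^sub>R (of_real (\<phi> x \<bullet> e) :: 'k) else 0)" for e x
  \<comment> \<open>The cutoff makes the field global; the inner case distinction is the
    normalisation that a tangent vector vanishes on nonsmooth functions.\<close>
  define E where "E e f x = (if x \<in> U then \<kappa> x *\<^sub>R (if f \<in> Cinf \<A> then pd e (f \<circ> ?\<psi>) (\<phi> x) else 0) else 0)"
    for e and f :: "'a \<Rightarrow> 'k" and x
  have XC: "X e \<in> Cinf \<A>" for e
    unfolding X_def
    by (intro Cinf_cutoff[OF U(1) _ b(1,6-8)] Cinf_on_bounded_linear[OF _ Cinf_on_chart[OF ch] U(1)]
        bounded_linear_compose[OF bounded_linear_of_real] bounded_linear_inner_left)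
  have diff: "(f \<circ> ?\<psi>) differentiable (at (\<phi> x))" if "f \<in> Cinf \<A>" "x \<in> U" for f :: "'a \<Rightarrow> 'k" and x
    by (rule smooth_on_differentiable[OF CinfD[OF that(1) ch]]) (use that in auto)
  have Ev: "E e \<in> vfields \<A>" for e
    unfolding vfields_def
  proof (intro CollectI conjI allI ballI)
    fix q
    show "vat (E e) q \<in> tangent \<A> q"
    proof (rule tangentI)
      fix f g :: "'a \<Rightarrow> 'k" and a b assume fg: "f \<in> Cinf \<A>" "g \<in> Cinf \<A>"
      have "pd e ((\<lambda>x. a * f x + b * g x) \<circ> ?\<psi>) (\<phi> q) = a * pd e (f \<circ> ?\<psi>) (\<phi> q) + b * pd e (g \<circ> ?\<psi>) (\<phi> q)"
        if "q \<in> U"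
        using pd_linear_combination[OF diff[OF fg(1) that] diff[OF fg(2) that], where v = e and a = a and b = b] by (simp add: o_def)
      then show "vat (E e) q (\<lambda>x. a * f x + b * g x) = a * vat (E e) q f + b * vat (E e) q g"
        using fg by (simp add: E_def Cinf_lin scaleR_conv_of_real algebra_simps)
      have "pd e ((\<lambda>x. f x * g x) \<circ> ?\<psi>) (\<phi> q) = pd e (f \<circ> ?\<psi>) (\<phi> q) * g q + f q * pd e (g \<circ> ?\<psi>) (\<phi> q)"
        if "q \<in> U"
        using pd_mult[OF diff[OF fg(1) that] diff[OF fg(2) that], where v = e] that ch by (simp add: o_def)
      then show "vat (E e) q (\<lambda>x. f x * g x) = vat (E e) q f * g q + f q * vat (E e) q g"
        using fg by (simp add: E_def Cinf_mult scaleR_conv_of_real algebra_simps)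
    qed (simp add: E_def)
  next
    fix f :: "'a \<Rightarrow> 'k" assume f: "f \<in> Cinf \<A>"
    have "(\<lambda>x. pd e (f \<circ> ?\<psi>) (\<phi> x)) \<in> Cinf_on \<A> U"
      using Cinf_on_pd[OF ch f] by simp
    from Cinf_cutoff[OF U(1) this b(1,6-8)]
    have "(\<lambda>x. if x \<in> U then \<kappa> x *\<^sub>R pd e (f \<circ> ?\<psi>) (\<phi> x) else 0) \<in> Cinf \<A>" .
    moreover have "E e f = (\<lambda>x. if x \<in> U then \<kappa> x *\<^sub>R pd e (f \<circ> ?\<psi>) (\<phi> x) else 0)"
      using f by (simp add: E_def fun_eq_iff)
    ultimately show "E e f \<in> Cinf \<A>" by simp
  qed
  have EV: "E e f y = pd e (f \<circ> ?\<psi>) (\<phi> y)" if "f \<in> Cinf \<A>" "y \<in> V" for e f y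
    using that b(5) VU by (auto simp: E_def)
  have XV: "X e y = of_real (\<phi> y \<bullet> e)" if "y \<in> V" for e y
    using that b(5) VU by (auto simp: X_def)
  have opV: "open (\<phi> ` V)" using chart_image_open[OF ch b(2)] VU by (simp add: Int_absorb1)
  have dual: "E d (X e) y = (if d = e then 1 else 0)" if "d \<in> onb" "e \<in> onb" "y \<in> V" for d e y
  proof -
    have "((\<lambda>z. of_real (z \<bullet> e) :: 'k) has_derivative (\<lambda>h. of_real (h \<bullet> e))) (at (\<phi> y))"
      by (intro bounded_linear_imp_has_derivative bounded_linear_compose[OF bounded_linear_of_real]
          bounded_linear_inner_left)
    then have "((X e \<circ> ?\<psi>) has_derivative (\<lambda>h. of_real (h \<bullet> e))) (at (\<phi> y))"
      by (rule has_derivative_transform_within_open[OF _ opV]) (use that XV VU ch in auto)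
    then have "E d (X e) y = of_real (d \<bullet> e)" using that(3) by (simp add: EV XC pd_eqI)
    then show ?thesis using inner_onb[OF that(1,2)] by simp
  qed
  have expand: "v f = (\<Sum>e\<in>onb. v (X e) * E e f y)"
    if y: "y \<in> V" and v: "v \<in> tangent \<A> y" and f: "f \<in> Cinf \<A>" for y v f
  proof -
    have yU: "y \<in> U" using y VU by auto
    then obtain r0 where r0: "r0 > 0" "ball (\<phi> y) r0 \<subseteq> \<phi> ` U" using U(2) openE by blast
    define r where "r = r0 / 2"
    have r: "r > 0" "ball (\<phi> y) (2 * r) \<subseteq> \<phi> ` U" using r0 by (auto simp: r_def)
    obtain g where g: "\<And>b. smooth_on (ball (\<phi> y) r) (g b)" "\<And>b. g b (\<phi> y) = pd b (f \<circ> ?\<psi>) (\<phi> y)"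
      "\<And>z. z \<in> ball (\<phi> y) r \<Longrightarrow> (f \<circ> ?\<psi>) z = (f \<circ> ?\<psi>) (\<phi> y) + (\<Sum>b\<in>onb. ((z - \<phi> y) \<bullet> b) *\<^sub>R g b z)"
      using hadamard[OF r(1) smooth_on_subset[OF CinfD[OF f ch] r(2)]] by blast
    define W where "W = {x \<in> U. \<phi> x \<in> ball (\<phi> y) r}"
    have W: "open W" "y \<in> W" unfolding W_def
      using chart_preimage_open[OF ch, of "ball (\<phi> y) r"] yU r(1) by auto
    obtain \<kappa>' :: "'a \<Rightarrow> real" and V' K' where b': "\<kappa>' \<in> Cinf \<A>" "open V'" "y \<in> V'" "V' \<subseteq> K'"
      "\<And>x. x \<in> V' \<Longrightarrow> \<kappa>' x = 1" "closed K'" "K' \<subseteq> W" "\<And>x. x \<notin> K' \<Longrightarrow> \<kappa>' x = 0"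
      using bump[OF W] by blast
    \<comment> \<open>The Hadamard coefficients live near \<open>y\<close> only, but
      \<open>v\<close> takes global functions, hence a second cutoff.\<close>
    define G where "G b x = (if x \<in> W then \<kappa>' x *\<^sub>R g b (\<phi> x) else 0)" for b x
    have GC: "G b \<in> Cinf \<A>" for b
      unfolding G_def
    proof (rule Cinf_cutoff[OF W(1) _ b'(1,6-8)])
      show "(\<lambda>x. g b (\<phi> x)) \<in> Cinf_on \<A> W"
        by (rule Cinf_on_compose[OF g(1) Cinf_on_subset[OF Cinf_on_chart[OF ch]]]) (use W in \<open>auto simp: W_def\<close>)
    qed
    have DC: "(\<lambda>x. X b x - X b y) \<in> Cinf \<A>" for b by (intro Cinf_diff XC Cinf_on_const)
    have "v f = v (\<lambda>x. f y + (\<Sum>b\<in>onb. (X b x - X b y) * G b x))"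
    proof (rule tangent_local[OF v f])
      show "(\<lambda>x. f y + (\<Sum>b\<in>onb. (X b x - X b y) * G b x)) \<in> Cinf \<A>"
        by (intro Cinf_add Cinf_sum Cinf_mult GC DC Cinf_on_const)
      show "open (V \<inter> V')" "y \<in> V \<inter> V'" using b b' y by auto
      fix x assume x: "x \<in> V \<inter> V'"
      then have "x \<in> W" using b' by auto
      then have z: "\<phi> x \<in> ball (\<phi> y) r" "x \<in> U" by (auto simp: W_def)
      have "G b x = g b (\<phi> x)" for b using x b'(5)[of x] \<open>x \<in> W\<close> by (simp add: G_def)
      then show "f x = f y + (\<Sum>b\<in>onb. (X b x - X b y) * G b x)"
        using g(3)[OF z(1)] z(2) yU x y ch
        by (simp add: XV scaleR_conv_of_real inner_diff_left)
    qed
    also have "\<dots> = (\<Sum>b\<in>onb. v (\<lambda>x. (X b x - X b y) * G b x))"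
      by (simp add: tangent_add[OF v] tangent_sum[OF v] Cinf_sum Cinf_mult GC DC tangent_const[OF v])
    also have "\<dots> = (\<Sum>b\<in>onb. v (X b) * E b f y)"
    proof (rule sum.cong[OF refl])
      fix b :: 'e
      have "G b y = E b f y"
        using b'(3,5) W(2) by (simp add: G_def g(2) EV[OF f y])
      then show "v (\<lambda>x. (X b x - X b y) * G b x) = v (X b) * E b f y"
        by (simp add: tangent_mult[OF v DC GC] tangent_diff[OF v XC] tangent_const[OF v])
    qed
    finally show ?thesis .
  qed
  have "frame V X E" unfolding frame_def using b(2) XC Ev dual expand by blast
  then show thesis using that b(3) VU EV by blast
qed

lemma frame_open: "frame V X E \<Longrightarrow> open V"
  and frame_coord: "frame V X E \<Longrightarrow> e \<in> onb \<Longrightarrow> X e \<in> Cinf \<A>"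
  and frame_vfield: "frame V X E \<Longrightarrow> e \<in> onb \<Longrightarrow> E e \<in> vfields \<A>"
  and frame_dual: "frame V X E \<Longrightarrow> d \<in> onb \<Longrightarrow> e \<in> onb \<Longrightarrow> y \<in> V \<Longrightarrow> E d (X e) y = (if d = e then 1 else 0)"
  and frame_expand: "frame V X E \<Longrightarrow> y \<in> V \<Longrightarrow> v \<in> tangent \<A> y \<Longrightarrow> f \<in> Cinf \<A>
      \<Longrightarrow> v f = (\<Sum>e\<in>onb. v (X e) * E e f y)"
  unfolding frame_def by blast+

lemma frame_at:
  obtains V and X :: "'e \<Rightarrow> 'a \<Rightarrow> 'k::{real_normed_field,banach}" and E where "frame V X E" "p \<in> V"
  by (metis chart_at ex_frame)

lemma tangent_eqI:
  assumes "frame V X E" "y \<in> V" "v \<in> tangent \<A> y" "w \<in> tangent \<A> y" "\<And>e. e \<in> onb \<Longrightarrow> v (X e) = w (X e)"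
  shows "v = w"
proof
  fix f show "v f = w f"
  proof (cases "f \<in> Cinf \<A>")
    case True
    then show ?thesis
      using frame_expand[OF assms(1,2,3) True] frame_expand[OF assms(1,2,4) True] assms(5) by simp
  next
    case False
    then show ?thesis using tangent_nonsmooth[OF assms(3)] tangent_nonsmooth[OF assms(4)] by simp
  qed
qed

lemma frame_expand_vec:
  assumes "frame V X E" "y \<in> V" "v \<in> tangent \<A> y"
  shows "v = (\<lambda>f. \<Sum>e\<in>onb. v (X e) * vat (E e) y f)"
proof
  fix f show "v f = (\<Sum>e\<in>onb. v (X e) * vat (E e) y f)"
  proof (cases "f \<in> Cinf \<A>")
    case True
    then show ?thesis using frame_expand[OF assms True] by simp
  next
    case False
    then show ?thesis using tangent_nonsmooth[OF assms(3)] vfields_nonsmooth[OF frame_vfield[OF assms(1)]]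
      by (simp cong: sum.cong)
  qed
qed

text \<open>Constant coefficients in a frame at \<open>p\<close>. Smoothness of forms and
  compatibility are stated for vector fields; this makes them available at a single tangent
  vector.\<close>

lemma tangent_extend:
  fixes v :: "('a \<Rightarrow> 'k::{real_normed_field,banach}) \<Rightarrow> 'k"
  assumes "v \<in> tangent \<A> p"
  obtains Z where "Z \<in> vfields \<A>" "vat Z p = v"
proof -
  obtain V and X :: "'e \<Rightarrow> 'a \<Rightarrow> 'k" and E where F: "frame V X E" "p \<in> V" by (rule frame_at)
  show thesis
  proof (rule that)
    show "(\<lambda>f x. \<Sum>e\<in>onb. v (X e) * E e f x) \<in> vfields \<A>"
      by (rule vfields_comb_sum) (auto intro: frame_vfield[OF F(1)])
    show "vat (\<lambda>f x. \<Sum>e\<in>onb. v (X e) * E e f x) p = v"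
      using frame_expand_vec[OF F assms] by (simp add: vat_def)
  qed
qed

end

section \<open>Symplectic manifolds\<close>

text \<open>The trivial kernel makes the rows \<open>R i\<close> independent in the space of
  functions supported on \<open>I\<close>, which is spanned by at most \<open>card I\<close> delta
  functions. Were \<open>cut t\<close> outside the span of the rows, adding it to them would give
  too large an independent set.\<close>

lemma square_system_solvable:
  fixes M :: "'i \<Rightarrow> 'i \<Rightarrow> complex"
  assumes "finite I"
    and inj: "\<And>a. (\<And>j. j \<in> I \<Longrightarrow> (\<Sum>i\<in>I. a i * M i j) = 0) \<Longrightarrow> (\<And>i. i \<in> I \<Longrightarrow> a i = 0)"
  obtains a where "\<And>j. j \<in> I \<Longrightarrow> (\<Sum>i\<in>I. a i * M i j) = t j"
proof -
  interpret V: vector_space "\<lambda>(c::complex) (f::'i \<Rightarrow> complex). (\<lambda>i. c * f i)"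
    by unfold_locales (auto simp: fun_eq_iff algebra_simps)
  define \<delta> :: "'i \<Rightarrow> 'i \<Rightarrow> complex" where "\<delta> i = (\<lambda>j. if j = i then 1 else 0)" for i
  define cut :: "('i \<Rightarrow> complex) \<Rightarrow> 'i \<Rightarrow> complex" where "cut f = (\<lambda>j. if j \<in> I then f j else 0)" for f
  define R where "R i = cut (M i)" for i
  have sum_apply: "(\<Sum>x\<in>J. g x) j = (\<Sum>x\<in>J. g x j)" for J and g :: "'x \<Rightarrow> 'i \<Rightarrow> complex" and j
    by (induction J rule: infinite_finite_induct) auto
  have cut_span: "cut f \<in> V.span (\<delta> ` I)" for f
  proof -
    have "cut f = (\<Sum>i\<in>I. (\<lambda>j. f i * \<delta> i j))"
    proof
      fix j
      have "(\<Sum>i\<in>I. f i * \<delta> i j) = (\<Sum>i\<in>I. if j = i then f i else 0)"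
        by (rule sum.cong) (auto simp: \<delta>_def)
      then show "cut f j = (\<Sum>i\<in>I. (\<lambda>j. f i * \<delta> i j)) j"
        using assms(1) by (simp add: sum_apply cut_def sum.delta)
    qed
    also have "\<dots> \<in> V.span (\<delta> ` I)"
      by (intro V.span_sum V.span_scale V.span_base) auto
    finally show ?thesis .
  qed
  have injR: "inj_on R I"
  proof (rule inj_onI, rule ccontr)
    fix i k assume ik: "i \<in> I" "k \<in> I" "R i = R k" "i \<noteq> k"
    define a :: "'i \<Rightarrow> complex" where "a l = \<delta> i l - \<delta> k l" for l
    have "a i = 0"
    proof (rule inj[OF _ ik(1)])
      fix j assume j: "j \<in> I"
      have "(\<Sum>l\<in>I. a l * M l j) = (\<Sum>l\<in>I. if l = i then M l j else 0) - (\<Sum>l\<in>I. if l = k then M l j else 0)"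
        unfolding sum_subtractf[symmetric] by (rule sum.cong) (auto simp: a_def \<delta>_def)
      also have "\<dots> = M i j - M k j" using assms(1) ik by (simp add: sum.delta)
      also have "\<dots> = 0" using ik(3) j by (auto simp: R_def cut_def fun_eq_iff split: if_splits)
      finally show "(\<Sum>l\<in>I. a l * M l j) = 0" .
    qed
    then show False using ik(4) by (simp add: a_def \<delta>_def)
  qed
  have comb: "(\<Sum>v\<in>R ` I. (\<lambda>j. u v * v j)) j = (\<Sum>i\<in>I. u (R i) * M i j)" if "j \<in> I" for u j
  proof -
    have "(\<Sum>v\<in>R ` I. u v * v j) = (\<Sum>i\<in>I. u (R i) * R i j)" by (simp add: sum.reindex[OF injR])
    then show ?thesis unfolding sum_apply using that by (simp add: R_def cut_def)
  qed
  have indep: "\<not> V.dependent (R ` I)"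
    unfolding V.dependent_finite[OF finite_imageI[OF assms(1)]]
  proof clarify
    fix u i assume i: "i \<in> I" "u (R i) \<noteq> 0" and z: "(\<Sum>v\<in>R ` I. (\<lambda>j. u v * v j)) = 0"
    have "u (R i) = 0"
      by (rule inj[OF _ i(1)]) (use comb[of _ u] z in simp)
    with i show False by simp
  qed
  have "cut t \<in> V.span (R ` I)"
  proof (rule ccontr)
    assume n: "cut t \<notin> V.span (R ` I)"
    then have "\<not> V.dependent (insert (cut t) (R ` I))"
      by (rule V.independent_insertI[OF _ indep])
    moreover have "insert (cut t) (R ` I) \<subseteq> V.span (\<delta> ` I)" using cut_span by (auto simp: R_def)
    ultimately have "card (insert (cut t) (R ` I)) \<le> card (\<delta> ` I)"
      using V.independent_span_bound[OF finite_imageI[OF assms(1)]] by blast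
    moreover have "card (insert (cut t) (R ` I)) = Suc (card I)"
    proof -
      have "cut t \<notin> R ` I" using n V.span_base[of "cut t" "R ` I"] by blast
      then show ?thesis using assms(1) by (simp add: card_image[OF injR])
    qed
    ultimately show False using card_image_le[OF assms(1), of \<delta>] by simp
  qed
  then obtain u where u: "cut t = (\<Sum>v\<in>R ` I. (\<lambda>j. u v * v j))"
    unfolding V.span_finite[OF finite_imageI[OF assms(1)]] by auto
  show thesis
  proof (rule that)
    fix j assume j: "j \<in> I"
    show "(\<Sum>i\<in>I. u (R i) * M i j) = t j"
      using comb[OF j, of u] u j by (metis cut_def)
  qed
qed

locale symplectic = smooth_manifold \<A>
  for \<A> :: "('m::{t2_space,second_countable_topology}, 'e::{real_inner,heine_borel,banach}) atlas" +
  fixes \<omega> :: "'m form2"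
  assumes two_form: "real_two_form \<A> \<omega>" and closed: "closed_two_form \<A> \<omega>"
    and nondegenerate: "nondegenerate_form \<A> \<omega>"
begin

abbreviation pb :: "('m \<Rightarrow> complex) \<Rightarrow> ('m \<Rightarrow> complex) \<Rightarrow> 'm \<Rightarrow> complex" where
  "pb \<equiv> poisson \<A> \<omega>"

lemma form_lin_left:
  "u \<in> tangent \<A> p \<Longrightarrow> v \<in> tangent \<A> p \<Longrightarrow> w \<in> tangent \<A> p
    \<Longrightarrow> \<omega> p (\<lambda>f. a * u f + b * v f) w = a * \<omega> p u w + b * \<omega> p v w"
  and form_antisym: "v \<in> tangent \<A> p \<Longrightarrow> w \<in> tangent \<A> p \<Longrightarrow> \<omega> p v w = - \<omega> p w v"
  and form_smooth: "X \<in> vfields \<A> \<Longrightarrow> Z \<in> vfields \<A> \<Longrightarrow> eval2 \<omega> X Z \<in> Cinf \<A>"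
  using two_form unfolding real_two_form_def by blast+

lemma form_zero_left: "w \<in> tangent \<A> p \<Longrightarrow> \<omega> p (\<lambda>f. 0) w = 0"
  using form_lin_left[of w p w w 0 0] by simp

lemma form_sum_left:
  assumes "\<And>i. i \<in> I \<Longrightarrow> v i \<in> tangent \<A> p" "w \<in> tangent \<A> p"
  shows "\<omega> p (\<lambda>f. \<Sum>i\<in>I. a i * v i f) w = (\<Sum>i\<in>I. a i * \<omega> p (v i) w)"
  using assms(1)
proof (induction I rule: infinite_finite_induct)
  case (insert i I)
  then show ?case
    using form_lin_left[of "v i" p "\<lambda>f. \<Sum>i\<in>I. a i * v i f" w "a i" 1] assms(2)
      tangent_comb_sum[of I v p a] by simp
qed (simp_all add: form_zero_left assms)

lemma form_sum_right:
  assumes "\<And>i. i \<in> I \<Longrightarrow> v i \<in> tangent \<A> p" "w \<in> tangent \<A> p"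
  shows "\<omega> p w (\<lambda>f. \<Sum>i\<in>I. a i * v i f) = (\<Sum>i\<in>I. a i * \<omega> p w (v i))"
proof -
  have "\<omega> p w (\<lambda>f. \<Sum>i\<in>I. a i * v i f) = - (\<Sum>i\<in>I. a i * \<omega> p (v i) w)"
    using form_antisym[OF assms(2) tangent_comb_sum[of I v p a]] form_sum_left[of I v p w a] assms by simp
  also have "\<dots> = (\<Sum>i\<in>I. a i * \<omega> p w (v i))"
    unfolding sum_negf[symmetric] using form_antisym[OF _ assms(2)] assms(1) by (auto intro!: sum.cong)
  finally show ?thesis .
qed

lemma form_frame_left:
  assumes "frame V X E" "y \<in> V" "v \<in> tangent \<A> y" "w \<in> tangent \<A> y"
  shows "\<omega> y v w = (\<Sum>e\<in>onb. v (X e) * \<omega> y (vat (E e) y) w)"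
  by (subst frame_expand_vec[OF assms(1-3)], rule form_sum_left)
    (rule vfields_tangent[OF frame_vfield[OF assms(1)]], assumption, rule assms(4))

lemma form_frame_right:
  assumes "frame V X E" "y \<in> V" "v \<in> tangent \<A> y" "w \<in> tangent \<A> y"
  shows "\<omega> y w v = (\<Sum>e\<in>onb. v (X e) * \<omega> y w (vat (E e) y))"
  by (subst frame_expand_vec[OF assms(1-3)], rule form_sum_right)
    (rule vfields_tangent[OF frame_vfield[OF assms(1)]], assumption, rule assms(4))

lemma form_inj:
  assumes "u \<in> tangent \<A> p" "v \<in> tangent \<A> p" "\<And>w. w \<in> tangent \<A> p \<Longrightarrow> \<omega> p u w = \<omega> p v w"
  shows "u = v"
proof -
  have d: "(\<lambda>f. 1 * u f + (-1) * v f) \<in> tangent \<A> p" by (rule tangent_comb[OF assms(1,2)])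
  have "(\<lambda>f. 1 * u f + (-1) * v f) = 0"
    using nondegenerate d form_lin_left[OF assms(1,2), of _ 1 "-1"] assms(3)
    unfolding nondegenerate_form_def by auto
  then show ?thesis by (auto simp: fun_eq_iff)
qed

text \<open>Nondegeneracy says that the matrix of \<open>\<omega>\<close> in a frame has trivial
  kernel, so the linear system for the components is solvable. This justifies the definite
  description in \<open>hamiltonian_field\<close>.\<close>

lemma ex_hamiltonian_vector: "\<exists>!v. v \<in> tangent \<A> p \<and> (\<forall>w\<in>tangent \<A> p. \<omega> p v w = w f)"
proof -
  obtain V and X :: "'e \<Rightarrow> 'm \<Rightarrow> complex" and E where F: "frame V X E" "p \<in> V" by (rule frame_at)
  have tE: "e \<in> onb \<Longrightarrow> vat (E e) p \<in> tangent \<A> p" for e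
    by (rule vfields_tangent[OF frame_vfield[OF F(1)]])
  have expand: "\<omega> p v w = (\<Sum>e\<in>onb. w (X e) * \<omega> p v (vat (E e) p))"
    if "v \<in> tangent \<A> p" "w \<in> tangent \<A> p" for v w
    by (rule form_frame_right[OF F that(2,1)])
  obtain a where a: "\<And>e. e \<in> onb \<Longrightarrow> (\<Sum>d\<in>onb. a d * \<omega> p (vat (E d) p) (vat (E e) p)) = E e f p"
  proof (rule square_system_solvable[OF finite_onb, of "\<lambda>d e. \<omega> p (vat (E d) p) (vat (E e) p)" "\<lambda>e. E e f p"])
    fix a and i :: 'e
    assume z: "\<And>e. e \<in> onb \<Longrightarrow> (\<Sum>d\<in>onb. a d * \<omega> p (vat (E d) p) (vat (E e) p)) = 0" and i: "i \<in> onb"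
    define v where "v = (\<lambda>f. \<Sum>d\<in>onb. a d * vat (E d) p f)"
    have v: "v \<in> tangent \<A> p" unfolding v_def by (rule tangent_comb_sum[OF tE])
    have "\<omega> p v (vat (E e) p) = 0" if "e \<in> onb" for e
      unfolding v_def using form_sum_left[OF tE tE[OF that], where I = onb and a = a] z[OF that] by simp
    then have "\<omega> p v w = 0" if "w \<in> tangent \<A> p" for w
      using expand[OF v that] by simp
    then have "v = 0" using nondegenerate v unfolding nondegenerate_form_def by blast
    then have "0 = v (X i)" by simp
    also have "\<dots> = (\<Sum>d\<in>onb. if d = i then a d else 0)"
      unfolding v_def by (rule sum.cong[OF refl]) (simp add: frame_dual[OF F(1) _ i F(2)])
    finally show "a i = 0" using i by (simp add: sum.delta)
  qed blast
  define v where "v = (\<lambda>f. \<Sum>d\<in>onb. a d * vat (E d) p f)"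
  have v: "v \<in> tangent \<A> p" unfolding v_def by (rule tangent_comb_sum[OF tE])
  have "\<omega> p v w = w f" if w: "w \<in> tangent \<A> p" for w
  proof -
    have "\<omega> p v w = (\<Sum>e\<in>onb. w (X e) * E e f p)"
      unfolding expand[OF v w]
      by (rule sum.cong[OF refl]) (use form_sum_left[OF tE tE, where I = onb and a = a] a in \<open>simp add: v_def\<close>)
    also have "\<dots> = w f" by (subst (2) frame_expand_vec[OF F w]) simp
    finally show ?thesis .
  qed
  then show ?thesis using v form_inj by (intro ex1I[of _ v]) auto
qed

abbreviation ham :: "('m \<Rightarrow> complex) \<Rightarrow> 'm \<Rightarrow> 'm cvec" where
  "ham f p \<equiv> vat (hamiltonian_field \<A> \<omega> f) p"

lemma ham_tangent: "ham f p \<in> tangent \<A> p"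
  and form_ham: "w \<in> tangent \<A> p \<Longrightarrow> \<omega> p (ham f p) w = w f"
  using theI'[OF ex_hamiltonian_vector[of p f]] by (auto simp: hamiltonian_field_def vat_def)

lemma ham_eqI: "v \<in> tangent \<A> p \<Longrightarrow> (\<And>w. w \<in> tangent \<A> p \<Longrightarrow> \<omega> p v w = w f) \<Longrightarrow> ham f p = v"
  by (rule form_inj[OF ham_tangent]) (simp_all add: form_ham)

text \<open>In the sign convention in force the bracket differentiates its first argument along the
  Hamiltonian field of the second. Linearity and locality in the first argument are thus those of
  tangent vectors.\<close>

lemma pb_ham: "pb f g p = ham g p f"
  by (simp add: poisson_def eval2_def form_ham[OF ham_tangent] del: vat_apply)

lemma pb_antisym: "pb f g p = - pb g f p"
  unfolding poisson_def eval2_def by (rule form_antisym[OF ham_tangent ham_tangent])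

lemma pb_lin_left:
  "f \<in> Cinf \<A> \<Longrightarrow> g \<in> Cinf \<A> \<Longrightarrow> pb (\<lambda>x. a * f x + b * g x) k p = a * pb f k p + b * pb g k p"
  unfolding pb_ham by (rule tangent_lin[OF ham_tangent])

lemma pb_local_left:
  "f \<in> Cinf \<A> \<Longrightarrow> g \<in> Cinf \<A> \<Longrightarrow> open V \<Longrightarrow> p \<in> V \<Longrightarrow> (\<And>x. x \<in> V \<Longrightarrow> f x = g x)
    \<Longrightarrow> pb f k p = pb g k p"
  unfolding pb_ham by (rule tangent_local[OF ham_tangent])

text \<open>The function is linear in the coordinates, with the components of the contraction of
  \<open>\<omega>\<close> with \<open>w\<close> as coefficients. Pointwise statements about
  arbitrary tangent vectors can therefore be tested on Hamiltonian ones.\<close>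

lemma ham_surj:
  fixes w :: "'m cvec"
  assumes w: "w \<in> tangent \<A> p"
  obtains f where "f \<in> Cinf \<A>" "ham f p = w"
proof -
  obtain V and X :: "'e \<Rightarrow> 'm \<Rightarrow> complex" and E where F: "frame V X E" "p \<in> V" by (rule frame_at)
  define f where "f = (\<lambda>x. \<Sum>e\<in>onb. \<omega> p w (vat (E e) p) * X e x)"
  have fC: "(\<lambda>x. c * X e x) \<in> Cinf \<A>" if "e \<in> onb" for e c
    by (intro Cinf_mult Cinf_on_const frame_coord[OF F(1) that])
  have "ham f p = w"
  proof (rule ham_eqI[OF w])
    fix u :: "'m cvec" assume u: "u \<in> tangent \<A> p"
    have "u f = (\<Sum>e\<in>onb. \<omega> p w (vat (E e) p) * u (X e))"
      unfolding f_def by (simp add: tangent_sum[OF u] fC tangent_scale[OF u] frame_coord[OF F(1)])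
    then show "\<omega> p w u = u f" by (simp add: form_frame_right[OF F u w] mult.commute)
  qed
  moreover have "f \<in> Cinf \<A>" unfolding f_def by (rule Cinf_sum[OF fC])
  ultimately show thesis using that by blast
qed

lemma chart_preimage_subset:
  assumes ch: "(U, \<phi>) \<in> \<A>" and B: "B \<subseteq> \<phi> ` (U \<inter> N)"
  shows "{x \<in> U. \<phi> x \<in> B} \<subseteq> N"
proof clarify
  fix x assume x: "x \<in> U" "\<phi> x \<in> B"
  then obtain y where y: "y \<in> U" "y \<in> N" "\<phi> x = \<phi> y" using B by auto
  then have "x = y" using chart_inv[OF ch] x(1) by metis
  with y show "x \<in> N" by simp
qed

text \<open>Brackets with \<open>b\<close> are derivatives of \<open>b\<close> along Hamiltonian
  vectors, and these exhaust the tangent spaces by \<open>ham_surj\<close>. So \<open>b\<close> has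
  zero derivative on a ball in a chart, and the ball is convex.\<close>

lemma pb_zero_locally_const:
  assumes b: "b \<in> Cinf \<A>" and N: "open N" "p \<in> N" and z: "\<And>f x. f \<in> Cinf \<A> \<Longrightarrow> x \<in> N \<Longrightarrow> pb b f x = 0"
  obtains V where "open V" "p \<in> V" "V \<subseteq> N" "\<And>x. x \<in> V \<Longrightarrow> b x = b p"
proof -
  have wb: "w b = 0" if "w \<in> tangent \<A> x" "x \<in> N" for w x
    using ham_surj[OF that(1)] z[OF _ that(2)] pb_ham by metis
  obtain U \<phi> where ch: "(U, \<phi>) \<in> \<A>" "p \<in> U" by (rule chart_at)
  let ?\<psi> = "inv_into U \<phi>"
  obtain W and X :: "'e \<Rightarrow> 'm \<Rightarrow> complex" and E where F: "frame W X E" "p \<in> W" "W \<subseteq> U"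
    and FE: "\<And>e f y. e \<in> onb \<Longrightarrow> f \<in> Cinf \<A> \<Longrightarrow> y \<in> W \<Longrightarrow> E e f y = pd e (f \<circ> ?\<psi>) (\<phi> y)"
    using ex_frame[OF ch] by blast
  have "open (\<phi> ` (U \<inter> (N \<inter> W)))"
    by (rule chart_image_open[OF ch(1)]) (intro open_Int N frame_open[OF F(1)])
  then obtain r where r: "r > 0" "ball (\<phi> p) r \<subseteq> \<phi> ` (U \<inter> (N \<inter> W))"
    using ch(2) N F(2) openE by (metis IntI imageI)
  define V where "V = {x \<in> U. \<phi> x \<in> ball (\<phi> p) r}"
  have VN: "V \<subseteq> N" unfolding V_def using chart_preimage_subset[OF ch(1) r(2)] by blast
  have "b x = b p" if "x \<in> V" for x
  proof -
    have "((b \<circ> ?\<psi>) has_derivative (\<lambda>h. 0)) (at z within ball (\<phi> p) r)" if "z \<in> ball (\<phi> p) r" for z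
    proof -
      have "z \<in> \<phi> ` (U \<inter> (N \<inter> W))" by (rule subsetD[OF r(2) that])
      then obtain y where y: "y \<in> U" "y \<in> N" "y \<in> W" "z = \<phi> y" by auto
      have diff: "(b \<circ> ?\<psi>) differentiable (at z)"
        by (rule smooth_on_differentiable[OF CinfD[OF b ch(1)]]) (use y in auto)
      have "pd e (b \<circ> ?\<psi>) z = 0" if "e \<in> onb" for e
        using FE[OF that b y(3)] wb[OF vfields_tangent[OF frame_vfield[OF F(1) that]] y(2)] y(4) by simp
      then have "pd v (b \<circ> ?\<psi>) z = 0" for v
        by (subst pd_onb_expansion[OF diff]) simp
      then have D0: "frechet_derivative (b \<circ> ?\<psi>) (at z) = (\<lambda>h. 0)" by (rule ext)
      have "((b \<circ> ?\<psi>) has_derivative (\<lambda>h. 0)) (at z)"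
        using diff[unfolded frechet_derivative_works] unfolding D0 .
      then show ?thesis by (rule has_derivative_at_withinI)
    qed
    from has_derivative_zero_unique[OF convex_ball this, of "\<phi> x" "\<phi> p"]
    show ?thesis using that r(1) ch by (simp add: V_def)
  qed
  moreover have "open V" unfolding V_def by (rule chart_preimage_open[OF ch(1) open_ball])
  moreover have "p \<in> V" using ch(2) r(1) by (simp add: V_def)
  ultimately show thesis using that VN by blast
qed

text \<open>A ball in a chart: the identity of \<open>V\<close> factors through the convex ball,
  hence is nullhomotopic. Such sets are where the condition in \<open>symplectic_derivation\<close>
  can be applied to a local potential.\<close>

lemma contractible_neighbourhood:
  fixes p :: 'm
  assumes "open N" "p \<in> N"
  obtains V where "open V" "contractible V" "p \<in> V" "V \<subseteq> N"
proof -
  obtain U \<phi> where ch: "(U, \<phi>) \<in> \<A>" "p \<in> U" by (rule chart_at)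
  have "open (\<phi> ` (U \<inter> N))" by (rule chart_image_open[OF ch(1) assms(1)])
  then obtain r where r: "r > 0" "ball (\<phi> p) r \<subseteq> \<phi> ` (U \<inter> N)"
    using ch(2) assms(2) openE by (metis IntI imageI)
  define V where "V = {x \<in> U. \<phi> x \<in> ball (\<phi> p) r}"
  have VN: "V \<subseteq> N" unfolding V_def using chart_preimage_subset[OF ch(1) r(2)] by blast
  have cV: "continuous_on V \<phi>"
    by (rule continuous_on_subset[OF chart_continuous[OF ch(1)]]) (auto simp: V_def)
  have cB: "continuous_on (ball (\<phi> p) r) (inv_into U \<phi>)"
    by (rule continuous_on_subset[OF chart_inv_continuous[OF ch(1)]]) (use r in auto)
  have bV: "inv_into U \<phi> z \<in> V" if z: "z \<in> ball (\<phi> p) r" for z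
  proof -
    obtain y where "y \<in> U" "z = \<phi> y" using z r(2) by auto
    then show ?thesis using z ch(1) by (auto simp: V_def)
  qed
  obtain c where "homotopic_with_canon (\<lambda>h. True) V V (inv_into U \<phi> \<circ> \<phi>) (\<lambda>x. c)"
    using nullhomotopic_through_contractible[of V \<phi> "ball (\<phi> p) r" "inv_into U \<phi>" V]
      cV cB bV convex_imp_contractible[OF convex_ball, of "\<phi> p" r] by (auto simp: V_def)
  then have "homotopic_with_canon (\<lambda>h. True) V V id (\<lambda>x. c)"
    by (rule homotopic_with_eq) (use ch in \<open>auto simp: V_def\<close>)
  then have "contractible V" unfolding contractible_def by blast
  moreover have "open V" unfolding V_def by (rule chart_preimage_open[OF ch(1) open_ball])
  moreover have "p \<in> V" using ch(2) r(1) by (simp add: V_def)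
  ultimately show thesis using that VN by blast
qed

lemma eval2_antisym: "X \<in> vfields \<A> \<Longrightarrow> Z \<in> vfields \<A> \<Longrightarrow> eval2 \<omega> X Z p = - eval2 \<omega> Z X p"
  unfolding eval2_def by (rule form_antisym) (auto intro: vfields_tangent)

lemma symplectic_vfield: "Y \<in> symplectic_fields \<A> \<omega> \<Longrightarrow> Y \<in> vfields \<A>"
  by (simp add: symplectic_fields_def)

text \<open>Cartan's formula: as \<open>\<omega>\<close> is closed, its Lie derivative along
  \<open>Y\<close> is the exterior derivative of its contraction with \<open>Y\<close>. Subtracting
  the expanded closedness condition from the expanded Lie derivative gives the claim up to
  antisymmetry.\<close>

lemma symplectic_contraction_closed:
  assumes Y: "Y \<in> symplectic_fields \<A> \<omega>" and X: "X \<in> vfields \<A>" and Z: "Z \<in> vfields \<A>"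
  shows "X (eval2 \<omega> Y Z) p - Z (eval2 \<omega> Y X) p = eval2 \<omega> Y (lie_bracket X Z) p"
proof -
  have Yv: "Y \<in> vfields \<A>" by (rule symplectic_vfield[OF Y])
  have 1: "Y (eval2 \<omega> X Z) p - eval2 \<omega> (lie_bracket Y X) Z p - eval2 \<omega> X (lie_bracket Y Z) p = 0"
    using Y X Z unfolding symplectic_fields_def by (auto simp: fun_eq_iff)
  have 2: "Y (eval2 \<omega> X Z) p - X (eval2 \<omega> Y Z) p + Z (eval2 \<omega> Y X) p
     - eval2 \<omega> (lie_bracket Y X) Z p + eval2 \<omega> (lie_bracket Y Z) X p
     - eval2 \<omega> (lie_bracket X Z) Y p = 0"
    using closed Yv X Z unfolding closed_two_form_def by (auto simp: fun_eq_iff)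
  show ?thesis
    using 1 2 eval2_antisym[OF X vfields_lie_bracket[OF Yv Z], of p]
      eval2_antisym[OF Yv vfields_lie_bracket[OF X Z], of p]
    by algebra
qed

text \<open>By duality \<open>E b (X c)\<close> is constant on \<open>V\<close>, so the bracket
  annihilates all coordinates.\<close>

lemma frame_bracket:
  assumes F: "frame V X E" and de: "d \<in> onb" "e \<in> onb" and y: "y \<in> V"
  shows "vat (lie_bracket (E d) (E e)) y = (\<lambda>f. 0)"
proof (rule tangent_eqI[OF F y])
  have E: "E d \<in> vfields \<A>" "E e \<in> vfields \<A>" using frame_vfield[OF F] de by auto
  show "vat (lie_bracket (E d) (E e)) y \<in> tangent \<A> y"
    by (rule vfields_tangent[OF vfields_lie_bracket[OF E]])
  show "(\<lambda>f. 0) \<in> tangent \<A> y" by (rule tangent_zero)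
  fix c :: 'e assume c: "c \<in> onb"
  have "E a (E b (X c)) y = 0" if "a \<in> onb" "b \<in> onb" for a b
  proof -
    have "E a (E b (X c)) y = E a (\<lambda>x. if b = c then 1 else 0) y"
      by (rule vfields_local[OF frame_vfield[OF F that(1)] vfields_Cinf[OF frame_vfield[OF F that(2)]]
            Cinf_on_const frame_open[OF F] y])
        (use frame_coord[OF F c] frame_dual[OF F that(2) c] in auto)
    then show ?thesis using vfields_const[OF frame_vfield[OF F that(1)]] by simp
  qed
  then show "vat (lie_bracket (E d) (E e)) y (X c) = 0"
    using de by (simp add: lie_bracket_def)
qed

lemma symplectic_frame_closed:
  assumes Y: "Y \<in> symplectic_fields \<A> \<omega>" and F: "frame V X E" and de: "d \<in> onb" "e \<in> onb" and y: "y \<in> V"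
  shows "E d (eval2 \<omega> Y (E e)) y = E e (eval2 \<omega> Y (E d)) y"
proof -
  have "eval2 \<omega> Y (lie_bracket (E d) (E e)) y = - \<omega> y (\<lambda>f. 0) (vat Y y)"
    unfolding eval2_def frame_bracket[OF F de y]
    by (rule form_antisym) (auto intro: vfields_tangent symplectic_vfield[OF Y] tangent_zero)
  then show ?thesis
    using symplectic_contraction_closed[OF Y frame_vfield[OF F de(1)] frame_vfield[OF F de(2)], of y]
      form_zero_left[OF vfields_tangent[OF symplectic_vfield[OF Y], of y]] by simp
qed

end

lemma pd_cong:
  assumes "f differentiable (at x)" "open S" "x \<in> S" "\<And>y. y \<in> S \<Longrightarrow> f y = g y"
  shows "pd v f x = pd v g x"
  using has_derivative_transform_within_open[OF assms(1)[unfolded frechet_derivative_works] assms(2,3), of g]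
    assms(4) by (metis frechet_derivative_at)

lemma pd_slice:
  assumes "F differentiable (at (s, y))"
  shows "pd (0, d) F (s, y) = pd d (\<lambda>y. F (s, y)) y" and "(\<lambda>y. F (s, y)) differentiable (at y)"
proof -
  have "((\<lambda>y. F (s, y)) has_derivative (\<lambda>h. frechet_derivative F (at (s, y)) (0, h))) (at y)"
    by (rule has_derivative_compose[of "\<lambda>y. (s, y)", OF _ assms[unfolded frechet_derivative_works]])
      (auto intro!: derivative_eq_intros)
  then show "pd (0, d) F (s, y) = pd d (\<lambda>y. F (s, y)) y" "(\<lambda>y. F (s, y)) differentiable (at y)"
    by (auto simp: pd_eqI differentiable_def)
qed

section \<open>Potentials of families of symplectic fields\<close>

locale symplectic_param = T: smooth_manifold \<T> + M: symplectic \<A> \<omega>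
  for \<T> :: "('t::{t2_space,second_countable_topology}, 'f::{real_inner,heine_borel,banach}) atlas"
    and \<A> :: "('m::{t2_space,second_countable_topology}, 'e::{real_inner,heine_borel,banach}) atlas"
    and \<omega> :: "'m form2"
begin

sublocale two_manifolds \<T> \<A> ..

text \<open>\<open>poincare_ball\<close> is applied in a product chart, with the chart coordinate on
  \<open>\<T>\<close> as its parameter, to the components of the contraction of
  \<open>\<omega>\<close> with \<open>Y\<close>. A cutoff then turns the primitive into one smooth
  function on the whole product, at the price that the bracket formula holds near the given point
  only.\<close>

lemma local_potential:
  fixes Y :: "'t \<Rightarrow> 'm cop"
  assumes Y: "\<And>\<sigma>. Y \<sigma> \<in> symplectic_fields \<A> \<omega>"
    and sm: "\<And>f. f \<in> Cinf \<A> \<Longrightarrow> (\<lambda>(\<sigma>, x). Y \<sigma> f x) \<in> Cinf (prod_atlas \<T> \<A>)"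
  obtains b S N where "b \<in> Cinf (prod_atlas \<T> \<A>)" "open S" "\<sigma>\<^sub>0 \<in> S" "open N" "p \<in> N"
    "\<And>\<sigma> x f. \<sigma> \<in> S \<Longrightarrow> x \<in> N \<Longrightarrow> f \<in> Cinf \<A> \<Longrightarrow> Y \<sigma> f x = M.pb (\<lambda>x. b (\<sigma>, x)) f x"
proof -
  obtain S0 \<theta> where ch1: "(S0, \<theta>) \<in> \<T>" "\<sigma>\<^sub>0 \<in> S0" by (rule T.chart_at)
  obtain U \<phi> where ch2: "(U, \<phi>) \<in> \<A>" "p \<in> U" by (rule M.chart_at)
  let ?\<psi> = "inv_into U \<phi>" and ?\<eta> = "inv_into S0 \<theta>" and ?c = "inv_into (S0 \<times> U) (map_prod \<theta> \<phi>)"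
  have chp: "(S0 \<times> U, map_prod \<theta> \<phi>) \<in> prod_atlas \<T> \<A>" by (rule prod_atlasI[OF ch1(1) ch2(1)])
  obtain V and X :: "'e \<Rightarrow> 'm \<Rightarrow> complex" and E where F: "M.frame V X E" "p \<in> V" "V \<subseteq> U"
    and FE: "\<And>e f y. e \<in> onb \<Longrightarrow> f \<in> Cinf \<A> \<Longrightarrow> y \<in> V \<Longrightarrow> E e f y = pd e (f \<circ> ?\<psi>) (\<phi> y)"
    using M.ex_frame[OF ch2] by blast
  have V: "open V" by (rule M.frame_open[OF F(1)])
  have Yv: "Y \<sigma> \<in> vfields \<A>" for \<sigma> by (rule M.symplectic_vfield[OF Y])
  have Yt: "vat (Y \<sigma>) x \<in> tangent \<A> x" for \<sigma> x by (rule M.vfields_tangent[OF Yv])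
  have Ev: "E e \<in> vfields \<A>" if "e \<in> onb" for e by (rule M.frame_vfield[OF F(1) that])
  have Et: "vat (E e) x \<in> tangent \<A> x" if "e \<in> onb" for e x by (rule M.vfields_tangent[OF Ev[OF that]])
  \<comment> \<open>Since the bracket of \<open>b\<close> and \<open>f\<close> is the derivative of
    \<open>b\<close> along the Hamiltonian field of \<open>f\<close>, a potential of
    \<open>Y\<close> has as differential minus the contraction of \<open>\<omega>\<close> with
    \<open>Y\<close>; hence the sign.\<close>
  define a where "a e z = - eval2 \<omega> (Y (fst z)) (E e) (snd z)" for e z
  \<comment> \<open>Smoothness in the parameter is assumed for \<open>Y \<sigma> f\<close> with
    fixed \<open>f\<close>. Expanding \<open>Y \<sigma>\<close> in the frame reduces the components
    to such terms.\<close>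
  have a_smooth: "a e \<in> Cinf_on (prod_atlas \<T> \<A>) (UNIV \<times> V)" if e: "e \<in> onb" for e
  proof (rule P.Cinf_on_cong)
    show "open ((UNIV :: 't set) \<times> V)" using V by (simp add: open_Times)
    have "(\<lambda>z. Y (fst z) (X c) (snd z)) \<in> Cinf (prod_atlas \<T> \<A>)" if "c \<in> onb" for c
      using sm[OF M.frame_coord[OF F(1) that]] by (simp add: case_prod_unfold)
    moreover have "(\<lambda>z. eval2 \<omega> (E c) (E e) (snd z)) \<in> Cinf (prod_atlas \<T> \<A>)" if "c \<in> onb" for c
      by (rule Cinf_snd[OF M.form_smooth[OF Ev[OF that] Ev[OF e]]])
    ultimately show "(\<lambda>z. - 1 * (\<Sum>c\<in>onb. Y (fst z) (X c) (snd z) * eval2 \<omega> (E c) (E e) (snd z)))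
        \<in> Cinf_on (prod_atlas \<T> \<A>) (UNIV \<times> V)"
      by (intro P.Cinf_imp_Cinf_on[OF P.Cinf_mult[OF P.Cinf_on_const P.Cinf_sum[OF P.Cinf_mult]]])
    fix z :: "'t \<times> 'm" assume "z \<in> UNIV \<times> V"
    then have "snd z \<in> V" by auto
    from M.form_frame_left[OF F(1) this Yt Et[OF e], of "fst z"]
    show "- 1 * (\<Sum>c\<in>onb. Y (fst z) (X c) (snd z) * eval2 \<omega> (E c) (E e) (snd z)) = a e z"
      by (simp add: a_def eval2_def)
  qed
  have opV: "open (\<phi> ` V)" using M.chart_image_open[OF ch2(1) V] F(3) by (simp add: Int_absorb1)
  then obtain r0 where r0: "r0 > 0" "ball (\<phi> p) r0 \<subseteq> \<phi> ` V"
    using F(2) openE by (metis imageI)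
  define r where "r = r0 / 2"
  have r: "r > 0" "ball (\<phi> p) (2 * r) \<subseteq> \<phi> ` V" using r0 by (auto simp: r_def)
  have rV: "ball (\<phi> p) r \<subseteq> \<phi> ` V" using r by (metis ball_subset_cball dual_order.trans less_eq_real_def mult_2 le_add_same_cancel1 subset_ball)
  define P where "P = \<theta> ` S0"
  have P: "open P" unfolding P_def by (rule T.chart_open_image[OF ch1(1)])
  define \<alpha> where "\<alpha> e = a e \<circ> ?c" for e
  have \<alpha>_smooth: "smooth_on (P \<times> \<phi> ` V) (\<alpha> e)" if "e \<in> onb" for e
  proof -
    have "map_prod \<theta> \<phi> ` (S0 \<times> U \<inter> UNIV \<times> V) = P \<times> \<phi> ` V"
      using F(3) by (auto simp: P_def Times_Int_Times map_prod_Times Int_absorb1)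
    then show ?thesis using P.Cinf_onD[OF a_smooth[OF that] chp] by (simp add: \<alpha>_def)
  qed
  have c_eq: "?c (\<theta> \<sigma>, \<phi> x) = (\<sigma>, x)" if "\<sigma> \<in> S0" "x \<in> U" for \<sigma> x
    using inv_chart_prod[OF ch1(1) ch2(1), of "\<theta> \<sigma>" "\<phi> x"] that T.chart_inv[OF ch1(1)] M.chart_inv[OF ch2(1)]
    by simp
  have \<alpha>_pd: "pd (0, d) (\<alpha> e) (\<theta> \<sigma>, \<phi> x) = - E d (eval2 \<omega> (Y \<sigma>) (E e)) x"
    if de: "d \<in> onb" "e \<in> onb" and \<sigma>: "\<sigma> \<in> S0" and x: "x \<in> V" for d e \<sigma> x
  proof -
    have diff: "\<alpha> e differentiable (at (\<theta> \<sigma>, \<phi> x))"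
      by (rule smooth_on_differentiable[OF \<alpha>_smooth[OF de(2)]]) (use \<sigma> x in \<open>auto simp: P_def\<close>)
    have g: "eval2 \<omega> (Y \<sigma>) (E e) \<in> Cinf \<A>" by (rule M.form_smooth[OF Yv Ev[OF de(2)]])
    then have g': "(\<lambda>x. - 1 * eval2 \<omega> (Y \<sigma>) (E e) x) \<in> Cinf \<A>"
      by (intro M.Cinf_mult M.Cinf_on_const)
    have "pd (0, d) (\<alpha> e) (\<theta> \<sigma>, \<phi> x) = pd d (\<lambda>y. \<alpha> e (\<theta> \<sigma>, y)) (\<phi> x)"
      by (rule pd_slice(1)[OF diff])
    also have "\<dots> = pd d ((\<lambda>x. - 1 * eval2 \<omega> (Y \<sigma>) (E e) x) \<circ> ?\<psi>) (\<phi> x)"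
    proof (rule pd_cong[OF pd_slice(2)[OF diff] opV])
      show "\<phi> x \<in> \<phi> ` V" using x by simp
      fix y assume "y \<in> \<phi> ` V"
      then obtain x' where "x' \<in> V" "y = \<phi> x'" by auto
      then show "\<alpha> e (\<theta> \<sigma>, y) = ((\<lambda>x. - 1 * eval2 \<omega> (Y \<sigma>) (E e) x) \<circ> ?\<psi>) y"
        using c_eq[OF \<sigma>, of x'] F(3) M.chart_inv[OF ch2(1), of x'] by (auto simp: \<alpha>_def a_def)
    qed
    also have "\<dots> = E d (\<lambda>x. - 1 * eval2 \<omega> (Y \<sigma>) (E e) x) x"
      by (rule FE[OF de(1) g' x, symmetric])
    also have "\<dots> = - E d (eval2 \<omega> (Y \<sigma>) (E e)) x"
      using M.vfields_lin[OF Ev[OF de(1)] g g, of "-1" 0 x] by simp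
    finally show ?thesis .
  qed
  have sub: "P \<times> ball (\<phi> p) (2 * r) \<subseteq> P \<times> \<phi> ` V" using r(2) by auto
  have closed: "pd (0, d) (\<alpha> e) (s, y) = pd (0, e) (\<alpha> d) (s, y)"
    if de: "d \<in> onb" "e \<in> onb" and sy: "s \<in> P" "y \<in> ball (\<phi> p) (2 * r)" for d e s y
  proof -
    have "y \<in> \<phi> ` V" by (rule subsetD[OF r(2) sy(2)])
    then obtain x where x: "x \<in> V" "y = \<phi> x" by auto
    obtain \<sigma> where s: "\<sigma> \<in> S0" "s = \<theta> \<sigma>" using sy(1) by (auto simp: P_def)
    show ?thesis
      using \<alpha>_pd[OF de s(1) x(1)] \<alpha>_pd[OF de(2,1) s(1) x(1)] x(2) s(2)
        M.symplectic_frame_closed[OF Y F(1) de x(1)] by simp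
  qed
  obtain b0 where b0: "smooth_on (P \<times> ball (\<phi> p) r) b0"
    "\<And>e s y. e \<in> onb \<Longrightarrow> s \<in> P \<Longrightarrow> y \<in> ball (\<phi> p) r \<Longrightarrow> pd (0, e) b0 (s, y) = \<alpha> e (s, y)"
    using poincare_ball[OF P r(1) smooth_on_subset[OF \<alpha>_smooth sub] closed] by blast
  define b1 where "b1 z = b0 (map_prod \<theta> \<phi> z)" for z
  define G0 where "G0 = {z \<in> S0 \<times> U. map_prod \<theta> \<phi> z \<in> P \<times> ball (\<phi> p) r}"
  have opPb: "open (P \<times> ball (\<phi> p) r)" using P by (simp add: open_Times)
  have "b1 \<in> Cinf_on (prod_atlas \<T> \<A>) G0"
    unfolding G0_def
  proof (rule P.Cinf_on_chartI[OF chp opPb])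
    show Psub: "P \<times> ball (\<phi> p) r \<subseteq> map_prod \<theta> \<phi> ` (S0 \<times> U)"
      unfolding map_prod_Times using rV F(3) by (auto simp: P_def)
    show "smooth_on (P \<times> ball (\<phi> p) r) (b1 \<circ> ?c)"
    proof (rule smooth_on_cong[OF b0(1) opPb])
      fix z assume "z \<in> P \<times> ball (\<phi> p) r"
      then have "z \<in> map_prod \<theta> \<phi> ` (S0 \<times> U)" using Psub by blast
      then show "b0 z = (b1 \<circ> ?c) z" by (simp add: b1_def f_inv_into_f)
    qed
  qed
  moreover have "open G0" unfolding G0_def by (rule P.chart_preimage_open[OF chp opPb])
  moreover have "(\<sigma>\<^sub>0, p) \<in> G0" using ch1 ch2 r(1) by (auto simp: G0_def P_def)
  \<comment> \<open>The primitive is extended from a neighbourhood in the product, not slice by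
    slice, so that \<open>b\<close> stays smooth in the parameter.\<close>
  ultimately obtain b G where b: "b \<in> Cinf (prod_atlas \<T> \<A>)" "open G" "(\<sigma>\<^sub>0, p) \<in> G" "G \<subseteq> G0"
    "\<And>z. z \<in> G \<Longrightarrow> b z = b1 z"
    using P.Cinf_extend[of G0 "(\<sigma>\<^sub>0, p)" b1] by metis
  obtain S N where SN: "open S" "open N" "(\<sigma>\<^sub>0, p) \<in> S \<times> N" "S \<times> N \<subseteq> G"
    using open_prod_elim[OF b(2,3)] by metis
  show thesis
  proof (rule that[OF b(1) SN(1) _ SN(2)])
    show "\<sigma>\<^sub>0 \<in> S" "p \<in> N" using SN(3) by auto
    fix \<sigma> x and f :: "'m \<Rightarrow> complex" assume \<sigma>: "\<sigma> \<in> S" and x: "x \<in> N" and f: "f \<in> Cinf \<A>"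
    let ?b = "\<lambda>x. b (\<sigma>, x)"
    have b\<sigma>: "?b \<in> Cinf \<A>" by (rule Cinf_slice[OF b(1)])
    have inG0: "(\<sigma>, x') \<in> G0" if "x' \<in> N" for x' using \<sigma> that SN(4) b(4) by auto
    have \<sigma>0: "\<sigma> \<in> S0" and xU: "x \<in> U" and xr: "\<phi> x \<in> ball (\<phi> p) r"
      using inG0[OF x] by (auto simp: G0_def)
    have xV: "x \<in> V"
      using M.chart_preimage_subset[OF ch2(1), of "ball (\<phi> p) r" V] rV F(3) xU xr by (auto simp: Int_absorb1)
    have Ebx: "E e ?b x = - \<omega> x (vat (Y \<sigma>) x) (vat (E e) x)" if e: "e \<in> onb" for e
    proof -
      have "b0 differentiable (at (\<theta> \<sigma>, \<phi> x))"
        by (rule smooth_on_differentiable[OF b0(1)]) (use \<sigma>0 xr in \<open>auto simp: P_def\<close>)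
      note sl = pd_slice[OF this]
      have "\<alpha> e (\<theta> \<sigma>, \<phi> x) = pd e (\<lambda>y. b0 (\<theta> \<sigma>, y)) (\<phi> x)"
        using b0(2)[OF e, of "\<theta> \<sigma>" "\<phi> x"] sl(1)[of e] \<sigma>0 xr by (simp add: P_def)
      also have "\<dots> = pd e (?b \<circ> ?\<psi>) (\<phi> x)"
      proof (rule pd_cong[OF sl(2) M.chart_image_open[OF ch2(1) SN(2)]])
        show "\<phi> x \<in> \<phi> ` (U \<inter> N)" using x xU by auto
        fix y assume "y \<in> \<phi> ` (U \<inter> N)"
        then obtain x' where x': "x' \<in> U" "x' \<in> N" "y = \<phi> x'" by auto
        have "(\<sigma>, x') \<in> G" using SN(4) \<sigma> x'(2) by auto
        then show "b0 (\<theta> \<sigma>, y) = (?b \<circ> ?\<psi>) y"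
          using x' M.chart_inv[OF ch2(1) x'(1)] b(5) by (simp add: b1_def)
      qed
      also have "\<dots> = E e ?b x" by (rule FE[OF e b\<sigma> xV, symmetric])
      finally show ?thesis using c_eq[OF \<sigma>0 xU] by (simp add: \<alpha>_def a_def eval2_def)
    qed
    have "M.pb ?b f x = (\<Sum>e\<in>onb. M.ham f x (X e) * E e ?b x)"
      unfolding M.pb_ham by (rule M.frame_expand[OF F(1) xV M.ham_tangent b\<sigma>])
    also have "\<dots> = - (\<Sum>e\<in>onb. M.ham f x (X e) * \<omega> x (vat (Y \<sigma>) x) (vat (E e) x))"
      unfolding sum_negf[symmetric] by (rule sum.cong) (auto simp: Ebx)
    also have "\<dots> = - \<omega> x (vat (Y \<sigma>) x) (M.ham f x)"
      using M.form_frame_right[OF F(1) xV M.ham_tangent[of f x] Yt[of \<sigma> x]] by simp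
    also have "\<dots> = \<omega> x (M.ham f x) (vat (Y \<sigma>) x)"
      using M.form_antisym[OF M.ham_tangent Yt] by simp
    also have "\<dots> = Y \<sigma> f x" using M.form_ham[OF Yt] by simp
    finally show "Y \<sigma> f x = M.pb ?b f x" by simp
  qed
qed

end

section \<open>Tensoriality of the Lie derivative of the symplectic form\<close>

context symplectic
begin

definition lie_form :: "'m cop \<Rightarrow> 'm cop \<Rightarrow> 'm cop \<Rightarrow> 'm \<Rightarrow> complex" where
  "lie_form Y X Z p =
     Y (eval2 \<omega> X Z) p - eval2 \<omega> (lie_bracket Y X) Z p - eval2 \<omega> X (lie_bracket Y Z) p"

lemma lie_form_antisym:
  assumes Y: "Y \<in> vfields \<A>" and X: "X \<in> vfields \<A>" and Z: "Z \<in> vfields \<A>"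
  shows "lie_form Y X Z p = - lie_form Y Z X p"
proof -
  have "eval2 \<omega> X Z = (\<lambda>x. - 1 * eval2 \<omega> Z X x)"
    using eval2_antisym[OF X Z] by auto
  then have "Y (eval2 \<omega> X Z) p = - Y (eval2 \<omega> Z X) p"
    using vfields_lin[OF Y form_smooth[OF Z X] form_smooth[OF Z X], of "-1" 0 p] by simp
  then show ?thesis
    unfolding lie_form_def
    using eval2_antisym[OF vfields_lie_bracket[OF Y X] Z, of p]
      eval2_antisym[OF X vfields_lie_bracket[OF Y Z], of p] by simp
qed

lemma vfields_comb:
  fixes X X' :: "'m cop"
  assumes "X \<in> vfields \<A>" "X' \<in> vfields \<A>"
  shows "(\<lambda>f x. a * X f x + a' * X' f x) \<in> vfields \<A>"
  using vfields_comb_sum[of "{True, False}" "\<lambda>i. if i then X else X'" "\<lambda>i x. if i then a else a'"] assms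
  by simp

lemma lie_form_comb:
  assumes Y: "Y \<in> vfields \<A>" and X: "X \<in> vfields \<A>" "X' \<in> vfields \<A>" and Z: "Z \<in> vfields \<A>"
  shows "lie_form Y (\<lambda>f x. a * X f x + a' * X' f x) Z p = a * lie_form Y X Z p + a' * lie_form Y X' Z p"
proof -
  let ?W = "\<lambda>f x. a * X f x + a' * X' f x"
  have ev: "eval2 \<omega> ?W Q x = a * eval2 \<omega> X Q x + a' * eval2 \<omega> X' Q x" if "Q \<in> vfields \<A>" for Q x
    using form_lin_left[OF vfields_tangent[OF X(1), of x] vfields_tangent[OF X(2)] vfields_tangent[OF that], of a a']
    by (simp add: eval2_def vat_def)
  have "Y (eval2 \<omega> ?W Z) p = a * Y (eval2 \<omega> X Z) p + a' * Y (eval2 \<omega> X' Z) p"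
  proof -
    have "eval2 \<omega> ?W Z = (\<lambda>x. a * eval2 \<omega> X Z x + a' * eval2 \<omega> X' Z x)" by (rule ext) (rule ev[OF Z])
    then show ?thesis using vfields_lin[OF Y form_smooth[OF X(1) Z] form_smooth[OF X(2) Z], of a a' p] by simp
  qed
  moreover have "vat (lie_bracket Y ?W) p f = a * vat (lie_bracket Y X) p f + a' * vat (lie_bracket Y X') p f" for f
  proof (cases "f \<in> Cinf \<A>")
    case True
    show ?thesis
      using vfields_lin[OF Y vfields_Cinf[OF X(1) True] vfields_Cinf[OF X(2) True], of a a' p]
      by (simp add: lie_bracket_def algebra_simps)
  next
    case False
    then show ?thesis
      using vfields_nonsmooth[OF vfields_lie_bracket[OF Y vfields_comb[OF X, of a a']] False]
        vfields_nonsmooth[OF vfields_lie_bracket[OF Y X(1)] False] vfields_nonsmooth[OF vfields_lie_bracket[OF Y X(2)] False]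
      by simp
  qed
  then have "vat (lie_bracket Y ?W) p = (\<lambda>f. a * vat (lie_bracket Y X) p f + a' * vat (lie_bracket Y X') p f)"
    by (rule ext)
  then have "eval2 \<omega> (lie_bracket Y ?W) Z p = a * eval2 \<omega> (lie_bracket Y X) Z p + a' * eval2 \<omega> (lie_bracket Y X') Z p"
    unfolding eval2_def
    using form_lin_left[OF vfields_tangent[OF vfields_lie_bracket[OF Y X(1)]]
        vfields_tangent[OF vfields_lie_bracket[OF Y X(2)]] vfields_tangent[OF Z], of p a a'] by simp
  ultimately show ?thesis
    using ev[OF vfields_lie_bracket[OF Y Z], of p] by (simp add: lie_form_def algebra_simps)
qed

text \<open>With \<open>X\<close> expanded in a frame near \<open>p\<close>, the Leibniz rule for
  \<open>Y\<close> leaves only the terms with differentiated components, as the components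
  themselves vanish at \<open>p\<close>. Those derivatives are the components of the bracket of
  \<open>Y\<close> and \<open>X\<close>, so the first two terms of \<open>lie_form\<close>
  cancel.\<close>

lemma lie_form_zero:
  assumes Y: "Y \<in> vfields \<A>" and X: "X \<in> vfields \<A>" and Z: "Z \<in> vfields \<A>" and z: "vat X p = (\<lambda>f. 0)"
  shows "lie_form Y X Z p = 0"
proof -
  obtain V and x :: "'e \<Rightarrow> 'm \<Rightarrow> complex" and E where F: "frame V x E" "p \<in> V" by (rule frame_at)
  have Ev: "E e \<in> vfields \<A>" if "e \<in> onb" for e by (rule frame_vfield[OF F(1) that])
  have xC: "X (x e) \<in> Cinf \<A>" if "e \<in> onb" for e by (rule vfields_Cinf[OF X frame_coord[OF F(1) that]])
  have EZ: "eval2 \<omega> (E e) Z \<in> Cinf \<A>" if "e \<in> onb" for e by (rule form_smooth[OF Ev[OF that] Z])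
  have z': "X f p = 0" for f using z by (metis vat_apply)
  have "Y (eval2 \<omega> X Z) p = Y (\<lambda>y. \<Sum>e\<in>onb. X (x e) y * eval2 \<omega> (E e) Z y) p"
  proof (rule vfields_local[OF Y form_smooth[OF X Z] _ frame_open[OF F(1)] F(2)])
    show "(\<lambda>y. \<Sum>e\<in>onb. X (x e) y * eval2 \<omega> (E e) Z y) \<in> Cinf \<A>"
      by (rule Cinf_sum[OF Cinf_mult[OF xC EZ]])
    fix y assume "y \<in> V"
    from form_frame_left[OF F(1) this vfields_tangent[OF X] vfields_tangent[OF Z]]
    show "eval2 \<omega> X Z y = (\<Sum>e\<in>onb. X (x e) y * eval2 \<omega> (E e) Z y)" by (simp add: eval2_def)
  qed
  also have "\<dots> = (\<Sum>e\<in>onb. Y (\<lambda>y. X (x e) y * eval2 \<omega> (E e) Z y) p)"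
    by (rule vfields_sum[OF Y]) (rule Cinf_mult[OF xC EZ])
  also have "\<dots> = (\<Sum>e\<in>onb. Y (X (x e)) p * eval2 \<omega> (E e) Z p)"
    by (rule sum.cong[OF refl]) (simp add: vfields_mult[OF Y xC EZ] z')
  also have "\<dots> = (\<Sum>e\<in>onb. vat (lie_bracket Y X) p (x e) * eval2 \<omega> (E e) Z p)"
    by (simp add: lie_bracket_def z')
  also have "\<dots> = eval2 \<omega> (lie_bracket Y X) Z p"
    using form_frame_left[OF F vfields_tangent[OF vfields_lie_bracket[OF Y X]] vfields_tangent[OF Z]]
    by (simp add: eval2_def)
  finally show ?thesis
    using form_zero_left[OF vfields_tangent[OF vfields_lie_bracket[OF Y Z], of p]] z
    by (simp add: lie_form_def eval2_def)
qed

lemma lie_form_tensorial: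
  assumes Y: "Y \<in> vfields \<A>" and X: "X \<in> vfields \<A>" "X' \<in> vfields \<A>" and Z: "Z \<in> vfields \<A>"
    and eq: "vat X p = vat X' p"
  shows "lie_form Y X Z p = lie_form Y X' Z p"
proof -
  have "vat (\<lambda>f x. 1 * X f x + (-1) * X' f x) p = (\<lambda>f. 0)"
    using fun_cong[OF eq] by (auto simp: vat_def)
  from lie_form_zero[OF Y vfields_comb[OF X] Z this]
  show ?thesis using lie_form_comb[OF Y X Z, of 1 "-1" p] by simp
qed

text \<open>By tensoriality, invariance of \<open>\<omega>\<close> need only be tested on Hamiltonian fields.\<close>

lemma poisson_derivation_symplectic:
  assumes smooth: "\<And>f g. f \<in> Cinf \<A> \<Longrightarrow> g \<in> Cinf \<A> \<Longrightarrow> pb f g \<in> Cinf \<A>"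
    and Y: "Y \<in> vfields \<A>"
    and der: "\<And>f g p. f \<in> Cinf \<A> \<Longrightarrow> g \<in> Cinf \<A> \<Longrightarrow> Y (pb f g) p = pb (Y f) g p + pb f (Y g) p"
  shows "Y \<in> symplectic_fields \<A> \<omega>"
proof -
  let ?H = "hamiltonian_field \<A> \<omega>"
  have H: "?H f \<in> vfields \<A>" if "f \<in> Cinf \<A>" for f
    unfolding vfields_def
  proof (intro CollectI conjI allI ballI ham_tangent)
    fix g :: "'m \<Rightarrow> complex" assume g: "g \<in> Cinf \<A>"
    have "?H f g = pb g f" using pb_ham[of g f] by auto
    then show "?H f g \<in> Cinf \<A>" using smooth[OF g that] by simp
  qed
  \<comment> \<open>The derivation property of \<open>Y\<close> says that its bracket with the
    Hamiltonian field of \<open>f\<close> is the Hamiltonian field of \<open>Y f\<close>.\<close>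
  have br: "vat (lie_bracket Y (?H f)) p = ham (Y f) p" if f: "f \<in> Cinf \<A>" for f p
  proof
    fix g show "vat (lie_bracket Y (?H f)) p g = ham (Y f) p g"
    proof (cases "g \<in> Cinf \<A>")
      case True
      have "?H f g = pb g f" "?H f (Y g) p = pb (Y g) f p" "?H (Y f) g p = pb g (Y f) p"
        using pb_ham by auto
      then show ?thesis using der[OF True f, of p] by (simp add: lie_bracket_def)
    next
      case False
      then show ?thesis
        using vfields_nonsmooth[OF vfields_lie_bracket[OF Y H[OF f]] False] tangent_nonsmooth[OF ham_tangent False]
        by (simp del: vat_apply) (simp add: vat_def)
    qed
  qed
  have HH: "lie_form Y (?H f) (?H g) p = 0" if fg: "f \<in> Cinf \<A>" "g \<in> Cinf \<A>" for f g p
    using der[OF fg, of p] br[OF fg(1), of p] br[OF fg(2), of p]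
    by (simp add: lie_form_def eval2_def poisson_def[of \<A> \<omega>, unfolded eval2_def] fun_eq_iff[symmetric])
  have "lie_form Y X Z p = 0" if X: "X \<in> vfields \<A>" and Z: "Z \<in> vfields \<A>" for X Z p
  proof -
    obtain f where f: "f \<in> Cinf \<A>" "ham f p = vat X p" using ham_surj[OF vfields_tangent[OF X]] by blast
    obtain g where g: "g \<in> Cinf \<A>" "ham g p = vat Z p" using ham_surj[OF vfields_tangent[OF Z]] by blast
    \<comment> \<open>Tensoriality is available in the first slot; antisymmetry brings the other
      argument there.\<close>
    have "lie_form Y X Z p = lie_form Y (?H f) Z p"
      by (rule lie_form_tensorial[OF Y X H[OF f(1)] Z f(2)[symmetric]])
    also have "\<dots> = - lie_form Y Z (?H f) p" by (rule lie_form_antisym[OF Y H[OF f(1)] Z])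
    also have "\<dots> = - lie_form Y (?H g) (?H f) p"
      using lie_form_tensorial[OF Y Z H[OF g(1)] H[OF f(1)] g(2)[symmetric]] by simp
    finally show ?thesis using HH[OF g(1) f(1)] by simp
  qed
  then show ?thesis
    unfolding symplectic_fields_def lie_form_def using Y by (auto simp: fun_eq_iff)
qed

end

section \<open>Star products and their derivations\<close>

lemma frechet_derivative_cong_open:
  assumes "open S" "x \<in> S" "\<And>y. y \<in> S \<Longrightarrow> f y = g y"
  shows "frechet_derivative f (at x) = frechet_derivative g (at x)"
proof -
  have "(f has_derivative D) (at x) \<longleftrightarrow> (g has_derivative D) (at x)" for D
    using assms has_derivative_transform_within_open[of f D x UNIV S g]
      has_derivative_transform_within_open[of g D x UNIV S f] by auto
  then show ?thesis by (simp add: frechet_derivative_def)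
qed

lemma iter_deriv_cong:
  assumes "open S" "\<And>y. y \<in> S \<Longrightarrow> f y = g y" "x \<in> S"
  shows "iter_deriv vs f x = iter_deriv vs g x"
  using assms(3)
proof (induction vs arbitrary: x)
  case (Cons v vs)
  then show ?case
    using frechet_derivative_cong_open[OF assms(1) Cons.prems, of "iter_deriv vs f" "iter_deriv vs g"] by simp
qed (simp add: assms(2))

lemma smooth_on_iter_deriv: "smooth_on S f \<Longrightarrow> smooth_on S (iter_deriv vs f)"
  by (induction vs) (auto intro: smooth_on_pd)

lemma sum_nested_triple:
  "(\<Sum>l\<le>n::nat. \<Sum>k\<le>n - l. \<Sum>i\<le>n - l - k. h l k i) = (\<Sum>(l, k, i)\<in>{(l, k, i). l + k + i \<le> n}. h l k i)"
proof -
  have "(\<Sum>l\<le>n. \<Sum>k\<le>n - l. \<Sum>i\<le>n - l - k. h l k i)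
      = (\<Sum>(l, k, i)\<in>(SIGMA l:{..n}. SIGMA k:{..n - l}. {..n - l - k}). h l k i)"
    by (simp add: sum.Sigma)
  also have "(SIGMA l:{..n}. SIGMA k:{..n - l}. {..n - l - k}) = {(l, k, i). l + k + i \<le> n}"
    by auto
  finally show ?thesis .
qed

lemma sum_nested_triple':
  "(\<Sum>k\<le>n::nat. \<Sum>s\<le>n - k. \<Sum>l\<le>s. h k s l) = (\<Sum>(k, s, l)\<in>{(k, s, l). k + s \<le> n \<and> l \<le> s}. h k s l)"
proof -
  have "(\<Sum>k\<le>n. \<Sum>s\<le>n - k. \<Sum>l\<le>s. h k s l)
      = (\<Sum>(k, s, l)\<in>(SIGMA k:{..n}. SIGMA s:{..n - k}. {..s}). h k s l)"
    by (simp add: sum.Sigma)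
  also have "(SIGMA k:{..n}. SIGMA s:{..n - k}. {..s}) = {(k, s, l). k + s \<le> n \<and> l \<le> s}"
    by auto
  finally show ?thesis .
qed

locale star_manifold = symplectic \<A> \<omega>
  for \<A> :: "('m::{t2_space,second_countable_topology}, 'e::{real_inner,heine_borel,banach}) atlas"
    and \<omega> :: "'m form2" +
  fixes c :: "'m star_coeffs"
  assumes natural: "natural_star_product \<A> \<omega> c"
begin

lemma star_prod: "star_product \<A> \<omega> c" and bidiff: "bidiff_op \<A> k (c k)"
  using natural by (auto simp: natural_star_product_def)

lemma c_smooth: "f \<in> Cinf \<A> \<Longrightarrow> g \<in> Cinf \<A> \<Longrightarrow> c k f g \<in> Cinf \<A>"
  and c_lin_left: "f \<in> Cinf \<A> \<Longrightarrow> g \<in> Cinf \<A> \<Longrightarrow> w \<in> Cinf \<A>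
    \<Longrightarrow> c k (\<lambda>x. a * f x + b * g x) w = (\<lambda>x. a * c k f w x + b * c k g w x)"
  and c_lin_right: "f \<in> Cinf \<A> \<Longrightarrow> g \<in> Cinf \<A> \<Longrightarrow> w \<in> Cinf \<A>
    \<Longrightarrow> c k w (\<lambda>x. a * f x + b * g x) = (\<lambda>x. a * c k w f x + b * c k w g x)"
  and star_assoc: "F \<in> formal_functions \<A> \<Longrightarrow> G \<in> formal_functions \<A> \<Longrightarrow> H \<in> formal_functions \<A>
    \<Longrightarrow> star c (star c F G) H = star c F (star c G H)"
  and star_unit_left: "F \<in> formal_functions \<A> \<Longrightarrow> star c (constant_series (\<lambda>x. 1)) F = F"
  and star_unit_right: "F \<in> formal_functions \<A> \<Longrightarrow> star c F (constant_series (\<lambda>x. 1)) = F"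
  and c_0: "f \<in> Cinf \<A> \<Longrightarrow> g \<in> Cinf \<A> \<Longrightarrow> c 0 f g = (\<lambda>x. f x * g x)"
  and c_1: "f \<in> Cinf \<A> \<Longrightarrow> g \<in> Cinf \<A> \<Longrightarrow> c 1 f g - c 1 g f = (\<lambda>x. \<i> * pb f g x)"
  using star_prod unfolding star_product_def by blast+

lemma zero_Cinf [simp]: "0 \<in> Cinf \<A>"
  unfolding zero_fun_def by (rule Cinf_on_const)

lemma constant_series_formal: "f \<in> Cinf \<A> \<Longrightarrow> constant_series f \<in> formal_functions \<A>"
  by (simp add: formal_functions_def constant_series_def)

lemma c_zero_left [simp]: "w \<in> Cinf \<A> \<Longrightarrow> c k 0 w = 0"
  using c_lin_left[of 0 0 w k 0 0] by (simp add: zero_fun_def)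

lemma c_zero_right [simp]: "w \<in> Cinf \<A> \<Longrightarrow> c k w 0 = 0"
  using c_lin_right[of 0 0 w k 0 0] by (simp add: zero_fun_def)

lemma c_diff_left: "f \<in> Cinf \<A> \<Longrightarrow> g \<in> Cinf \<A> \<Longrightarrow> w \<in> Cinf \<A>
    \<Longrightarrow> c k (\<lambda>x. f x - g x) w x = c k f w x - c k g w x"
  using c_lin_left[of f g w k 1 "-1"] by simp

lemma c_diff_right: "f \<in> Cinf \<A> \<Longrightarrow> g \<in> Cinf \<A> \<Longrightarrow> w \<in> Cinf \<A>
    \<Longrightarrow> c k w (\<lambda>x. f x - g x) x = c k w f x - c k w g x"
  using c_lin_right[of f g w k 1 "-1"] by simp

lemma c_sum_left:
  assumes "\<And>i. i \<in> I \<Longrightarrow> f i \<in> Cinf \<A>" "w \<in> Cinf \<A>"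
  shows "c k (\<lambda>x. \<Sum>i\<in>I. f i x) w = (\<lambda>x. \<Sum>i\<in>I. c k (f i) w x)"
  using assms(1)
proof (induction I rule: infinite_finite_induct)
  case (insert i I)
  then show ?case using c_lin_left[of "f i" "\<lambda>x. \<Sum>i\<in>I. f i x" w k 1 1] assms(2) Cinf_sum[of I f] by simp
qed (use c_zero_left[OF assms(2), of k] in \<open>simp_all add: zero_fun_def\<close>)

lemma c_sum_right:
  assumes "\<And>i. i \<in> I \<Longrightarrow> f i \<in> Cinf \<A>" "w \<in> Cinf \<A>"
  shows "c k w (\<lambda>x. \<Sum>i\<in>I. f i x) = (\<lambda>x. \<Sum>i\<in>I. c k w (f i) x)"
  using assms(1)
proof (induction I rule: infinite_finite_induct)
  case (insert i I)
  then show ?case using c_lin_right[of "f i" "\<lambda>x. \<Sum>i\<in>I. f i x" w k 1 1] assms(2) Cinf_sum[of I f] by simp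
qed (use c_zero_right[OF assms(2), of k] in \<open>simp_all add: zero_fun_def\<close>)

lemma bidiff_rep:
  assumes ch: "(U, \<phi>) \<in> \<A>" and p: "p \<in> U"
  obtains W J a where "open W" "p \<in> W" "W \<subseteq> U" "finite J"
    "\<And>vs ws. (vs, ws) \<in> J \<Longrightarrow> length vs \<le> k \<and> length ws \<le> k \<and> a (vs, ws) \<in> Cinf_on \<A> W"
    "\<And>f g x. f \<in> Cinf \<A> \<Longrightarrow> g \<in> Cinf \<A> \<Longrightarrow> x \<in> W \<Longrightarrow> c k f g x =
       (\<Sum>(vs, ws)\<in>J. a (vs, ws) x * local_deriv U \<phi> vs f x * local_deriv U \<phi> ws g x)"
proof -
  have "\<forall>p\<in>U. \<exists>W J a. open W \<and> p \<in> W \<and> W \<subseteq> U \<and> finite J \<and>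
        (\<forall>(vs, ws)\<in>J. length vs \<le> k \<and> length ws \<le> k \<and> a (vs, ws) \<in> Cinf_on \<A> W) \<and>
        (\<forall>f\<in>Cinf \<A>. \<forall>g\<in>Cinf \<A>. \<forall>x\<in>W. c k f g x =
           (\<Sum>(vs, ws)\<in>J. a (vs, ws) x * local_deriv U \<phi> vs f x * local_deriv U \<phi> ws g x))"
    using bspec[OF bidiff[of k, unfolded bidiff_op_def] ch] unfolding prod.case .
  from bspec[OF this p] obtain W J a where *: "open W" "p \<in> W" "W \<subseteq> U" "finite J"
    "\<forall>(vs, ws)\<in>J. length vs \<le> k \<and> length ws \<le> k \<and> a (vs, ws) \<in> Cinf_on \<A> W"
    "\<forall>f\<in>Cinf \<A>. \<forall>g\<in>Cinf \<A>. \<forall>x\<in>W. c k f g x =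
       (\<Sum>(vs, ws)\<in>J. a (vs, ws) x * local_deriv U \<phi> vs f x * local_deriv U \<phi> ws g x)"
    by (elim exE conjE)
  show thesis
    by (rule that[OF *(1-4)]) (use *(5,6) in fast)+
qed

lemma c_local:
  assumes fg: "f \<in> Cinf \<A>" "f' \<in> Cinf \<A>" "g \<in> Cinf \<A>" "g' \<in> Cinf \<A>"
    and V: "open V" "x \<in> V" "\<And>y. y \<in> V \<Longrightarrow> f y = f' y" "\<And>y. y \<in> V \<Longrightarrow> g y = g' y"
  shows "c k f g x = c k f' g' x"
proof -
  obtain U \<phi> where ch: "(U, \<phi>) \<in> \<A>" "x \<in> U" by (rule chart_at)
  obtain W J a where W: "x \<in> W" and rep: "\<And>f g x. f \<in> Cinf \<A> \<Longrightarrow> g \<in> Cinf \<A> \<Longrightarrow> x \<in> W \<Longrightarrow> c k f g x =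
           (\<Sum>(vs, ws)\<in>J. a (vs, ws) x * local_deriv U \<phi> vs f x * local_deriv U \<phi> ws g x)"
    by (rule bidiff_rep[OF ch, where k = k]) blast
  have loc: "local_deriv U \<phi> vs h x = local_deriv U \<phi> vs h' x" if "\<And>y. y \<in> V \<Longrightarrow> h y = h' y" for vs h h'
    unfolding local_deriv_def
    by (rule iter_deriv_cong[OF chart_image_open[OF ch(1) V(1)]]) (use ch V(2) that in auto)
  show ?thesis
    using loc[OF V(3)] loc[OF V(4)] by (simp add: rep[OF _ _ W] fg)
qed

lemma star_const_left:
  assumes "f \<in> Cinf \<A>" "\<And>n. G n \<in> Cinf \<A>"
  shows "star c (constant_series f) G n x = (\<Sum>k\<le>n. c k f (G (n - k)) x)"
proof -
  have "(\<Sum>i\<le>n - k. c k (constant_series f i) (G (n - k - i)) x) = c k f (G (n - k)) x" if "k \<le> n" for k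
  proof -
    have "(\<Sum>i\<le>n - k. c k (constant_series f i) (G (n - k - i)) x)
        = (\<Sum>i\<le>n - k. if i = 0 then c k f (G (n - k - i)) x else 0)"
      by (rule sum.cong) (auto simp: constant_series_def assms)
    then show ?thesis by (simp add: sum.delta)
  qed
  then show ?thesis by (simp add: star_def)
qed

lemma star_const_right:
  assumes "g \<in> Cinf \<A>" "\<And>n. F n \<in> Cinf \<A>"
  shows "star c F (constant_series g) n x = (\<Sum>k\<le>n. c k (F (n - k)) g x)"
proof -
  have "(\<Sum>i\<le>n - k. c k (F i) (constant_series g (n - k - i)) x) = c k (F (n - k)) g x" if "k \<le> n" for k
  proof -
    have "(\<Sum>i\<le>n - k. c k (F i) (constant_series g (n - k - i)) x)
        = (\<Sum>i\<le>n - k. if i = n - k then c k (F i) g x else 0)"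
      by (rule sum.cong) (auto simp: constant_series_def assms)
    then show ?thesis by (simp add: sum.delta)
  qed
  then show ?thesis by (simp add: star_def)
qed

lemma star_const_const:
  assumes "f \<in> Cinf \<A>" "g \<in> Cinf \<A>"
  shows "star c (constant_series f) (constant_series g) = (\<lambda>n. c n f g)"
proof (intro ext)
  fix n x
  have "star c (constant_series f) (constant_series g) n x = (\<Sum>k\<le>n. if k = n then c k f g x else 0)"
    unfolding star_const_left[OF assms(1), of "constant_series g", OF constant_series_formal[OF assms(2), unfolded formal_functions_def, simplified, rule_format]]
    by (rule sum.cong) (auto simp: constant_series_def assms)
  then show "star c (constant_series f) (constant_series g) n x = c n f g x" by (simp add: sum.delta)
qed

lemma c_assoc:
  assumes "f \<in> Cinf \<A>" "g \<in> Cinf \<A>" "w \<in> Cinf \<A>"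
  shows "(\<Sum>k\<le>n. c k (c (n - k) f g) w x) = (\<Sum>k\<le>n. c k f (c (n - k) g w) x)"
proof -
  have "star c (\<lambda>n. c n f g) (constant_series w) n x = star c (constant_series f) (\<lambda>n. c n g w) n x"
    using star_assoc[OF assms[THEN constant_series_formal]] assms by (simp add: star_const_const)
  then show ?thesis using assms by (simp add: star_const_left star_const_right c_smooth)
qed

lemma c_unit:
  assumes "f \<in> Cinf \<A>"
  shows "c (Suc n) (\<lambda>x. r) f x = 0" "c (Suc n) f (\<lambda>x. r) x = 0"
proof -
  have "c (Suc n) (\<lambda>x. 1) f x = 0" "c (Suc n) f (\<lambda>x. 1) x = 0"
    using fun_cong[OF star_unit_left[OF constant_series_formal[OF assms]], of "Suc n"]
      fun_cong[OF star_unit_right[OF constant_series_formal[OF assms]], of "Suc n"] assms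
    by (simp_all add: star_const_const) (simp_all add: constant_series_def)
  then show "c (Suc n) (\<lambda>x. r) f x = 0" "c (Suc n) f (\<lambda>x. r) x = 0"
    using c_lin_left[of "\<lambda>x. 1" "\<lambda>x. 1" f "Suc n" r 0] c_lin_right[of "\<lambda>x. 1" "\<lambda>x. 1" f "Suc n" r 0] assms
    by simp_all
qed

text \<open>Hamiltonian vectors were found point by point, with no statement on smoothness.
  Smoothness of the bracket is read off from the antisymmetric part of \<open>c 1\<close>.\<close>

lemma pb_smooth:
  assumes "f \<in> Cinf \<A>" "g \<in> Cinf \<A>"
  shows "pb f g \<in> Cinf \<A>"
proof -
  have "pb f g = (\<lambda>x. - \<i> * (c 1 f g x - c 1 g f x))"
    using c_1[OF assms] by (auto simp: fun_eq_iff)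
  also have "\<dots> \<in> Cinf \<A>"
    by (intro Cinf_mult Cinf_diff c_smooth assms Cinf_on_const)
  finally show ?thesis .
qed

subsection \<open>Derivations in terms of coefficients\<close>

text \<open>The Leibniz rule in degree \<open>n\<close> on functions that do not contain
  \<open>h\<close>. By \<open>star_derivation_iff\<close> this is what remains to be checked once
  the operators are linear and preserve smoothness.\<close>

definition coeff_derivation :: "(nat \<Rightarrow> 'm cop) \<Rightarrow> bool" where
  "coeff_derivation B \<longleftrightarrow> (\<forall>n. \<forall>f\<in>Cinf \<A>. \<forall>g\<in>Cinf \<A>. \<forall>x.
     (\<Sum>k\<le>n. B k (c (n - k) f g) x) = (\<Sum>k\<le>n. c k (B (n - k) f) g x + c k f (B (n - k) g) x))"

context
  fixes B :: "nat \<Rightarrow> 'm cop"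
  assumes B_smooth: "\<And>n f. f \<in> Cinf \<A> \<Longrightarrow> B n f \<in> Cinf \<A>"
    and B_lin: "\<And>n f g a b. f \<in> Cinf \<A> \<Longrightarrow> g \<in> Cinf \<A>
      \<Longrightarrow> B n (\<lambda>x. a * f x + b * g x) = (\<lambda>x. a * B n f x + b * B n g x)"
begin

lemma operator_zero: "B n 0 = 0"
  using B_lin[of 0 0 n 0 0] by (simp add: zero_fun_def)

lemma operator_sum:
  assumes "\<And>i. i \<in> I \<Longrightarrow> f i \<in> Cinf \<A>"
  shows "B n (\<lambda>x. \<Sum>i\<in>I. f i x) = (\<lambda>x. \<Sum>i\<in>I. B n (f i) x)"
  using assms
proof (induction I rule: infinite_finite_induct)
  case (insert i I)
  then show ?case using B_lin[of "f i" "\<lambda>x. \<Sum>i\<in>I. f i x" n 1 1] Cinf_sum[of I f] by simp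
qed (use operator_zero[of n] in \<open>simp_all add: zero_fun_def\<close>)

lemma apply_series_const:
  assumes "f \<in> Cinf \<A>"
  shows "apply_series B (constant_series f) = (\<lambda>n. B n f)"
proof (intro ext)
  fix n x
  have "apply_series B (constant_series f) n x = (\<Sum>i\<le>n. if i = n then B i f x else 0)"
    unfolding apply_series_def by (rule sum.cong) (auto simp: constant_series_def operator_zero)
  then show "apply_series B (constant_series f) n x = B n f x" by (simp add: sum.delta)
qed

lemma derivation_imp_coeff:
  assumes D: "\<And>f g. f \<in> formal_functions \<A> \<Longrightarrow> g \<in> formal_functions \<A> \<Longrightarrow>
    apply_series B (star c f g) = star c (apply_series B f) g + star c f (apply_series B g)"
  shows "coeff_derivation B"
  unfolding coeff_derivation_def
proof (intro allI ballI)
  fix n x and f g :: "'m \<Rightarrow> complex" assume fg: "f \<in> Cinf \<A>" "g \<in> Cinf \<A>"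
  have "apply_series B (\<lambda>n. c n f g) n x = star c (\<lambda>n. B n f) (constant_series g) n x
      + star c (constant_series f) (\<lambda>n. B n g) n x"
    using D[OF fg[THEN constant_series_formal]] fg
    by (simp add: star_const_const apply_series_const fun_eq_iff)
  then show "(\<Sum>k\<le>n. B k (c (n - k) f g) x) = (\<Sum>k\<le>n. c k (B (n - k) f) g x + c k f (B (n - k) g) x)"
    using fg by (simp add: star_const_left star_const_right B_smooth sum.distrib apply_series_def)
qed

text \<open>Both sides are sums over triples of degrees. With the degrees \<open>i\<close> of
  \<open>f\<close> and \<open>j\<close> of \<open>g\<close> fixed, what is left is
  \<open>coeff_derivation\<close> for \<open>f i\<close> and \<open>g j\<close> in degree
  \<open>n - i - j\<close>; the rest is reindexing.\<close>

lemma coeff_imp_derivation: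
  assumes D: "coeff_derivation B" and F: "f \<in> formal_functions \<A>" and G: "g \<in> formal_functions \<A>"
  shows "apply_series B (star c f g) = star c (apply_series B f) g + star c f (apply_series B g)"
proof (intro ext)
  fix n x
  have fC: "f i \<in> Cinf \<A>" and gC: "g i \<in> Cinf \<A>" for i using F G by (auto simp: formal_functions_def)
  note sC = Cinf_sum c_smooth B_smooth fC gC
  have DD: "(\<Sum>l\<le>m. B l (c (m - l) (f i) (g j)) x)
      = (\<Sum>l\<le>m. c l (B (m - l) (f i)) (g j) x + c l (f i) (B (m - l) (g j)) x)" for m i j
    using D fC gC unfolding coeff_derivation_def by blast
  let ?T = "{(i, j, l). i + j + l \<le> n} :: (nat \<times> nat \<times> nat) set"
  have "apply_series B (star c f g) n x
      = (\<Sum>l\<le>n. \<Sum>k\<le>n - l. \<Sum>i\<le>n - l - k. B l (c k (f i) (g (n - l - k - i))) x)"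
    unfolding apply_series_def star_def
    by (simp add: operator_sum sC)
  also have "\<dots> = (\<Sum>(i, j, l)\<in>?T. B l (c (n - i - j - l) (f i) (g j)) x)"
    unfolding sum_nested_triple
    by (rule sum.reindex_bij_witness[of _ "\<lambda>(i, j, l). (l, n - i - j - l, i)" "\<lambda>(l, k, i). (i, n - l - k - i, l)"])
      (auto simp: algebra_simps)
  also have "\<dots> = (\<Sum>i\<le>n. \<Sum>j\<le>n - i. \<Sum>l\<le>n - i - j. B l (c (n - i - j - l) (f i) (g j)) x)"
    unfolding sum_nested_triple ..
  also have "\<dots> = (\<Sum>i\<le>n. \<Sum>j\<le>n - i. \<Sum>l\<le>n - i - j. c l (B (n - i - j - l) (f i)) (g j) x
      + c l (f i) (B (n - i - j - l) (g j)) x)"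
    by (simp only: DD)
  also have "\<dots> = (\<Sum>(i, j, k)\<in>?T. c k (B (n - i - j - k) (f i)) (g j) x)
      + (\<Sum>(i, j, k)\<in>?T. c k (f i) (B (n - i - j - k) (g j)) x)"
    unfolding sum.distrib sum_nested_triple ..
  also have "(\<Sum>(i, j, k)\<in>?T. c k (B (n - i - j - k) (f i)) (g j) x)
      = (\<Sum>(k, s, l)\<in>{(k, s, l). k + s \<le> n \<and> l \<le> s}. c k (B l (f (s - l))) (g (n - k - s)) x)"
    by (rule sum.reindex_bij_witness[of _ "\<lambda>(k, s, l). (s - l, n - k - s, k)" "\<lambda>(i, j, k). (k, n - j - k, n - i - j - k)"])
      (auto simp: algebra_simps)
  also have "\<dots> = star c (apply_series B f) g n x"
    unfolding sum_nested_triple'[symmetric] star_def apply_series_def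
    by (simp add: c_sum_left sC)
  also have "(\<Sum>(i, j, k)\<in>?T. c k (f i) (B (n - i - j - k) (g j)) x)
      = (\<Sum>(k, i, l)\<in>?T. c k (f i) (B l (g (n - k - i - l))) x)"
    by (rule sum.reindex_bij_witness[of _ "\<lambda>(k, i, l). (i, n - k - i - l, k)" "\<lambda>(i, j, k). (k, i, n - i - j - k)"])
      (auto simp: algebra_simps)
  also have "\<dots> = star c f (apply_series B g) n x"
    unfolding sum_nested_triple[symmetric] star_def apply_series_def
    by (simp add: c_sum_right sC)
  finally show "apply_series B (star c f g) n x
      = (star c (apply_series B f) g + star c f (apply_series B g)) n x" by simp
qed

end

lemma star_derivation_iff:
  "star_derivation \<A> c B \<longleftrightarrow>
     (\<forall>n f. f \<notin> Cinf \<A> \<longrightarrow> B n f = 0) \<and>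
     (\<forall>n. \<forall>f\<in>Cinf \<A>. B n f \<in> Cinf \<A>) \<and>
     (\<forall>n. \<forall>f\<in>Cinf \<A>. \<forall>g\<in>Cinf \<A>. \<forall>a b.
        B n (\<lambda>x. a * f x + b * g x) = (\<lambda>x. a * B n f x + b * B n g x)) \<and>
     coeff_derivation B"
  (is "?L \<longleftrightarrow> ?R")
proof
  assume L: ?L
  have "coeff_derivation B"
    by (rule derivation_imp_coeff) (use L in \<open>unfold star_derivation_def, blast+\<close>)
  with L show ?R unfolding star_derivation_def by blast
next
  assume R: ?R
  have "apply_series B (star c f g) = star c (apply_series B f) g + star c f (apply_series B g)"
    if "f \<in> formal_functions \<A>" "g \<in> formal_functions \<A>" for f g
    by (rule coeff_imp_derivation[OF _ _ _ that]) (use R in blast)+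
  with R show ?L unfolding star_derivation_def by blast
qed

lemma star_derivationD:
  assumes "star_derivation \<A> c B"
  shows "f \<notin> Cinf \<A> \<Longrightarrow> B n f = 0" and "f \<in> Cinf \<A> \<Longrightarrow> B n f \<in> Cinf \<A>"
    and "f \<in> Cinf \<A> \<Longrightarrow> g \<in> Cinf \<A> \<Longrightarrow> B n (\<lambda>x. a * f x + b * g x) = (\<lambda>x. a * B n f x + b * B n g x)"
    and "f \<in> Cinf \<A> \<Longrightarrow> g \<in> Cinf \<A> \<Longrightarrow> (\<Sum>k\<le>n. B k (c (n - k) f g) x)
      = (\<Sum>k\<le>n. c k (B (n - k) f) g x + c k f (B (n - k) g) x)"
  using assms unfolding star_derivation_iff coeff_derivation_def by blast+

end

text \<open>Provides the sequence of vector fields in \<open>derivation_imp_FD\<close>, where each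
  coefficient depends on all earlier ones.\<close>

lemma nat_course_of_values:
  fixes F :: "nat \<Rightarrow> (nat \<Rightarrow> 'b) \<Rightarrow> 'b"
  assumes "\<And>n f g. (\<And>k. k < n \<Longrightarrow> f k = g k) \<Longrightarrow> F n f = F n g"
  obtains Y where "\<And>n. Y n = F n Y"
proof (rule that)
  let ?Y = "wfrec less_than (\<lambda>f n. F n f)"
  fix n
  have "?Y n = F n (cut ?Y less_than n)" by (rule wfrec) simp
  also have "\<dots> = F n ?Y" by (rule assms) (simp add: cut_apply)
  finally show "?Y n = F n ?Y" .
qed

section \<open>Potentials and linear combinations of symplectic fields\<close>

context symplectic
begin

lemma ex_potential:
  assumes "Y \<in> symplectic_fields \<A> \<omega>"
  obtains b N where "b \<in> Cinf \<A>" "open N" "p \<in> N" "\<And>x f. x \<in> N \<Longrightarrow> f \<in> Cinf \<A> \<Longrightarrow> Y f x = pb b f x"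
proof -
  \<comment> \<open>A single field is a constant family; the manifold itself serves as parameter
    space.\<close>
  interpret Q: symplectic_param \<A> \<A> \<omega> ..
  have "(\<lambda>(\<sigma>, x). Y f x) \<in> Cinf (prod_atlas \<A> \<A>)" if "f \<in> Cinf \<A>" for f
    using Q.Cinf_snd[OF vfields_Cinf[OF symplectic_vfield[OF assms] that]] by (simp add: case_prod_unfold)
  then obtain b S N where b: "b \<in> Cinf (prod_atlas \<A> \<A>)" "open S" "p \<in> S" "open N" "p \<in> N"
    "\<And>\<sigma> x f. \<sigma> \<in> S \<Longrightarrow> x \<in> N \<Longrightarrow> f \<in> Cinf \<A> \<Longrightarrow> Y f x = pb (\<lambda>x. b (\<sigma>, x)) f x"
    using Q.local_potential[of "\<lambda>_. Y" p p] assms by blast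
  show thesis
    by (rule that[OF Q.Cinf_slice[OF b(1)] b(4,5) b(6)[OF b(3)]])
qed

lemma symplectic_zero: "0 \<in> symplectic_fields \<A> \<omega>"
proof -
  have v0: "vat 0 p = (\<lambda>f. 0)" for p :: 'm by (simp add: vat_def)
  have "(\<lambda>f x. 0 :: complex) \<in> vfields \<A>"
    using vfields_comb_sum[of "{} :: nat set" "\<lambda>_. undefined" "\<lambda>_. undefined"] by simp
  then have z: "(0 :: 'm cop) \<in> vfields \<A>" by (simp add: zero_fun_def)
  have br0: "lie_bracket 0 X = 0" if "X \<in> vfields \<A>" for X :: "'m cop"
    using vfields_const[OF that, of 0] by (auto simp: lie_bracket_def fun_eq_iff zero_fun_def)
  have "lie_form 0 X Z p = 0" if XZ: "X \<in> vfields \<A>" "Z \<in> vfields \<A>" for X Z p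
    unfolding lie_form_def eval2_def br0[OF XZ(1)] br0[OF XZ(2)] v0
    using form_zero_left[OF vfields_tangent[OF XZ(2)], of p]
      form_sum_right[of "{}" undefined p "vat X p" undefined] vfields_tangent[OF XZ(1)] by simp
  then show ?thesis
    using z unfolding symplectic_fields_def lie_form_def by (auto simp: fun_eq_iff)
qed

lemma symplectic_comb:
  assumes Y: "Y \<in> symplectic_fields \<A> \<omega>" "Y' \<in> symplectic_fields \<A> \<omega>"
  shows "(\<lambda>f x. a * Y f x + a' * Y' f x) \<in> symplectic_fields \<A> \<omega>"
proof -
  let ?W = "\<lambda>f x. a * Y f x + a' * Y' f x"
  have Yv: "Y \<in> vfields \<A>" "Y' \<in> vfields \<A>" using Y by (auto simp: symplectic_vfield)
  have W: "?W \<in> vfields \<A>" by (rule vfields_comb[OF Yv])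
  have br: "vat (lie_bracket ?W X) p = (\<lambda>f. a * vat (lie_bracket Y X) p f + a' * vat (lie_bracket Y' X) p f)"
    if X: "X \<in> vfields \<A>" for X p
  proof
    fix f show "vat (lie_bracket ?W X) p f = a * vat (lie_bracket Y X) p f + a' * vat (lie_bracket Y' X) p f"
    proof (cases "f \<in> Cinf \<A>")
      case True
      show ?thesis
        using vfields_lin[OF X vfields_Cinf[OF Yv(1) True] vfields_Cinf[OF Yv(2) True], of a a' p]
        by (simp add: lie_bracket_def algebra_simps)
    next
      case False
      then show ?thesis
        using vfields_nonsmooth[OF vfields_lie_bracket[OF W X] False]
          vfields_nonsmooth[OF vfields_lie_bracket[OF Yv(1) X] False] vfields_nonsmooth[OF vfields_lie_bracket[OF Yv(2) X] False]
        by simp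
    qed
  qed
  have ev: "eval2 \<omega> (lie_bracket ?W X) Z p = a * eval2 \<omega> (lie_bracket Y X) Z p + a' * eval2 \<omega> (lie_bracket Y' X) Z p"
    if XZ: "X \<in> vfields \<A>" "Z \<in> vfields \<A>" for X Z p
    unfolding eval2_def br[OF XZ(1)]
    by (rule form_lin_left) (intro vfields_tangent vfields_lie_bracket Yv XZ)+
  have "lie_form ?W X Z p = a * lie_form Y X Z p + a' * lie_form Y' X Z p"
    if XZ: "X \<in> vfields \<A>" "Z \<in> vfields \<A>" for X Z p
    using ev[OF XZ, of p] ev[OF XZ(2,1), of p]
      eval2_antisym[OF XZ(1) vfields_lie_bracket[OF W XZ(2)], of p]
      eval2_antisym[OF XZ(1) vfields_lie_bracket[OF Yv(1) XZ(2)], of p]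
      eval2_antisym[OF XZ(1) vfields_lie_bracket[OF Yv(2) XZ(2)], of p]
    by (simp add: lie_form_def algebra_simps)
  moreover have "lie_form Y X Z p = 0" "lie_form Y' X Z p = 0" if "X \<in> vfields \<A>" "Z \<in> vfields \<A>" for X Z p
    using Y that unfolding symplectic_fields_def lie_form_def by (auto simp: fun_eq_iff)
  ultimately have "lie_form ?W X Z p = 0" if "X \<in> vfields \<A>" "Z \<in> vfields \<A>" for X Z p
    using that by simp
  then show ?thesis
    unfolding symplectic_fields_def lie_form_def using W by (auto simp: fun_eq_iff)
qed

end

context star_manifold
begin

subsection \<open>Inner derivations\<close>

text \<open>The degree \<open>n\<close> part of the commutator with \<open>b\<close> divided by
  \<open>h\<close>. The division is possible because \<open>c 0\<close> is commutative.\<close>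

definition comm :: "('m \<Rightarrow> complex) \<Rightarrow> nat \<Rightarrow> 'm cop" where
  "comm b n f x = c (Suc n) b f x - c (Suc n) f b x"

lemma comm_smooth: "b \<in> Cinf \<A> \<Longrightarrow> f \<in> Cinf \<A> \<Longrightarrow> comm b n f \<in> Cinf \<A>"
  unfolding comm_def[abs_def] by (intro Cinf_diff c_smooth)

lemma comm_lin:
  "b \<in> Cinf \<A> \<Longrightarrow> f \<in> Cinf \<A> \<Longrightarrow> g \<in> Cinf \<A>
    \<Longrightarrow> comm b n (\<lambda>x. a * f x + a' * g x) x = a * comm b n f x + a' * comm b n g x"
  by (simp add: comm_def c_lin_left c_lin_right algebra_simps)

lemma comm_lin_potential:
  "b \<in> Cinf \<A> \<Longrightarrow> b' \<in> Cinf \<A> \<Longrightarrow> f \<in> Cinf \<A>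
    \<Longrightarrow> comm (\<lambda>x. a * b x + a' * b' x) n f x = a * comm b n f x + a' * comm b' n f x"
  by (simp add: comm_def c_lin_left c_lin_right algebra_simps)

lemma comm_local:
  assumes "b \<in> Cinf \<A>" "b' \<in> Cinf \<A>" "f \<in> Cinf \<A>" "f' \<in> Cinf \<A>" "open V" "x \<in> V"
    "\<And>y. y \<in> V \<Longrightarrow> b y = b' y" "\<And>y. y \<in> V \<Longrightarrow> f y = f' y"
  shows "comm b n f x = comm b' n f' x"
  unfolding comm_def
  using c_local[OF assms(1-8)] c_local[OF assms(3,4,1,2,5,6,8,7)] by simp

lemma comm_zero: "b \<in> Cinf \<A> \<Longrightarrow> f \<in> Cinf \<A> \<Longrightarrow> comm b 0 f x = \<i> * pb b f x"
  using fun_cong[OF c_1, of b f x] by (simp add: comm_def)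

text \<open>That a commutator is a derivation follows from associativity for the triples
  \<open>b, f, g\<close> and \<open>f, b, g\<close> and \<open>f, g, b\<close>, here in degree
  \<open>Suc n\<close> because of the division by \<open>h\<close>. The terms at the ends of the
  sums contain \<open>c 0\<close>, and its symmetry lets them cancel.\<close>

lemma comm_derivation:
  assumes "b \<in> Cinf \<A>" "f \<in> Cinf \<A>" "g \<in> Cinf \<A>"
  shows "(\<Sum>k\<le>n. comm b k (c (n - k) f g) x)
    = (\<Sum>k\<le>n. c k (comm b (n - k) f) g x + c k f (comm b (n - k) g) x)"
proof -
  \<comment> \<open>\<open>L\<close> and \<open>R\<close> split off the last summand,
    \<open>L'\<close> and \<open>R'\<close> the summand for 0; in each case the isolated term is one
    that contains \<open>c 0\<close>.\<close>
  have L: "(\<Sum>k\<le>Suc n. c k (c (Suc n - k) u v) w x)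
      = (\<Sum>k\<le>n. c k (c (Suc (n - k)) u v) w x) + c (Suc n) (c 0 u v) w x" for u v w
    by (simp add: Suc_diff_le)
  have R: "(\<Sum>k\<le>Suc n. c k u (c (Suc n - k) v w) x)
      = (\<Sum>k\<le>n. c k u (c (Suc (n - k)) v w) x) + c (Suc n) u (c 0 v w) x" for u v w
    by (simp add: Suc_diff_le)
  have L': "(\<Sum>k\<le>Suc n. c k (c (Suc n - k) u v) w x)
      = c 0 (c (Suc n) u v) w x + (\<Sum>k\<le>n. c (Suc k) (c (n - k) u v) w x)" for u v w
    by (subst sum.atMost_Suc_shift) simp
  have R': "(\<Sum>k\<le>Suc n. c k u (c (Suc n - k) v w) x)
      = c 0 u (c (Suc n) v w) x + (\<Sum>k\<le>n. c (Suc k) u (c (n - k) v w) x)" for u v w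
    by (subst sum.atMost_Suc_shift) simp
  have c0: "c 0 u v = c 0 v u" if "u \<in> Cinf \<A>" "v \<in> Cinf \<A>" for u v
    using that by (simp add: c_0 mult.commute)
  note c0' = c0[OF assms(1,2)] c0[OF assms(1,3)] c0[OF assms(1) c_smooth[OF assms(2,3)], of "Suc n"]
  have A1: "(\<Sum>k\<le>n. c k (c (Suc (n - k)) b f) g x) + c (Suc n) (c 0 f b) g x
      = c 0 (c (Suc n) f g) b x + (\<Sum>k\<le>n. c (Suc k) b (c (n - k) f g) x)"
    using c_assoc[of b f g "Suc n" x] assms unfolding L R' c0' by simp
  have A2: "(\<Sum>k\<le>n. c k (c (Suc (n - k)) f b) g x) + c (Suc n) (c 0 f b) g x
      = (\<Sum>k\<le>n. c k f (c (Suc (n - k)) b g) x) + c (Suc n) f (c 0 g b) x"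
    using c_assoc[of f b g "Suc n" x] assms unfolding L R c0' by simp
  have A3: "c 0 (c (Suc n) f g) b x + (\<Sum>k\<le>n. c (Suc k) (c (n - k) f g) b x)
      = (\<Sum>k\<le>n. c k f (c (Suc (n - k)) g b) x) + c (Suc n) f (c 0 g b) x"
    using c_assoc[of f g b "Suc n" x] assms unfolding L' R by simp
  have arith: "l1 - l2 = p1 - p2 + (q1 - q2)"
    if "p1 + y = z + l1" "p2 + y = q1 + w" "z + l2 = q2 + w" for p1 p2 q1 q2 l1 l2 y z w :: complex
    using that by algebra
  have "(\<Sum>k\<le>n. comm b k (c (n - k) f g) x)
      = (\<Sum>k\<le>n. c (Suc k) b (c (n - k) f g) x) - (\<Sum>k\<le>n. c (Suc k) (c (n - k) f g) b x)"
    by (simp add: comm_def sum_subtractf)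
  also have "\<dots> = (\<Sum>k\<le>n. c k (c (Suc (n - k)) b f) g x) - (\<Sum>k\<le>n. c k (c (Suc (n - k)) f b) g x)
      + ((\<Sum>k\<le>n. c k f (c (Suc (n - k)) b g) x) - (\<Sum>k\<le>n. c k f (c (Suc (n - k)) g b) x))"
    by (rule arith[OF A1 A2 A3])
  also have "\<dots> = (\<Sum>k\<le>n. c k (comm b (n - k) f) g x + c k f (comm b (n - k) g) x)"
    unfolding comm_def[abs_def]
    by (simp add: c_diff_left c_diff_right c_smooth assms sum_subtractf sum.distrib)
  finally show ?thesis .
qed

subsection \<open>The derivation of a symplectic vector field\<close>

text \<open>\<open>b\<close> is global, since operators take global functions, but generates
  \<open>Y\<close> on \<open>N\<close> only.\<close>

definition potential :: "'m cop \<Rightarrow> ('m \<Rightarrow> complex) \<Rightarrow> 'm set \<Rightarrow> bool" where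
  "potential Y b N \<longleftrightarrow> b \<in> Cinf \<A> \<and> open N \<and> (\<forall>x\<in>N. \<forall>f\<in>Cinf \<A>. Y f x = pb b f x)"

lemma potential_at:
  assumes "Y \<in> symplectic_fields \<A> \<omega>"
  obtains b N where "potential Y b N" "p \<in> N"
proof -
  obtain b N where *: "b \<in> Cinf \<A>" "open N" "p \<in> N" "\<forall>x f. x \<in> N \<longrightarrow> f \<in> Cinf \<A> \<longrightarrow> Y f x = pb b f x"
    by (rule ex_potential[OF assms, of p]) blast
  show thesis by (rule that[of b N]) (use * in \<open>auto simp: potential_def\<close>)
qed

text \<open>By \<open>pb_zero_locally_const\<close> the two potentials differ by a constant near
  \<open>x\<close>. The commutator is local, and by \<open>c_unit\<close> it vanishes on
  constants.\<close>

lemma comm_potential_unique: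
  assumes "potential Y b N" "potential Y b' N'" "x \<in> N" "x \<in> N'" "f \<in> Cinf \<A>"
  shows "comm b n f x = comm b' n f x"
proof -
  have b: "b \<in> Cinf \<A>" "b' \<in> Cinf \<A>" and N: "open N" "open N'" using assms by (auto simp: potential_def)
  define d where "d = (\<lambda>x. 1 * b x + (-1) * b' x)"
  have d: "d \<in> Cinf \<A>" unfolding d_def by (rule Cinf_lin[OF b])
  have z: "pb d g y = 0" if "g \<in> Cinf \<A>" "y \<in> N \<inter> N'" for g y
    using pb_lin_left[OF b, of 1 "-1" g y] that assms(1,2) by (auto simp: d_def potential_def)
  have xN: "x \<in> N \<inter> N'" using assms(3,4) by blast
  obtain V where V: "open V" "x \<in> V" "\<And>y. y \<in> V \<Longrightarrow> d y = d x"
    by (rule pb_zero_locally_const[OF d open_Int[OF N] xN z]) blast+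
  have "comm d n f x = comm (\<lambda>y. d x) n f x"
    by (rule comm_local[OF d _ assms(5) assms(5) V(1,2)]) (use V(3) in auto)
  also have "\<dots> = 0" by (simp add: comm_def c_unit[OF assms(5)])
  finally show ?thesis using comm_lin_potential[OF b assms(5), of 1 "-1" n x] by (simp add: d_def)
qed

lemma germ_ext:
  fixes b :: "'m \<Rightarrow> complex"
  assumes "open U" "x \<in> U" "b \<in> Cinf_on \<A> U"
  obtains W where "germ_ext \<A> b x \<in> Cinf \<A>" "open W" "x \<in> W" "\<And>y. y \<in> W \<Longrightarrow> germ_ext \<A> b x y = b y"
proof -
  have "\<exists>g. g \<in> Cinf \<A> \<and> (\<exists>W. open W \<and> x \<in> W \<and> (\<forall>y\<in>W. g y = b y))"
    by (rule Cinf_extend[OF assms]) blast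
  from someI_ex[OF this] obtain W where
    "germ_ext \<A> b x \<in> Cinf \<A>" "open W" "x \<in> W" "\<forall>y\<in>W. germ_ext \<A> b x y = b y"
    unfolding germ_ext_def by blast
  then show thesis by (intro that) auto
qed

context
  fixes Y :: "'m cop"
  assumes Y: "Y \<in> symplectic_fields \<A> \<omega>"
begin

text \<open>The choice is made afresh at every point; by \<open>comm_potential_unique\<close> the
  value does not depend on it, and near each point one potential serves throughout.\<close>

definition glued :: "nat \<Rightarrow> 'm cop" where
  "glued n f x = (if f \<in> Cinf \<A> then comm (SOME b. \<exists>N. potential Y b N \<and> x \<in> N) n f x else 0)"

lemma glued_comm:
  assumes "potential Y b N" "x \<in> N" "f \<in> Cinf \<A>"
  shows "glued n f x = comm b n f x"
proof -
  obtain N' where "potential Y (SOME b. \<exists>N. potential Y b N \<and> x \<in> N) N'" "x \<in> N'"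
    using someI_ex[of "\<lambda>b. \<exists>N. potential Y b N \<and> x \<in> N"] assms by blast
  from comm_potential_unique[OF this(1) assms(1) this(2) assms(2,3)]
  show ?thesis using assms(3) by (simp add: glued_def)
qed

lemma star_derivation_glued: "star_derivation \<A> c glued"
proof -
  have smooth: "glued n f \<in> Cinf \<A>" if f: "f \<in> Cinf \<A>" for n f
  proof (rule Cinf_on_local)
    fix p :: 'm
    obtain b N where b: "potential Y b N" "p \<in> N" by (rule potential_at[OF Y])
    have bN: "b \<in> Cinf \<A>" "open N" using b by (auto simp: potential_def)
    have "glued n f \<in> Cinf_on \<A> N"
      by (rule Cinf_on_cong[OF Cinf_imp_Cinf_on[OF comm_smooth[OF bN(1) f]] bN(2)])
        (rule glued_comm[OF b(1) _ f, symmetric])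
    then show "\<exists>V. open V \<and> p \<in> V \<and> glued n f \<in> Cinf_on \<A> V" using b(2) bN(2) by blast
  qed
  have lin: "glued n (\<lambda>x. a * f x + a' * g x) x = a * glued n f x + a' * glued n g x"
    if fg: "f \<in> Cinf \<A>" "g \<in> Cinf \<A>" for n f g a a' x
  proof -
    obtain b N where b: "potential Y b N" "x \<in> N" by (rule potential_at[OF Y])
    have "b \<in> Cinf \<A>" using b by (auto simp: potential_def)
    then show ?thesis using glued_comm[OF b] fg Cinf_lin[OF fg] comm_lin by simp
  qed
  have "coeff_derivation glued"
    unfolding coeff_derivation_def
  proof (intro allI ballI)
    fix n x and f g :: "'m \<Rightarrow> complex" assume fg: "f \<in> Cinf \<A>" "g \<in> Cinf \<A>"
    obtain b N where b: "potential Y b N" "x \<in> N" by (rule potential_at[OF Y])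
    have bN: "b \<in> Cinf \<A>" "open N" using b by (auto simp: potential_def)
    \<comment> \<open>Inside \<open>c k\<close>, agreement on the neighbourhood \<open>N\<close> is
      enough because \<open>c k\<close> is local.\<close>
    have l: "c k (glued m f) g x = c k (comm b m f) g x" "c k f (glued m g) x = c k f (comm b m g) x" for k m
      by (rule c_local[OF smooth[OF fg(1)] comm_smooth[OF bN(1) fg(1)] fg(2) fg(2) bN(2) b(2)];
          simp add: glued_comm[OF b(1)] fg)
        (rule c_local[OF fg(1) fg(1) smooth[OF fg(2)] comm_smooth[OF bN(1) fg(2)] bN(2) b(2)];
          simp add: glued_comm[OF b(1)] fg)
    show "(\<Sum>k\<le>n. glued k (c (n - k) f g) x)
        = (\<Sum>k\<le>n. c k (glued (n - k) f) g x + c k f (glued (n - k) g) x)"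
      using comm_derivation[OF bN(1) fg, of n x] by (simp add: l glued_comm[OF b] c_smooth fg)
  qed
  moreover have "glued n f = 0" if "f \<notin> Cinf \<A>" for n f using that by (auto simp: glued_def fun_eq_iff)
  ultimately show ?thesis using smooth lin unfolding star_derivation_iff by blast
qed

definition represents :: "(nat \<Rightarrow> 'm cop) \<Rightarrow> bool" where
  "represents B \<longleftrightarrow> (\<forall>U b. open U \<and> contractible U \<and> b \<in> Cinf_on \<A> U \<and>
        (\<forall>f\<in>Cinf \<A>. \<forall>x\<in>U. Y f x = pb (germ_ext \<A> b x) f x) \<longrightarrow>
        (\<forall>f\<in>Cinf \<A>. \<forall>x\<in>U. \<forall>n. B n f x =
           star c (constant_series (germ_ext \<A> b x)) (constant_series f) (Suc n) x
           - star c (constant_series f) (constant_series (germ_ext \<A> b x)) (Suc n) x))"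

text \<open>Near \<open>x\<close> the extension \<open>germ_ext \<A> b x\<close> has the same germs
  as the extensions chosen at neighbouring points \<open>y\<close>. So it is a potential on a
  neighbourhood of \<open>x\<close>, not merely at \<open>x\<close>.\<close>

lemma represents_glued: "represents glued"
  unfolding represents_def
proof (intro allI impI ballI, elim conjE)
  fix U and b f :: "'m \<Rightarrow> complex" and x n
  assume U: "open U" and bU: "b \<in> Cinf_on \<A> U"
    and h: "\<forall>f\<in>Cinf \<A>. \<forall>x\<in>U. Y f x = pb (germ_ext \<A> b x) f x" and f: "f \<in> Cinf \<A>" and x: "x \<in> U"
  obtain W where W: "germ_ext \<A> b x \<in> Cinf \<A>" "open W" "x \<in> W" "\<And>y. y \<in> W \<Longrightarrow> germ_ext \<A> b x y = b y"
    using germ_ext[OF U x bU] by blast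
  have "potential Y (germ_ext \<A> b x) (W \<inter> U)"
    unfolding potential_def
  proof (intro conjI ballI W open_Int U)
    fix y and g :: "'m \<Rightarrow> complex" assume y: "y \<in> W \<inter> U" and g: "g \<in> Cinf \<A>"
    obtain W' where W': "germ_ext \<A> b y \<in> Cinf \<A>" "open W'" "y \<in> W'" "\<And>z. z \<in> W' \<Longrightarrow> germ_ext \<A> b y z = b z"
      using germ_ext[OF U _ bU, of y] y by blast
    have "Y g y = pb (germ_ext \<A> b y) g y" using h g y by blast
    also have "\<dots> = pb (germ_ext \<A> b x) g y"
      by (rule pb_local_left[OF W'(1) W(1) open_Int[OF W(2) W'(2)]]) (use W W' y in auto)
    finally show "Y g y = pb (germ_ext \<A> b x) g y" .
  qed
  then show "glued n f x = star c (constant_series (germ_ext \<A> b x)) (constant_series f) (Suc n) x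
           - star c (constant_series f) (constant_series (germ_ext \<A> b x)) (Suc n) x"
    using glued_comm[of "germ_ext \<A> b x" "W \<inter> U" x f n] W x f by (simp add: star_const_const comm_def)
qed

text \<open>A potential near \<open>x\<close>, restricted to a contractible neighbourhood, meets the
  premise of \<open>represents\<close>. This fixes the value at \<open>x\<close> of every operator
  that satisfies the condition.\<close>

lemma represents_unique:
  assumes "represents B" "f \<in> Cinf \<A>"
  shows "B n f x = glued n f x"
proof -
  obtain b N where b: "potential Y b N" "x \<in> N" by (rule potential_at[OF Y])
  have bN: "b \<in> Cinf \<A>" "open N" using b by (auto simp: potential_def)
  obtain U where U: "open U" "contractible U" "x \<in> U" "U \<subseteq> N"
    using contractible_neighbourhood[OF bN(2) b(2)] by blast
  have bU: "b \<in> Cinf_on \<A> U" by (rule Cinf_imp_Cinf_on[OF bN(1)])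
  have h: "\<forall>f\<in>Cinf \<A>. \<forall>x\<in>U. Y f x = pb (germ_ext \<A> b x) f x"
  proof (intro ballI)
    fix g :: "'m \<Rightarrow> complex" and y assume g: "g \<in> Cinf \<A>" and y: "y \<in> U"
    obtain W where W: "germ_ext \<A> b y \<in> Cinf \<A>" "open W" "y \<in> W" "\<And>z. z \<in> W \<Longrightarrow> germ_ext \<A> b y z = b z"
      using germ_ext[OF U(1) y bU] by blast
    have "Y g y = pb b g y" using b(1) g y U(4) by (auto simp: potential_def)
    also have "\<dots> = pb (germ_ext \<A> b y) g y"
      by (rule pb_local_left[OF bN(1) W(1) W(2,3)]) (use W(4) in auto)
    finally show "Y g y = pb (germ_ext \<A> b y) g y" .
  qed
  have *: "C n f x = star c (constant_series (germ_ext \<A> b x)) (constant_series f) (Suc n) x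
      - star c (constant_series f) (constant_series (germ_ext \<A> b x)) (Suc n) x" if "represents C" for C
    using that[unfolded represents_def, THEN spec, THEN spec, THEN mp,
        OF conjI[OF U(1) conjI[OF U(2) conjI[OF bU h]]]] assms(2) U(3) by blast
  show ?thesis using *[OF assms(1)] *[OF represents_glued] by simp
qed

lemma symplectic_derivation_eq: "symplectic_derivation \<A> \<omega> c Y = glued"
  unfolding symplectic_derivation_def represents_def[symmetric]
proof (rule the_equality)
  show "star_derivation \<A> c glued \<and> represents glued"
    using star_derivation_glued represents_glued by blast
  fix B assume B: "star_derivation \<A> c B \<and> represents B"
  show "B = glued"
  proof (intro ext)
    fix n f x show "B n f x = glued n f x"
      using represents_unique[of B f n x] B star_derivationD(1)[of B f n] star_derivationD(1)[OF star_derivation_glued, of f n]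
      by (cases "f \<in> Cinf \<A>") auto
  qed
qed

end

abbreviation SD :: "'m cop \<Rightarrow> nat \<Rightarrow> 'm cop" where
  "SD \<equiv> symplectic_derivation \<A> \<omega> c"

lemma SD_derivation: "Y \<in> symplectic_fields \<A> \<omega> \<Longrightarrow> star_derivation \<A> c (SD Y)"
  using symplectic_derivation_eq star_derivation_glued by simp

lemma SD_comm:
  "Y \<in> symplectic_fields \<A> \<omega> \<Longrightarrow> potential Y b N \<Longrightarrow> x \<in> N \<Longrightarrow> f \<in> Cinf \<A> \<Longrightarrow> SD Y n f x = comm b n f x"
  using symplectic_derivation_eq glued_comm by simp

lemma SD_nonsmooth: "Y \<in> symplectic_fields \<A> \<omega> \<Longrightarrow> f \<notin> Cinf \<A> \<Longrightarrow> SD Y n f = 0"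
  using star_derivationD(1)[OF SD_derivation] .

text \<open>The factor i comes from the normalisation of \<open>c 1\<close>; it is the source of the
  factor - i in the recursions for vector fields.\<close>

lemma SD_leading:
  assumes "Y \<in> symplectic_fields \<A> \<omega>" "f \<in> Cinf \<A>"
  shows "SD Y 0 f x = \<i> * Y f x"
proof -
  obtain b N where b: "potential Y b N" "x \<in> N" by (rule potential_at[OF assms(1)])
  then show ?thesis
    using SD_comm[OF assms(1) b assms(2)] comm_zero assms(2) by (simp add: potential_def)
qed

lemma SD_comb:
  assumes Y: "Y \<in> symplectic_fields \<A> \<omega>" "Y' \<in> symplectic_fields \<A> \<omega>"
  shows "SD (\<lambda>f x. a * Y f x + a' * Y' f x) n f x = a * SD Y n f x + a' * SD Y' n f x"
proof (cases "f \<in> Cinf \<A>")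
  case True
  obtain b N where b: "potential Y b N" "x \<in> N" by (rule potential_at[OF Y(1)])
  obtain b' N' where b': "potential Y' b' N'" "x \<in> N'" by (rule potential_at[OF Y(2)])
  have bC: "b \<in> Cinf \<A>" "b' \<in> Cinf \<A>" using b b' by (auto simp: potential_def)
  have "potential (\<lambda>f x. a * Y f x + a' * Y' f x) (\<lambda>x. a * b x + a' * b' x) (N \<inter> N')"
    using b b' bC by (auto simp: potential_def Cinf_lin pb_lin_left)
  from SD_comm[OF symplectic_comb[OF Y] this _ True] show ?thesis
    using b(2) b'(2) SD_comm[OF Y(1) b True] SD_comm[OF Y(2) b' True] comm_lin_potential[OF bC True] by simp
next
  case False
  then show ?thesis
    using SD_nonsmooth[OF symplectic_comb[OF Y] False] SD_nonsmooth[OF Y(1) False] SD_nonsmooth[OF Y(2) False] by simp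
qed

lemma SD_zero: "SD 0 n = 0"
proof (intro ext)
  fix f x
  have "(\<lambda>f x. 0 * (0 :: 'm cop) f x + 0 * (0 :: 'm cop) f x) = (0 :: 'm cop)" by (auto simp: fun_eq_iff)
  then show "SD 0 n f x = 0 f x"
    using SD_comb[OF symplectic_zero symplectic_zero, of 0 0 n f x] by simp
qed

end

section \<open>Differential operators\<close>

context smooth_manifold
begin

lemma local_deriv_smooth:
  fixes f :: "'a \<Rightarrow> complex"
  assumes ch: "(U, \<phi>) \<in> \<A>" and f: "f \<in> Cinf \<A>"
  shows "local_deriv U \<phi> vs f \<in> Cinf_on \<A> U"
  unfolding local_deriv_def
  by (rule Cinf_on_compose[OF smooth_on_iter_deriv[OF CinfD[OF f ch]] Cinf_on_chart[OF ch]])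
    (use chart_open[OF ch] chart_open_image[OF ch] in auto)

lemma iter_deriv_linear:
  assumes "smooth_on S f" "smooth_on S g" "open S" "x \<in> S"
  shows "iter_deriv vs (\<lambda>x. a * f x + b * g x) x = a * iter_deriv vs f x + b * iter_deriv vs g x"
  using assms(4)
proof (induction vs arbitrary: x)
  case (Cons v vs)
  have "iter_deriv (v # vs) (\<lambda>x. a * f x + b * g x) x
      = pd v (\<lambda>x. a * iter_deriv vs f x + b * iter_deriv vs g x) x"
    using frechet_derivative_cong_open[OF assms(3) Cons.prems Cons.IH] by simp
  also have "\<dots> = a * pd v (iter_deriv vs f) x + b * pd v (iter_deriv vs g) x"
    by (rule pd_linear_combination)
      (rule smooth_on_differentiable[OF smooth_on_iter_deriv Cons.prems], rule assms)+
  finally show ?case by simp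
qed simp

lemma diff_ops_rep:
  assumes D: "D \<in> diff_ops \<A> k" and ch: "(U, \<phi>) \<in> \<A>" and p: "p \<in> U"
  obtains W J a where "open W" "p \<in> W" "W \<subseteq> U" "finite J"
    "\<forall>vs\<in>J. length vs \<le> k \<and> a vs \<in> Cinf_on \<A> W"
    "\<forall>f\<in>Cinf \<A>. \<forall>x\<in>W. D f x = (\<Sum>vs\<in>J. a vs x * local_deriv U \<phi> vs f x)"
proof -
  have "\<forall>(U, \<phi>)\<in>\<A>. \<forall>p\<in>U. \<exists>W J a. open W \<and> p \<in> W \<and> W \<subseteq> U \<and>
        finite J \<and> (\<forall>vs\<in>J. length vs \<le> k \<and> a vs \<in> Cinf_on \<A> W) \<and>
        (\<forall>f\<in>Cinf \<A>. \<forall>x\<in>W. D f x = (\<Sum>vs\<in>J. a vs x * local_deriv U \<phi> vs f x))"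
    using D unfolding diff_ops_def by simp
  from bspec[OF this ch, unfolded prod.case, rule_format, OF p] show thesis
    using that by (elim exE conjE)
qed

lemma diff_ops_nonsmooth: "D \<in> diff_ops \<A> k \<Longrightarrow> f \<notin> Cinf \<A> \<Longrightarrow> D f = 0"
  by (simp add: diff_ops_def)

lemma diff_opsI:
  assumes "\<And>f. f \<notin> Cinf \<A> \<Longrightarrow> D f = 0"
    and "\<And>U \<phi> p. (U, \<phi>) \<in> \<A> \<Longrightarrow> p \<in> U \<Longrightarrow> \<exists>W J a. open W \<and> p \<in> W \<and> W \<subseteq> U \<and>
        finite J \<and> (\<forall>vs\<in>J. length vs \<le> k \<and> a vs \<in> Cinf_on \<A> W) \<and>
        (\<forall>f\<in>Cinf \<A>. \<forall>x\<in>W. D f x = (\<Sum>vs\<in>J. a vs x * local_deriv U \<phi> vs f x))"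
  shows "D \<in> diff_ops \<A> k"
  unfolding diff_ops_def
  by (intro CollectI conjI allI impI ballI assms(1))
    (assumption, split prod.split, intro allI impI ballI assms(2), simp_all)

lemma diff_ops_linear:
  assumes D: "D \<in> diff_ops \<A> k" and f: "f \<in> Cinf \<A>" "g \<in> Cinf \<A>"
  shows "D (\<lambda>x. a * f x + b * g x) = (\<lambda>x. a * D f x + b * D g x)"
proof
  fix x
  obtain U \<phi> where ch: "(U, \<phi>) \<in> \<A>" "x \<in> U" by (rule chart_at)
  obtain W J u where W: "x \<in> W" and
    rep: "\<forall>f\<in>Cinf \<A>. \<forall>x\<in>W. D f x = (\<Sum>vs\<in>J. u vs x * local_deriv U \<phi> vs f x)"
    by (rule diff_ops_rep[OF D ch]) blast
  have "local_deriv U \<phi> vs (\<lambda>x. a * f x + b * g x) x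
      = a * local_deriv U \<phi> vs f x + b * local_deriv U \<phi> vs g x" for vs
    using iter_deriv_linear[OF CinfD[OF f(1) ch(1)] CinfD[OF f(2) ch(1)] chart_open_image[OF ch(1)], of "\<phi> x" vs a b]
      ch(2) by (simp add: local_deriv_def o_def)
  then show "D (\<lambda>x. a * f x + b * g x) x = a * D f x + b * D g x"
    using rep W f Cinf_lin[OF f]
    by (simp add: sum_distrib_left sum.distrib[symmetric] algebra_simps)
qed

lemma diff_ops_zero: "0 \<in> diff_ops \<A> k"
proof (rule diff_opsI)
  fix U \<phi> and p :: 'a assume "(U, \<phi>) \<in> \<A>" "p \<in> U"
  then show "\<exists>W J a. open W \<and> p \<in> W \<and> W \<subseteq> U \<and>
        finite J \<and> (\<forall>vs\<in>J. length vs \<le> k \<and> a vs \<in> Cinf_on \<A> W) \<and>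
        (\<forall>f\<in>Cinf \<A>. \<forall>x\<in>W. 0 f x = (\<Sum>vs\<in>J. a vs x * local_deriv U \<phi> vs f x))"
    using chart_open by (intro exI[of _ U] exI[of _ "{}"]) auto
qed simp

lemma diff_ops_mono: "D \<in> diff_ops \<A> k \<Longrightarrow> k \<le> l \<Longrightarrow> D \<in> diff_ops \<A> l"
proof (rule diff_opsI)
  fix U \<phi> p assume D: "D \<in> diff_ops \<A> k" and kl: "k \<le> l" and "(U, \<phi>) \<in> \<A>" "p \<in> U"
  then obtain W J a where "open W" "p \<in> W" "W \<subseteq> U" "finite J"
    "\<forall>vs\<in>J. length vs \<le> k \<and> a vs \<in> Cinf_on \<A> W"
    "\<forall>f\<in>Cinf \<A>. \<forall>x\<in>W. D f x = (\<Sum>vs\<in>J. a vs x * local_deriv U \<phi> vs f x)"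
    by (elim diff_ops_rep)
  then show "\<exists>W J a. open W \<and> p \<in> W \<and> W \<subseteq> U \<and>
        finite J \<and> (\<forall>vs\<in>J. length vs \<le> l \<and> a vs \<in> Cinf_on \<A> W) \<and>
        (\<forall>f\<in>Cinf \<A>. \<forall>x\<in>W. D f x = (\<Sum>vs\<in>J. a vs x * local_deriv U \<phi> vs f x))"
    using kl by (intro exI[of _ W] exI[of _ J] exI[of _ a]) (auto intro: order_trans)
qed (rule diff_ops_nonsmooth)

lemma diff_ops_add:
  assumes D: "D \<in> diff_ops \<A> k" and D': "D' \<in> diff_ops \<A> k"
  shows "(\<lambda>f x. D f x + D' f x) \<in> diff_ops \<A> k"
proof (rule diff_opsI)
  fix U \<phi> p assume ch: "(U, \<phi>) \<in> \<A>" "p \<in> U"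
  obtain W J a where 1: "open W" "p \<in> W" "W \<subseteq> U" "finite J"
    "\<forall>vs\<in>J. length vs \<le> k \<and> a vs \<in> Cinf_on \<A> W"
    "\<forall>f\<in>Cinf \<A>. \<forall>x\<in>W. D f x = (\<Sum>vs\<in>J. a vs x * local_deriv U \<phi> vs f x)"
    by (rule diff_ops_rep[OF D ch])
  obtain W' J' a' where 2: "open W'" "p \<in> W'" "W' \<subseteq> U" "finite J'"
    "\<forall>vs\<in>J'. length vs \<le> k \<and> a' vs \<in> Cinf_on \<A> W'"
    "\<forall>f\<in>Cinf \<A>. \<forall>x\<in>W'. D' f x = (\<Sum>vs\<in>J'. a' vs x * local_deriv U \<phi> vs f x)"
    by (rule diff_ops_rep[OF D' ch])
  define u where "u vs x = (if vs \<in> J then a vs x else 0) + (if vs \<in> J' then a' vs x else 0)" for vs x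
  have ext: "(\<Sum>vs\<in>L. b vs * y vs) = (\<Sum>vs\<in>J \<union> J'. (if vs \<in> L then b vs else 0) * y vs)"
    if "L \<subseteq> J \<union> J'" for L and b y :: "'e list \<Rightarrow> complex"
    using that 1(4) 2(4) by (intro sum.mono_neutral_cong_left) auto
  have "u vs \<in> Cinf_on \<A> (W \<inter> W')" if "vs \<in> J \<union> J'" for vs
  proof -
    have "(\<lambda>x. if vs \<in> J then a vs x else 0) \<in> Cinf_on \<A> (W \<inter> W')"
      using 1(5) by (cases "vs \<in> J") (auto intro: Cinf_on_subset)
    moreover have "(\<lambda>x. if vs \<in> J' then a' vs x else 0) \<in> Cinf_on \<A> (W \<inter> W')"
      using 2(5) by (cases "vs \<in> J'") (auto intro: Cinf_on_subset)
    ultimately show ?thesis unfolding u_def by (rule Cinf_on_add) (intro open_Int 1 2)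
  qed
  moreover have "D f x + D' f x = (\<Sum>vs\<in>J \<union> J'. u vs x * local_deriv U \<phi> vs f x)"
    if "f \<in> Cinf \<A>" "x \<in> W \<inter> W'" for f x
    using that 1(6) 2(6) ext[of J "\<lambda>vs. a vs x"] ext[of J' "\<lambda>vs. a' vs x"]
    by (simp add: u_def distrib_right sum.distrib)
  ultimately show "\<exists>W J a. open W \<and> p \<in> W \<and> W \<subseteq> U \<and>
        finite J \<and> (\<forall>vs\<in>J. length vs \<le> k \<and> a vs \<in> Cinf_on \<A> W) \<and>
        (\<forall>f\<in>Cinf \<A>. \<forall>x\<in>W. D f x + D' f x = (\<Sum>vs\<in>J. a vs x * local_deriv U \<phi> vs f x))"
    using 1(1-5) 2(1-5) by (intro exI[of _ "W \<inter> W'"] exI[of _ "J \<union> J'"] exI[of _ u]) auto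
qed (use diff_ops_nonsmooth[OF D] diff_ops_nonsmooth[OF D'] in \<open>auto simp: fun_eq_iff\<close>)

lemma diff_ops_sum:
  "(\<And>i. i \<in> I \<Longrightarrow> D i \<in> diff_ops \<A> k) \<Longrightarrow> (\<lambda>f x. \<Sum>i\<in>I. D i f x) \<in> diff_ops \<A> k"
proof (induction I rule: infinite_finite_induct)
  case (insert i I)
  then show ?case using diff_ops_add[of "D i" k "\<lambda>f x. \<Sum>i\<in>I. D i f x"] by simp
qed (use diff_ops_zero[of k] in \<open>simp_all add: zero_fun_def\<close>)

end

context star_manifold
begin

text \<open>Freezing one argument of \<open>c (Suc n)\<close> at a potential leaves an operator of
  order at most \<open>Suc n\<close>. The excess of one over the degree comes from the division by
  \<open>h\<close>.\<close>

lemma SD_diff_ops: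
  assumes Y: "Y \<in> symplectic_fields \<A> \<omega>"
  shows "SD Y n \<in> diff_ops \<A> (Suc n)"
proof (rule diff_opsI)
  fix U \<phi> and p :: 'm assume ch: "(U, \<phi>) \<in> \<A>" "p \<in> U"
  obtain b N where b: "potential Y b N" "p \<in> N" by (rule potential_at[OF Y])
  have bN: "b \<in> Cinf \<A>" "open N" using b by (auto simp: potential_def)
  obtain W J a where W: "open W" "p \<in> W" "W \<subseteq> U" "finite J"
    and J: "\<And>vs ws. (vs, ws) \<in> J \<Longrightarrow> length vs \<le> Suc n \<and> length ws \<le> Suc n \<and> a (vs, ws) \<in> Cinf_on \<A> W"
    and rep: "\<And>f g x. f \<in> Cinf \<A> \<Longrightarrow> g \<in> Cinf \<A> \<Longrightarrow> x \<in> W \<Longrightarrow> c (Suc n) f g x =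
       (\<Sum>(vs, ws)\<in>J. a (vs, ws) x * local_deriv U \<phi> vs f x * local_deriv U \<phi> ws g x)"
    by (rule bidiff_rep[OF ch, where k = "Suc n"]) blast
  define L where "L = fst ` J \<union> snd ` J"
  \<comment> \<open>The sums over pairs of derivatives are regrouped by the derivative that falls on
    \<open>f\<close>: the second of the pair in the first term of the commutator, the first of the
    pair in the second term.\<close>
  define u where "u us x = (\<Sum>j\<in>{j\<in>J. snd j = us}. a j x * local_deriv U \<phi> (fst j) b x)
      - (\<Sum>j\<in>{j\<in>J. fst j = us}. a j x * local_deriv U \<phi> (snd j) b x)" for us x
  have WN: "open (W \<inter> N)" using W bN by blast
  have sm: "(\<lambda>x. \<Sum>j\<in>K. a j x * local_deriv U \<phi> (h j) b x) \<in> Cinf_on \<A> (W \<inter> N)" if "K \<subseteq> J" for K h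
  proof (rule Cinf_on_sum[OF Cinf_on_mult WN])
    fix j assume "j \<in> K"
    then have "j \<in> J" using that by blast
    then have "a j \<in> Cinf_on \<A> W" using J[of "fst j" "snd j"] by simp
    then show "a j \<in> Cinf_on \<A> (W \<inter> N)" by (rule Cinf_on_subset) auto
    show "local_deriv U \<phi> (h j) b \<in> Cinf_on \<A> (W \<inter> N)"
      by (rule Cinf_on_subset[OF local_deriv_smooth[OF ch(1) bN(1)]]) (use W in auto)
  qed (rule WN)
  have "u us \<in> Cinf_on \<A> (W \<inter> N)" for us
  proof -
    have "(\<lambda>x. (\<Sum>j\<in>{j\<in>J. snd j = us}. a j x * local_deriv U \<phi> (fst j) b x)
      + (- 1) * (\<Sum>j\<in>{j\<in>J. fst j = us}. a j x * local_deriv U \<phi> (snd j) b x)) \<in> Cinf_on \<A> (W \<inter> N)"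
      by (intro Cinf_on_add Cinf_on_mult Cinf_on_const sm WN) auto
    then show ?thesis by (simp add: u_def[abs_def])
  qed
  moreover have "SD Y n f x = (\<Sum>us\<in>L. u us x * local_deriv U \<phi> us f x)"
    if f: "f \<in> Cinf \<A>" and x: "x \<in> W \<inter> N" for f x
  proof -
    let ?l = "\<lambda>vs f. local_deriv U \<phi> vs f x"
    have g: "(\<Sum>us\<in>L. (\<Sum>j\<in>{j\<in>J. h j = us}. a j x * ?l (h' j) b) * ?l us f)
        = (\<Sum>j\<in>J. a j x * ?l (h' j) b * ?l (h j) f)" if "h ` J \<subseteq> L" for h h'
    proof -
      have "(\<Sum>us\<in>L. (\<Sum>j\<in>{j\<in>J. h j = us}. a j x * ?l (h' j) b) * ?l us f)
        = (\<Sum>us\<in>L. \<Sum>j\<in>{j\<in>J. h j = us}. a j x * ?l (h' j) b * ?l (h j) f)"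
        by (simp add: sum_distrib_right)
      also have "\<dots> = (\<Sum>j\<in>J. a j x * ?l (h' j) b * ?l (h j) f)"
        by (rule sum.group) (use W(4) that in \<open>auto simp: L_def\<close>)
      finally show ?thesis .
    qed
    have "SD Y n f x = c (Suc n) b f x - c (Suc n) f b x"
      using SD_comm[OF Y b(1) _ f] x by (simp add: comm_def)
    also have "\<dots> = (\<Sum>j\<in>J. a j x * ?l (fst j) b * ?l (snd j) f) - (\<Sum>j\<in>J. a j x * ?l (snd j) b * ?l (fst j) f)"
      using x by (simp add: rep[OF bN(1) f] rep[OF f bN(1)] case_prod_unfold mult_ac)
    also have "\<dots> = (\<Sum>us\<in>L. u us x * ?l us f)"
      using g[of snd fst] g[of fst snd]
      by (simp add: L_def u_def left_diff_distrib sum_subtractf)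
    finally show ?thesis .
  qed
  moreover have "finite L" "\<forall>us\<in>L. length us \<le> Suc n" using W(4) J by (auto simp: L_def)
  ultimately show "\<exists>W J a. open W \<and> p \<in> W \<and> W \<subseteq> U \<and>
        finite J \<and> (\<forall>vs\<in>J. length vs \<le> Suc n \<and> a vs \<in> Cinf_on \<A> W) \<and>
        (\<forall>f\<in>Cinf \<A>. \<forall>x\<in>W. SD Y n f x = (\<Sum>vs\<in>J. a vs x * local_deriv U \<phi> vs f x))"
    using WN W(2,3) b(2) by (intro exI[of _ "W \<inter> N"] exI[of _ L] exI[of _ u]) auto
qed (rule SD_nonsmooth[OF Y])

subsection \<open>Formal symplectic vector fields and derivations\<close>

abbreviation FD :: "(nat \<Rightarrow> 'm cop) \<Rightarrow> nat \<Rightarrow> 'm cop" where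
  "FD \<equiv> formal_derivation \<A> \<omega> c"

abbreviation formal_symplectic :: "(nat \<Rightarrow> 'm cop) set" where
  "formal_symplectic \<equiv> formal_symplectic_fields \<A> \<omega>"

lemma formal_symplecticD: "Y \<in> formal_symplectic \<Longrightarrow> Y k \<in> symplectic_fields \<A> \<omega>"
  by (simp add: formal_symplectic_fields_def)

lemma FD_comb:
  assumes "Y \<in> formal_symplectic" "Y' \<in> formal_symplectic"
  shows "FD (\<lambda>k f x. a * Y k f x + a' * Y' k f x) n f x = a * FD Y n f x + a' * FD Y' n f x"
  using assms
  by (simp add: formal_derivation_def SD_comb formal_symplecticD sum.distrib sum_distrib_left)

lemma FD_zero: "FD 0 n = 0"
  by (auto simp: formal_derivation_def SD_zero fun_eq_iff)

text \<open>For positive \<open>k\<close> the term \<open>SD (Y k) (n - k)\<close> has order at most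
  \<open>n - k + 1\<close>, hence at most \<open>n\<close>. The term for 0, of order
  \<open>n + 1\<close> in general, is absent since \<open>Y 0 = 0\<close>.\<close>

lemma FD_diff_ops:
  assumes Y: "Y \<in> formal_symplectic" "Y 0 = 0"
  shows "FD Y n \<in> diff_ops \<A> n"
  unfolding formal_derivation_def
proof (rule diff_ops_sum)
  fix k assume k: "k \<in> {..n}"
  show "SD (Y k) (n - k) \<in> diff_ops \<A> n"
  proof (cases "k = 0")
    case True
    then show ?thesis using Y(2) by (simp add: SD_zero diff_ops_zero)
  next
    case False
    show ?thesis
      by (rule diff_ops_mono[OF SD_diff_ops[OF formal_symplecticD[OF Y(1)]]]) (use k False in auto)
  qed
qed

text \<open>The series \<open>SD (Y k)\<close> enters shifted by \<open>k\<close> degrees, so the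
  rule for the sum is the sum of the rules in degree \<open>n - k\<close>, after an exchange of
  summations.\<close>

lemma FD_derivation:
  assumes Y: "Y \<in> formal_symplectic"
  shows "star_derivation \<A> c (FD Y)"
proof -
  note S = SD_derivation[OF formal_symplecticD[OF Y]]
  note SC = star_derivationD(2)[OF S]
  have "FD Y n f = 0" if "f \<notin> Cinf \<A>" for n f
    using star_derivationD(1)[OF S that] by (auto simp: formal_derivation_def fun_eq_iff)
  moreover have "FD Y n f \<in> Cinf \<A>" if "f \<in> Cinf \<A>" for n f
    unfolding formal_derivation_def by (rule Cinf_sum) (rule SC[OF that])
  moreover have "FD Y n (\<lambda>x. a * f x + b * g x) = (\<lambda>x. a * FD Y n f x + b * FD Y n g x)"
    if "f \<in> Cinf \<A>" "g \<in> Cinf \<A>" for n f g a b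
    by (simp add: formal_derivation_def star_derivationD(3)[OF S that] sum.distrib sum_distrib_left)
  moreover have "coeff_derivation (FD Y)"
    unfolding coeff_derivation_def
  proof (intro allI ballI)
    fix n x and f g :: "'m \<Rightarrow> complex" assume fg: "f \<in> Cinf \<A>" "g \<in> Cinf \<A>"
    have pairs: "(\<Sum>m\<le>n. \<Sum>k\<le>n - m. h m k) = (\<Sum>(m, k)\<in>{(m, k). m + k \<le> n}. h m k)"
      for h :: "nat \<Rightarrow> nat \<Rightarrow> complex"
    proof -
      have "(\<Sum>m\<le>n. \<Sum>k\<le>n - m. h m k) = (\<Sum>(m, k)\<in>(SIGMA m:{..n}. {..n - m}). h m k)"
        by (simp add: sum.Sigma)
      also have "(SIGMA m:{..n}. {..n - m}) = {(m, k). m + k \<le> n}" by auto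
      finally show ?thesis .
    qed
    have swap: "(\<Sum>m\<le>n. \<Sum>k\<le>n - m. h m k) = (\<Sum>k\<le>n. \<Sum>m\<le>n - k. h m k)"
      for h :: "nat \<Rightarrow> nat \<Rightarrow> complex"
      unfolding pairs
      by (rule sum.reindex_bij_witness[of _ "\<lambda>(k, m). (m, k)" "\<lambda>(m, k). (k, m)"]) auto
    have "(\<Sum>m\<le>n. FD Y m (c (n - m) f g) x) = (\<Sum>m\<le>n. \<Sum>k\<le>m. SD (Y k) (m - k) (c (n - m) f g) x)"
      by (simp add: formal_derivation_def)
    also have "\<dots> = (\<Sum>(m, k)\<in>(SIGMA m:{..n}. {..m}). SD (Y k) (m - k) (c (n - m) f g) x)"
      by (simp add: sum.Sigma)
    also have "\<dots> = (\<Sum>(k, l)\<in>{(k, l). k + l \<le> n}. SD (Y k) l (c (n - k - l) f g) x)"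
      by (rule sum.reindex_bij_witness[of _ "\<lambda>(k, l). (k + l, k)" "\<lambda>(m, k). (k, m - k)"]) auto
    also have "\<dots> = (\<Sum>k\<le>n. \<Sum>l\<le>n - k. SD (Y k) l (c (n - k - l) f g) x)" unfolding pairs ..
    also have "\<dots> = (\<Sum>k\<le>n. \<Sum>l\<le>n - k. c l (SD (Y k) (n - k - l) f) g x + c l f (SD (Y k) (n - k - l) g) x)"
      by (simp only: star_derivationD(4)[OF S fg])
    also have "\<dots> = (\<Sum>m\<le>n. \<Sum>k\<le>n - m. c m (SD (Y k) (n - k - m) f) g x + c m f (SD (Y k) (n - k - m) g) x)"
      by (rule swap[symmetric])
    also have "\<dots> = (\<Sum>m\<le>n. c m (FD Y (n - m) f) g x + c m f (FD Y (n - m) g) x)"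
      unfolding formal_derivation_def
      by (simp add: c_sum_left c_sum_right SC fg sum.distrib add.commute)
    finally show "(\<Sum>m\<le>n. FD Y m (c (n - m) f g) x)
      = (\<Sum>m\<le>n. c m (FD Y (n - m) f) g x + c m f (FD Y (n - m) g) x)" .
  qed
  ultimately show ?thesis unfolding star_derivation_iff by blast
qed

lemma star_derivation_diff:
  assumes A: "star_derivation \<A> c A" and B: "star_derivation \<A> c B"
  shows "star_derivation \<A> c (\<lambda>n f x. A n f x - B n f x)"
proof -
  note AC = star_derivationD(2)[OF A] and BC = star_derivationD(2)[OF B]
  have "(\<lambda>x. A n f x - B n f x) = 0" if "f \<notin> Cinf \<A>" for n f
    using star_derivationD(1)[OF A that] star_derivationD(1)[OF B that] by auto
  moreover have "(\<lambda>x. A n f x - B n f x) \<in> Cinf \<A>" if "f \<in> Cinf \<A>" for n f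
    by (rule Cinf_diff[OF AC[OF that] BC[OF that]])
  moreover have "(\<lambda>x. A n (\<lambda>x. a * f x + b * g x) x - B n (\<lambda>x. a * f x + b * g x) x)
      = (\<lambda>x. a * (A n f x - B n f x) + b * (A n g x - B n g x))"
    if "f \<in> Cinf \<A>" "g \<in> Cinf \<A>" for n f g a b
    by (simp add: star_derivationD(3)[OF A that] star_derivationD(3)[OF B that] algebra_simps)
  moreover have "coeff_derivation (\<lambda>n f x. A n f x - B n f x)"
    unfolding coeff_derivation_def
    using star_derivationD(4)[OF A] star_derivationD(4)[OF B]
    by (simp add: c_diff_left c_diff_right AC BC sum_subtractf sum.distrib)
  ultimately show ?thesis unfolding star_derivation_iff by blast
qed

text \<open>The factor - i undoes the i of \<open>SD_leading\<close>, so that the derivation of the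
  resulting field has the leading coefficient \<open>B n\<close>.\<close>

lemma derivation_leading_symplectic:
  assumes B: "star_derivation \<A> c B" and low: "\<And>m. m < n \<Longrightarrow> B m = 0"
  shows "(\<lambda>f x. - \<i> * B n f x) \<in> symplectic_fields \<A> \<omega>"
proof -
  note BC = star_derivationD(2)[OF B]
  have mult: "B n (\<lambda>x. f x * g x) x = B n f x * g x + f x * B n g x"
    if fg: "f \<in> Cinf \<A>" "g \<in> Cinf \<A>" for f g x
  proof -
    have "B n (c 0 f g) x = (\<Sum>k\<le>n. B k (c (n - k) f g) x)"
      using low by (subst sum.mono_neutral_right[of "{..n}" "{n}"]) auto
    also have "\<dots> = (\<Sum>k\<le>n. c k (B (n - k) f) g x + c k f (B (n - k) g) x)"
      by (rule star_derivationD(4)[OF B fg])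
    also have "\<dots> = c 0 (B n f) g x + c 0 f (B n g) x"
      using low fg by (subst sum.mono_neutral_right[of "{..n}" "{0}"]) auto
    finally show ?thesis using fg by (simp add: c_0 BC)
  qed
  \<comment> \<open>The unknown \<open>B (Suc n)\<close> enters only through an expression symmetric
    in \<open>f\<close> and \<open>g\<close>, which disappears on antisymmetrisation.\<close>
  have next_order: "B n (c 1 f g) x = c 1 (B n f) g x + c 1 f (B n g) x
      + (B (Suc n) f x * g x + f x * B (Suc n) g x - B (Suc n) (\<lambda>x. f x * g x) x)"
    if fg: "f \<in> Cinf \<A>" "g \<in> Cinf \<A>" for f g x
  proof -
    have "B n (c 1 f g) x + B (Suc n) (c 0 f g) x = (\<Sum>k\<le>Suc n. B k (c (Suc n - k) f g) x)"
      using low by (subst sum.mono_neutral_right[of "{..Suc n}" "{n, Suc n}"]) (auto simp: not_le less_Suc_eq)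
    also have "\<dots> = (\<Sum>k\<le>Suc n. c k (B (Suc n - k) f) g x + c k f (B (Suc n - k) g) x)"
      by (rule star_derivationD(4)[OF B fg])
    also have "\<dots> = (\<Sum>k\<in>{0, 1}. c k (B (Suc n - k) f) g x + c k f (B (Suc n - k) g) x)"
    proof (rule sum.mono_neutral_right)
      have "B (Suc n - i) = 0" if "i \<in> {..Suc n} - {0, 1}" for i by (rule low) (use that in auto)
      then show "\<forall>i\<in>{..Suc n} - {0, 1}. c i (B (Suc n - i) f) g x + c i f (B (Suc n - i) g) x = 0"
        using fg by simp
    qed auto
    also have "\<dots> = c 0 (B (Suc n) f) g x + c 0 f (B (Suc n) g) x + (c 1 (B n f) g x + c 1 f (B n g) x)"
      by simp
    finally show ?thesis using fg by (simp add: c_0 BC algebra_simps)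
  qed
  have i_pb: "c 1 f g x - c 1 g f x = \<i> * pb f g x" if "f \<in> Cinf \<A>" "g \<in> Cinf \<A>" for f g x
    using fun_cong[OF c_1[OF that], of x] by simp
  let ?Y = "\<lambda>f x. - \<i> * B n f x"
  have Yv: "?Y \<in> vfields \<A>"
    unfolding vfields_def
  proof (intro CollectI conjI allI ballI)
    show "vat ?Y p \<in> tangent \<A> p" for p
      by (rule tangentI)
        (simp_all add: star_derivationD(1)[OF B] star_derivationD(3)[OF B] mult algebra_simps)
    show "?Y f \<in> Cinf \<A>" if "f \<in> Cinf \<A>" for f by (intro Cinf_mult Cinf_on_const BC that)
  qed
  show ?thesis
  proof (rule poisson_derivation_symplectic[OF pb_smooth Yv])
    fix f g :: "'m \<Rightarrow> complex" and p assume fg: "f \<in> Cinf \<A>" "g \<in> Cinf \<A>"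
    have "B n (\<lambda>x. 1 * c 1 f g x + (-1) * c 1 g f x) p = B n (c 1 f g) p - B n (c 1 g f) p"
      using star_derivationD(3)[OF B c_smooth[OF fg] c_smooth[OF fg(2,1)], where n = n and a = 1 and b = "-1"] by simp
    moreover have "(\<lambda>x. 1 * c 1 f g x + (-1) * c 1 g f x) = (\<lambda>x. \<i> * pb f g x + 0 * pb f g x)"
      using i_pb[OF fg] by simp
    moreover have "B n (\<lambda>x. \<i> * pb f g x + 0 * pb f g x) p = \<i> * B n (pb f g) p"
      using star_derivationD(3)[OF B pb_smooth[OF fg] pb_smooth[OF fg], where n = n and a = \<i> and b = 0] by simp
    ultimately have "\<i> * B n (pb f g) p = B n (c 1 f g) p - B n (c 1 g f) p" by simp
    also have "\<dots> = \<i> * pb (B n f) g p + \<i> * pb f (B n g) p"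
    proof -
      have comm: "(\<lambda>x. g x * f x) = (\<lambda>x. f x * g x)" by (simp add: mult.commute)
      show ?thesis
        unfolding next_order[OF fg] next_order[OF fg(2,1)] comm
          i_pb[OF BC[OF fg(1)] fg(2), symmetric] i_pb[OF fg(1) BC[OF fg(2)], symmetric]
        by (simp add: algebra_simps)
    qed
    finally have "B n (pb f g) p = pb (B n f) g p + pb f (B n g) p"
      by (simp flip: distrib_left)
    moreover have "pb (?Y f) g p = - \<i> * pb (B n f) g p"
      using pb_lin_left[OF BC[OF fg(1)] BC[OF fg(1)], where a = "- \<i>" and b = 0 and k = g and p = p] by simp
    moreover have "pb f (?Y g) p = - \<i> * pb f (B n g) p"
      using pb_lin_left[OF BC[OF fg(2)] BC[OF fg(2)], where a = "- \<i>" and b = 0 and k = f and p = p]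
        pb_antisym[of f "?Y g" p] pb_antisym[of f "B n g" p] by simp
    ultimately show "?Y (pb f g) p = pb (?Y f) g p + pb f (?Y g) p" by (simp add: algebra_simps)
  qed
qed

text \<open>The coefficients of the vector field are obtained successively, each as the leading
  coefficient of the derivation that remains after subtracting the previous ones.\<close>

lemma derivation_imp_FD:
  assumes A: "star_derivation \<A> c A" and A0: "A 0 = 0"
  obtains Y where "Y \<in> formal_symplectic" "Y 0 = 0" "FD Y = A"
proof -
  \<comment> \<open>The sum collects what the derivations of the earlier coefficients contribute in
    degree \<open>n\<close>; i times the new coefficient has to account for the rest of
    \<open>A n\<close>.\<close>
  obtain Y where Y: "\<And>n. Y n = (\<lambda>f x. - \<i> * (A n f x - (\<Sum>k<n. SD (Y k) (n - k) f x)))"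
    by (rule nat_course_of_values[of "\<lambda>n Y f x. - \<i> * (A n f x - (\<Sum>k<n. SD (Y k) (n - k) f x))"])
      (simp, blast)
  have iY: "\<i> * Y n f x = A n f x - (\<Sum>k<n. SD (Y k) (n - k) f x)" for n f x
    by (subst Y) (simp add: algebra_simps)
  have lead: "A n f x = (\<Sum>k\<le>n. SD (Y k) (n - k) f x)" if "Y n \<in> symplectic_fields \<A> \<omega>"
    "\<And>k. k < n \<Longrightarrow> Y k \<in> symplectic_fields \<A> \<omega>" for n f x
  proof (cases "f \<in> Cinf \<A>")
    case True
    have "(\<Sum>k\<le>n. SD (Y k) (n - k) f x) = (\<Sum>k<n. SD (Y k) (n - k) f x) + SD (Y n) 0 f x"
      unfolding lessThan_Suc_atMost[symmetric] by simp
    then show ?thesis using iY[of n f x] SD_leading[OF that(1) True] by simp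
  next
    case False
    have "SD (Y k) (n - k) f = 0" if "k \<in> {..n}" for k
      by (rule SD_nonsmooth) (use that \<open>Y n \<in> _\<close> \<open>\<And>k. k < n \<Longrightarrow> Y k \<in> _\<close> False in \<open>auto simp: le_less\<close>)
    then show ?thesis using star_derivationD(1)[OF A False] by simp
  qed
  have sym: "Y n \<in> symplectic_fields \<A> \<omega>" for n
  proof (induction n rule: less_induct)
    case (less n)
    \<comment> \<open>Only the coefficients below \<open>n\<close> are known to be symplectic yet,
      so \<open>Y\<close> is truncated there. The remainder \<open>R\<close> vanishes below degree
      \<open>n\<close>, and its coefficient in degree \<open>n\<close> is i times
      \<open>Y n\<close>.\<close>
    define Z where "Z k = (if k < n then Y k else 0)" for k
    have Z: "Z \<in> formal_symplectic" using less symplectic_zero by (auto simp: formal_symplectic_fields_def Z_def)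
    define R where "R = (\<lambda>m f x. A m f x - FD Z m f x)"
    have R: "star_derivation \<A> c R" unfolding R_def by (rule star_derivation_diff[OF A FD_derivation[OF Z]])
    have "R m = 0" if "m < n" for m
    proof (intro ext)
      fix f x
      have "A m f x = (\<Sum>k\<le>m. SD (Y k) (m - k) f x)" by (rule lead) (use less that in auto)
      also have "\<dots> = FD Z m f x" using that by (simp add: formal_derivation_def Z_def)
      finally show "R m f x = 0 f x" by (simp add: R_def)
    qed
    from derivation_leading_symplectic[OF R this]
    have "(\<lambda>f x. - \<i> * R n f x) \<in> symplectic_fields \<A> \<omega>" .
    moreover have "FD Z n f x = (\<Sum>k<n. SD (Y k) (n - k) f x)" for f x
      by (simp add: formal_derivation_def Z_def SD_zero lessThan_Suc_atMost[symmetric])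
    then have "(\<lambda>f x. - \<i> * R n f x) = Y n" unfolding R_def by (subst Y) simp
    ultimately show ?case by simp
  qed
  show thesis
  proof (rule that)
    show "Y \<in> formal_symplectic" using sym by (simp add: formal_symplectic_fields_def)
    show "Y 0 = 0" by (subst Y) (simp add: A0 fun_eq_iff)
    show "FD Y = A" using lead[OF sym sym] by (auto simp: formal_derivation_def fun_eq_iff)
  qed
qed

text \<open>Recovers the field from its derivation coefficient by coefficient. This recursion gives
  injectivity in \<open>FD_inj\<close> and smooth dependence on the parameter in
  \<open>act_surj\<close>.\<close>

lemma FD_leading:
  assumes "Y \<in> formal_symplectic" "f \<in> Cinf \<A>"
  shows "\<i> * Y n f x = FD Y n f x - (\<Sum>k<n. SD (Y k) (n - k) f x)"
proof -
  have "FD Y n f x = (\<Sum>k<n. SD (Y k) (n - k) f x) + SD (Y n) 0 f x"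
    unfolding formal_derivation_def lessThan_Suc_atMost[symmetric] by simp
  then show ?thesis using SD_leading[OF formal_symplecticD[OF assms(1)] assms(2), of n x] by simp
qed

lemma FD_inj:
  assumes Y: "Y \<in> formal_symplectic" "Y' \<in> formal_symplectic" and eq: "FD Y = FD Y'"
  shows "Y = Y'"
proof
  fix n show "Y n = Y' n"
  proof (induction n rule: less_induct)
    case (less n)
    show ?case
    proof (intro ext)
      fix f x show "Y n f x = Y' n f x"
      proof (cases "f \<in> Cinf \<A>")
        case True
        have "\<i> * Y n f x = \<i> * Y' n f x"
          using FD_leading[OF Y(1) True, of n x] FD_leading[OF Y(2) True, of n x] eq less by simp
        then show ?thesis by simp
      next
        case False
        then show ?thesis
          using vfields_nonsmooth[OF symplectic_vfield[OF formal_symplecticD[OF Y(1)]] False]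
            vfields_nonsmooth[OF symplectic_vfield[OF formal_symplecticD[OF Y(2)]] False] by simp
      qed
    qed
  qed
qed

end

section \<open>Compatible connections\<close>

lemma one_forms_comb:
  assumes A: "A \<in> one_forms \<T> \<A> Q" and B: "B \<in> one_forms \<T> \<A> Q"
    and Q: "\<And>y y'. y \<in> Q \<Longrightarrow> y' \<in> Q \<Longrightarrow> (\<lambda>k f x. a * y k f x + b * y' k f x) \<in> Q"
    and P: "\<And>f g :: 't \<times> 'm \<Rightarrow> complex. f \<in> Cinf (prod_atlas \<T> \<A>) \<Longrightarrow> g \<in> Cinf (prod_atlas \<T> \<A>)
      \<Longrightarrow> (\<lambda>z. a * f z + b * g z) \<in> Cinf (prod_atlas \<T> \<A>)"
  shows "(\<lambda>(\<sigma> :: 't) v k f (x :: 'm). a * A \<sigma> v k f x + b * B \<sigma> v k f x) \<in> one_forms \<T> \<A> Q"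
  unfolding one_forms_def
proof (intro CollectI conjI allI impI ballI)
  fix \<sigma> and v :: "('t \<Rightarrow> real) \<Rightarrow> real" assume "v \<notin> tangent \<T> \<sigma>"
  then show "(\<lambda>k f x. a * A \<sigma> v k f x + b * B \<sigma> v k f x) = 0"
    using A B by (auto simp: one_forms_def fun_eq_iff)
next
  fix \<sigma> and v :: "('t \<Rightarrow> real) \<Rightarrow> real" assume "v \<in> tangent \<T> \<sigma>"
  then show "(\<lambda>k f x. a * A \<sigma> v k f x + b * B \<sigma> v k f x) \<in> Q"
    using A B by (intro Q) (auto simp: one_forms_def)
next
  fix \<sigma> r s and v w :: "('t \<Rightarrow> real) \<Rightarrow> real" assume "v \<in> tangent \<T> \<sigma>" "w \<in> tangent \<T> \<sigma>"
  then have "A \<sigma> (\<lambda>f. r * v f + s * w f) = (\<lambda>k f x. of_real r * A \<sigma> v k f x + of_real s * A \<sigma> w k f x)"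
    "B \<sigma> (\<lambda>f. r * v f + s * w f) = (\<lambda>k f x. of_real r * B \<sigma> v k f x + of_real s * B \<sigma> w k f x)"
    using A B by (auto simp: one_forms_def)
  then show "(\<lambda>k f x. a * A \<sigma> (\<lambda>f. r * v f + s * w f) k f x + b * B \<sigma> (\<lambda>f. r * v f + s * w f) k f x)
    = (\<lambda>k f x. of_real r * (a * A \<sigma> v k f x + b * B \<sigma> v k f x) + of_real s * (a * A \<sigma> w k f x + b * B \<sigma> w k f x))"
    by (simp add: algebra_simps)
next
  fix V :: "('t \<Rightarrow> real) \<Rightarrow> 't \<Rightarrow> real" and k and f :: "'t \<times> 'm \<Rightarrow> complex" assume V: "V \<in> vfields \<T>" and f: "f \<in> Cinf (prod_atlas \<T> \<A>)"
  have "(\<lambda>(\<sigma>, x). A \<sigma> (vat V \<sigma>) k (\<lambda>y. f (\<sigma>, y)) x) \<in> Cinf (prod_atlas \<T> \<A>)"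
    "(\<lambda>(\<sigma>, x). B \<sigma> (vat V \<sigma>) k (\<lambda>y. f (\<sigma>, y)) x) \<in> Cinf (prod_atlas \<T> \<A>)"
    using A B V f by (auto simp: one_forms_def)
  from P[OF this] show "(\<lambda>(\<sigma>, x). a * A \<sigma> (vat V \<sigma>) k (\<lambda>y. f (\<sigma>, y)) x
      + b * B \<sigma> (vat V \<sigma>) k (\<lambda>y. f (\<sigma>, y)) x) \<in> Cinf (prod_atlas \<T> \<A>)"
    by (simp add: case_prod_unfold)
qed

lemma one_forms_outside: "A \<in> one_forms \<T> \<A> Q \<Longrightarrow> v \<notin> tangent \<T> \<sigma> \<Longrightarrow> A \<sigma> v = 0"
  and one_forms_value: "A \<in> one_forms \<T> \<A> Q \<Longrightarrow> v \<in> tangent \<T> \<sigma> \<Longrightarrow> A \<sigma> v \<in> Q"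
  and one_forms_lin: "A \<in> one_forms \<T> \<A> Q \<Longrightarrow> v \<in> tangent \<T> \<sigma> \<Longrightarrow> w \<in> tangent \<T> \<sigma>
    \<Longrightarrow> A \<sigma> (\<lambda>f. a * v f + b * w f) = (\<lambda>k f x. of_real a * A \<sigma> v k f x + of_real b * A \<sigma> w k f x)"
  and one_forms_smooth: "A \<in> one_forms \<T> \<A> Q \<Longrightarrow> V \<in> vfields \<T> \<Longrightarrow> f \<in> Cinf (prod_atlas \<T> \<A>)
    \<Longrightarrow> (\<lambda>(\<sigma>, x). A \<sigma> (vat V \<sigma>) k (\<lambda>y. f (\<sigma>, y)) x) \<in> Cinf (prod_atlas \<T> \<A>)"
  unfolding one_forms_def by blast+

context two_manifolds
begin

text \<open>In a product chart, expanding \<open>V\<close> in a frame at \<open>\<sigma>\<close>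
  gives a combination with constant coefficients of partial derivatives of \<open>g\<close>, which
  are smooth in \<open>x\<close>. Derivatives of sections are thus formal functions in each fibre,
  where the star product is bilinear.\<close>

lemma Cinf_vector_slice:
  fixes g :: "'t \<times> 'a \<Rightarrow> real"
  assumes V: "V \<in> vfields \<T>" and g: "g \<in> Cinf (prod_atlas \<T> \<A>)"
  shows "(\<lambda>x. V (\<lambda>\<tau>. g (\<tau>, x)) \<sigma>) \<in> Cinf \<A>"
proof (rule M.Cinf_on_local)
  fix p :: 'a
  obtain S \<theta> where 1: "(S, \<theta>) \<in> \<T>" "\<sigma> \<in> S" by (rule T.chart_at)
  obtain U \<phi> where 2: "(U, \<phi>) \<in> \<A>" "p \<in> U" by (rule M.chart_at)
  let ?c = "inv_into (S \<times> U) (map_prod \<theta> \<phi>)"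
  obtain W and X :: "'f \<Rightarrow> 't \<Rightarrow> real" and E where F: "T.frame W X E" "\<sigma> \<in> W" "W \<subseteq> S"
    and FE: "\<And>e f y. e \<in> onb \<Longrightarrow> f \<in> Cinf \<T> \<Longrightarrow> y \<in> W \<Longrightarrow> E e f y = pd e (f \<circ> inv_into S \<theta>) (\<theta> y)"
    by (rule T.ex_frame[OF 1]) blast
  have op: "open (\<theta> ` S)" "open (\<phi> ` U)" "open U"
    using T.chart_open_image[OF 1(1)] M.chart_open_image[OF 2(1)] M.chart_open[OF 2(1)] by auto
  have sm: "smooth_on (\<theta> ` S \<times> \<phi> ` U) (g \<circ> ?c)"
    using P.CinfD[OF g prod_atlasI[OF 1(1) 2(1)]] by (simp add: map_prod_Times)
  have slice: "(\<lambda>\<tau>. g (\<tau>, x)) \<in> Cinf \<T>" for x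
    unfolding Cinf_on_def
  proof clarify
    fix S' \<theta>' assume 3: "(S', \<theta>') \<in> \<T>"
    obtain U' \<phi>' where 4: "(U', \<phi>') \<in> \<A>" "x \<in> U'" by (rule M.chart_at)
    have op': "open (\<theta>' ` S')" "open (\<phi>' ` U')"
      using T.chart_open_image[OF 3] M.chart_open_image[OF 4(1)] by auto
    have "smooth_on (\<theta>' ` S') (\<lambda>s. (g \<circ> inv_into (S' \<times> U') (map_prod \<theta>' \<phi>')) (s, \<phi>' x))"
      by (rule smooth_on_compose[OF P.CinfD[OF g prod_atlasI[OF 3 4(1)]]])
        (use op' 4 in \<open>auto simp: map_prod_Times open_Times intro!: smooth_on_Pair\<close>)
    then show "smooth_on (\<theta>' ` (S' \<inter> UNIV)) ((\<lambda>\<tau>. g (\<tau>, x)) \<circ> inv_into S' \<theta>')"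
      unfolding Int_UNIV_right
      by (rule smooth_on_cong) (use op' inv_chart_prod[OF 3 4(1)] 4 M.chart_inv[OF 4(1)] in auto)
  qed
  have "V (\<lambda>\<tau>. g (\<tau>, x)) \<sigma> = (\<Sum>e\<in>onb. V (X e) \<sigma> * pd (e, 0) (g \<circ> ?c) (\<theta> \<sigma>, \<phi> x))" if x: "x \<in> U" for x
  proof -
    have diff: "(g \<circ> ?c) differentiable (at (\<theta> s, \<phi> x))" if "s \<in> S" for s
      by (rule smooth_on_differentiable[OF sm]) (use that x in auto)
    have "E e (\<lambda>\<tau>. g (\<tau>, x)) \<sigma> = pd (e, 0) (g \<circ> ?c) (\<theta> \<sigma>, \<phi> x)" if e: "e \<in> onb" for e
    proof -
      have "((\<lambda>s. (g \<circ> ?c) (s, \<phi> x)) has_derivative (\<lambda>h. frechet_derivative (g \<circ> ?c) (at (\<theta> \<sigma>, \<phi> x)) (h, 0))) (at (\<theta> \<sigma>))"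
        by (rule has_derivative_compose[of "\<lambda>s. (s, \<phi> x)", OF _ diff[OF 1(2), unfolded frechet_derivative_works]])
          (auto intro!: derivative_eq_intros)
      then have "(((\<lambda>\<tau>. g (\<tau>, x)) \<circ> inv_into S \<theta>) has_derivative
          (\<lambda>h. frechet_derivative (g \<circ> ?c) (at (\<theta> \<sigma>, \<phi> x)) (h, 0))) (at (\<theta> \<sigma>))"
        by (rule has_derivative_transform_within_open[OF _ op(1)])
          (use 1 inv_chart_prod[OF 1(1) 2(1)] x M.chart_inv[OF 2(1)] in auto)
      then show ?thesis using FE[OF e slice F(2)] by (simp add: pd_eqI)
    qed
    then show ?thesis
      using T.frame_expand[OF F(1,2) T.vfields_tangent[OF V] slice, of x] by simp
  qed
  moreover have "(\<lambda>x. \<Sum>e\<in>onb. V (X e) \<sigma> * pd (e, 0) (g \<circ> ?c) (\<theta> \<sigma>, \<phi> x)) \<in> Cinf_on \<A> U"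
  proof (rule M.Cinf_on_sum[OF M.Cinf_on_mult[OF M.Cinf_on_const _ op(3)] op(3)])
    fix e :: 'f
    have "smooth_on (\<phi> ` U) (\<lambda>y. pd (e, 0) (g \<circ> ?c) (\<theta> \<sigma>, y))"
      by (rule smooth_on_compose[OF smooth_on_pd[OF sm]])
        (use op 1 in \<open>auto simp: open_Times intro!: smooth_on_Pair\<close>)
    from M.Cinf_on_compose[OF this M.Cinf_on_chart[OF 2(1)] op(2,3)]
    show "(\<lambda>x. pd (e, 0) (g \<circ> ?c) (\<theta> \<sigma>, \<phi> x)) \<in> Cinf_on \<A> U" by simp
  qed
  ultimately have "(\<lambda>x. V (\<lambda>\<tau>. g (\<tau>, x)) \<sigma>) \<in> Cinf_on \<A> U"
    using M.Cinf_on_cong[of _ U "\<lambda>x. V (\<lambda>\<tau>. g (\<tau>, x)) \<sigma>"] op(3) by fastforce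
  then show "\<exists>U. open U \<and> p \<in> U \<and> (\<lambda>x. V (\<lambda>\<tau>. g (\<tau>, x)) \<sigma>) \<in> Cinf_on \<A> U"
    using op(3) 2(2) by blast
qed

lemma section_at_smooth: "f \<in> sections \<T> \<A> \<Longrightarrow> section_at f \<sigma> \<in> formal_functions \<A>"
  unfolding formal_functions_def section_at_def by (auto intro: Cinf_slice)

lemma section_deriv_smooth:
  assumes V: "V \<in> vfields \<T>" and f: "f \<in> sections \<T> \<A>"
  shows "section_at (section_deriv V f) \<sigma> \<in> formal_functions \<A>"
  unfolding formal_functions_def
proof (intro CollectI allI)
  fix n
  have fn: "f n \<in> Cinf (prod_atlas \<T> \<A>)" using f by (simp add: formal_functions_def)
  have re: "(\<lambda>z. Re (f n z)) \<in> Cinf (prod_atlas \<T> \<A>)" and im: "(\<lambda>z. Im (f n z)) \<in> Cinf (prod_atlas \<T> \<A>)"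
    by (rule P.Cinf_on_bounded_linear[OF bounded_linear_Re fn open_UNIV],
        rule P.Cinf_on_bounded_linear[OF bounded_linear_Im fn open_UNIV])
  have "(\<lambda>x. complex_of_real (V (\<lambda>\<tau>. Re (f n (\<tau>, x))) \<sigma>) + \<i> * complex_of_real (V (\<lambda>\<tau>. Im (f n (\<tau>, x))) \<sigma>)) \<in> Cinf \<A>"
    using Cinf_vector_slice[OF V re, of \<sigma>] Cinf_vector_slice[OF V im, of \<sigma>]
    by (intro M.Cinf_add M.Cinf_mult M.Cinf_of_real M.Cinf_on_const)
  then show "section_at (section_deriv V f) \<sigma> n \<in> Cinf \<A>"
    by (simp add: section_at_def section_deriv_def Complex_eq)
qed

end

context star_manifold
begin

lemma star_comb_left:
  assumes "F \<in> formal_functions \<A>" "G \<in> formal_functions \<A>" "H \<in> formal_functions \<A>"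
  shows "star c (\<lambda>n x. a * F n x + b * G n x) H n x = a * star c F H n x + b * star c G H n x"
  using assms by (simp add: star_def formal_functions_def c_lin_left sum.distrib sum_distrib_left)

lemma star_comb_right:
  assumes "F \<in> formal_functions \<A>" "G \<in> formal_functions \<A>" "H \<in> formal_functions \<A>"
  shows "star c H (\<lambda>n x. a * F n x + b * G n x) n x = a * star c H F n x + b * star c H G n x"
  using assms by (simp add: star_def formal_functions_def c_lin_right sum.distrib sum_distrib_left)

lemma star_derivation_formal:
  assumes "star_derivation \<A> c B" "f \<in> formal_functions \<A>" "g \<in> formal_functions \<A>"
  shows "apply_series B (star c f g) n x = star c (apply_series B f) g n x + star c f (apply_series B g) n x"
  using assms by (simp add: star_derivation_def)

lemma apply_series_formal:
  assumes "\<And>n f. f \<in> Cinf \<A> \<Longrightarrow> B n f \<in> Cinf \<A>" "f \<in> formal_functions \<A>"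
  shows "apply_series B f \<in> formal_functions \<A>"
  using assms unfolding formal_functions_def apply_series_def by (auto intro!: Cinf_sum)

end

section \<open>Connections compatible with a family of star products\<close>

locale star_family = symplectic_param \<T> \<A> \<omega>
  for \<T> :: "('t::{t2_space,second_countable_topology}, 'f::{real_inner,heine_borel,banach}) atlas"
    and \<A> :: "('m::{t2_space,second_countable_topology}, 'e::{real_inner,heine_borel,banach}) atlas"
    and \<omega> :: "'m form2" +
  fixes c :: "'t \<Rightarrow> 'm star_coeffs"
  assumes family: "smooth_natural_family \<T> \<A> \<omega> c"
begin

sublocale S: star_manifold \<A> \<omega> "c \<sigma>" for \<sigma>
  by unfold_locales (use family in \<open>simp add: smooth_natural_family_def\<close>)

lemma family_smooth:
  "f \<in> Cinf (prod_atlas \<T> \<A>) \<Longrightarrow> g \<in> Cinf (prod_atlas \<T> \<A>) \<Longrightarrow>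
    (\<lambda>(\<sigma>, x). c \<sigma> k (\<lambda>y. f (\<sigma>, y)) (\<lambda>y. g (\<sigma>, y)) x) \<in> Cinf (prod_atlas \<T> \<A>)"
  using family unfolding smooth_natural_family_def by blast

text \<open>Near a point of the product one smooth function \<open>b\<close> supplies potentials for
  all nearby parameters at once. The derivation is there a difference of values of
  \<open>c \<sigma> (Suc n)\<close>, smooth by the smoothness of the family.\<close>

lemma SD_family_smooth:
  fixes Y :: "'t \<Rightarrow> 'm cop"
  assumes Y: "\<And>\<sigma>. Y \<sigma> \<in> symplectic_fields \<A> \<omega>"
    and sm: "\<And>f. f \<in> Cinf \<A> \<Longrightarrow> (\<lambda>(\<sigma>, x). Y \<sigma> f x) \<in> Cinf (prod_atlas \<T> \<A>)"
    and f: "f \<in> Cinf (prod_atlas \<T> \<A>)"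
  shows "(\<lambda>(\<sigma>, x). symplectic_derivation \<A> \<omega> (c \<sigma>) (Y \<sigma>) n (\<lambda>y. f (\<sigma>, y)) x) \<in> Cinf (prod_atlas \<T> \<A>)"
proof (rule P.Cinf_on_local)
  fix z :: "'t \<times> 'm"
  obtain b S N where b: "b \<in> Cinf (prod_atlas \<T> \<A>)" "open S" "fst z \<in> S" "open N" "snd z \<in> N"
    "\<And>\<sigma> x f. \<sigma> \<in> S \<Longrightarrow> x \<in> N \<Longrightarrow> f \<in> Cinf \<A> \<Longrightarrow> Y \<sigma> f x = M.pb (\<lambda>x. b (\<sigma>, x)) f x"
    by (rule local_potential[OF Y sm, of "fst z" "snd z"]) blast+
  let ?h = "\<lambda>(\<sigma>, x). c \<sigma> (Suc n) (\<lambda>y. b (\<sigma>, y)) (\<lambda>y. f (\<sigma>, y)) x - c \<sigma> (Suc n) (\<lambda>y. f (\<sigma>, y)) (\<lambda>y. b (\<sigma>, y)) x"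
  have "?h \<in> Cinf (prod_atlas \<T> \<A>)"
    using P.Cinf_diff[OF family_smooth[OF b(1) f] family_smooth[OF f b(1)]]
    by (simp add: case_prod_unfold)
  then have "(\<lambda>(\<sigma>, x). symplectic_derivation \<A> \<omega> (c \<sigma>) (Y \<sigma>) n (\<lambda>y. f (\<sigma>, y)) x)
      \<in> Cinf_on (prod_atlas \<T> \<A>) (S \<times> N)"
  proof (rule P.Cinf_on_cong[OF P.Cinf_imp_Cinf_on])
    fix w assume w: "w \<in> S \<times> N"
    obtain \<sigma> x where wx: "w = (\<sigma>, x)" by (cases w)
    have pot: "S.potential (Y \<sigma>) (\<lambda>y. b (\<sigma>, y)) N"
      using b(4) b(6) Cinf_slice[OF b(1)] w wx by (auto simp: S.potential_def)
    show "?h w = (\<lambda>(\<sigma>, x). symplectic_derivation \<A> \<omega> (c \<sigma>) (Y \<sigma>) n (\<lambda>y. f (\<sigma>, y)) x) w"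
      using S.SD_comm[OF Y pot _ Cinf_slice[OF f], of x \<sigma> n \<sigma>] w by (simp add: wx S.comm_def)
  qed (use b in \<open>auto intro: open_Times\<close>)
  then show "\<exists>V. open V \<and> z \<in> V \<and> (\<lambda>(\<sigma>, x). symplectic_derivation \<A> \<omega> (c \<sigma>) (Y \<sigma>) n (\<lambda>y. f (\<sigma>, y)) x)
      \<in> Cinf_on (prod_atlas \<T> \<A>) V"
    using b(2-5) by (intro exI[of _ "S \<times> N"]) (auto intro: open_Times simp: mem_Times_iff)
qed

abbreviation FDf :: "('t, 'm) op_form \<Rightarrow> ('t, 'm) op_form" where
  "FDf Y \<equiv> (\<lambda>\<sigma> v. formal_derivation \<A> \<omega> (c \<sigma>) (Y \<sigma> v))"

abbreviation symplectic_forms :: "('t, 'm) op_form set" where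
  "symplectic_forms \<equiv> symplectic_one_forms \<T> \<A> \<omega>"

abbreviation natural_forms :: "('t, 'm) op_form set" where
  "natural_forms \<equiv> one_forms \<T> \<A> {A. A 0 = 0 \<and> (\<forall>k. A k \<in> diff_ops \<A> k)}"

lemma formal_zero: "0 \<in> formal_symplectic_fields \<A> \<omega>"
  by (simp add: formal_symplectic_fields_def M.symplectic_zero)

lemma formal_comb:
  "y \<in> formal_symplectic_fields \<A> \<omega> \<Longrightarrow> y' \<in> formal_symplectic_fields \<A> \<omega>
    \<Longrightarrow> (\<lambda>k f x. a * y k f x + b * y' k f x) \<in> formal_symplectic_fields \<A> \<omega>"
  by (simp add: formal_symplectic_fields_def M.symplectic_comb)

lemma symplectic_form_formal:
  assumes "Y \<in> symplectic_forms"
  shows "Y \<sigma> v \<in> formal_symplectic_fields \<A> \<omega>" and "Y \<sigma> v 0 = 0"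
  using assms one_forms_outside[of Y \<T> \<A> _ v \<sigma>] one_forms_value[of Y \<T> \<A> _ v \<sigma>] formal_zero
  by (cases "v \<in> tangent \<T> \<sigma>"; auto simp: symplectic_one_forms_def)+

lemma symplectic_form_smooth:
  assumes "Y \<in> symplectic_forms" "V \<in> vfields \<T>" "f \<in> Cinf (prod_atlas \<T> \<A>)"
  shows "(\<lambda>(\<sigma>, x). Y \<sigma> (vat V \<sigma>) k (\<lambda>y. f (\<sigma>, y)) x) \<in> Cinf (prod_atlas \<T> \<A>)"
  by (rule one_forms_smooth[OF assms(1)[unfolded symplectic_one_forms_def] assms(2,3)])

lemma FDf_natural:
  assumes Y: "Y \<in> symplectic_forms"
  shows "FDf Y \<in> natural_forms"
  unfolding one_forms_def
proof (intro CollectI conjI allI impI ballI)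
  note YF = symplectic_form_formal[OF Y]
  {
    fix \<sigma> and v :: "('t \<Rightarrow> real) \<Rightarrow> real" assume "v \<notin> tangent \<T> \<sigma>"
    then have Y0: "Y \<sigma> v = 0" by (rule one_forms_outside[OF Y[unfolded symplectic_one_forms_def]])
    show "formal_derivation \<A> \<omega> (c \<sigma>) (Y \<sigma> v) = 0"
      unfolding Y0 by (rule ext) (simp add: S.FD_zero)
  next
    fix \<sigma> v
    show "formal_derivation \<A> \<omega> (c \<sigma>) (Y \<sigma> v) 0 = 0"
      by (intro ext) (simp add: formal_derivation_def YF(2) S.SD_zero)
    fix k show "formal_derivation \<A> \<omega> (c \<sigma>) (Y \<sigma> v) k \<in> diff_ops \<A> k"
      by (rule S.FD_diff_ops[OF YF])
  next
    fix \<sigma> a b and v w :: "('t \<Rightarrow> real) \<Rightarrow> real" assume vw: "v \<in> tangent \<T> \<sigma>" "w \<in> tangent \<T> \<sigma>"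
    have eq: "Y \<sigma> (\<lambda>f. a * v f + b * w f) = (\<lambda>k f x. of_real a * Y \<sigma> v k f x + of_real b * Y \<sigma> w k f x)"
      by (rule one_forms_lin[OF Y[unfolded symplectic_one_forms_def] vw])
    show "formal_derivation \<A> \<omega> (c \<sigma>) (Y \<sigma> (\<lambda>f. a * v f + b * w f)) =
      (\<lambda>k f x. of_real a * formal_derivation \<A> \<omega> (c \<sigma>) (Y \<sigma> v) k f x
        + of_real b * formal_derivation \<A> \<omega> (c \<sigma>) (Y \<sigma> w) k f x)"
      unfolding eq by (intro ext) (rule S.FD_comb[OF YF(1) YF(1)])
  next
    fix V :: "('t \<Rightarrow> real) \<Rightarrow> 't \<Rightarrow> real" and k and f :: "'t \<times> 'm \<Rightarrow> complex" assume V: "V \<in> vfields \<T>" and f: "f \<in> Cinf (prod_atlas \<T> \<A>)"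
    have "(\<lambda>(\<sigma>, x). symplectic_derivation \<A> \<omega> (c \<sigma>) (Y \<sigma> (vat V \<sigma>) j) (k - j) (\<lambda>y. f (\<sigma>, y)) x)
        \<in> Cinf (prod_atlas \<T> \<A>)" for j
    proof (rule SD_family_smooth[OF _ _ f])
      show "Y \<sigma> (vat V \<sigma>) j \<in> symplectic_fields \<A> \<omega>" for \<sigma>
        using YF(1) by (simp add: formal_symplectic_fields_def)
      show "(\<lambda>(\<sigma>, x). Y \<sigma> (vat V \<sigma>) j f x) \<in> Cinf (prod_atlas \<T> \<A>)" if "f \<in> Cinf \<A>" for f
        using symplectic_form_smooth[OF Y V Cinf_snd[OF that]] by simp
    qed
    from P.Cinf_sum[of "{..k}", OF this]
    show "(\<lambda>(\<sigma>, x). formal_derivation \<A> \<omega> (c \<sigma>) (Y \<sigma> (vat V \<sigma>)) k (\<lambda>y. f (\<sigma>, y)) x)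
        \<in> Cinf (prod_atlas \<T> \<A>)"
      by (simp add: formal_derivation_def case_prod_unfold)
  }
qed

lemma natural_forms_add:
  assumes "A \<in> natural_forms" "B \<in> natural_forms"
  shows "A + B \<in> natural_forms"
proof -
  have "(\<lambda>\<sigma> v k f x. 1 * A \<sigma> v k f x + 1 * B \<sigma> v k f x) \<in> natural_forms"
  proof (rule one_forms_comb[OF assms])
    fix y y' :: "nat \<Rightarrow> 'm cop"
    assume "y \<in> {A. A 0 = 0 \<and> (\<forall>k. A k \<in> diff_ops \<A> k)}" "y' \<in> {A. A 0 = 0 \<and> (\<forall>k. A k \<in> diff_ops \<A> k)}"
    then show "(\<lambda>k f x. 1 * y k f x + 1 * y' k f x) \<in> {A. A 0 = 0 \<and> (\<forall>k. A k \<in> diff_ops \<A> k)}"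
      using M.diff_ops_add by (auto simp: fun_eq_iff)
  qed (rule P.Cinf_lin)
  moreover have "(\<lambda>\<sigma> v k f x. 1 * A \<sigma> v k f x + 1 * B \<sigma> v k f x) = A + B" by (auto simp: fun_eq_iff)
  ultimately show ?thesis by simp
qed

lemma apply_series_add: "apply_series (A + B) f n x = apply_series A f n x + apply_series B f n x"
  by (simp add: apply_series_def sum.distrib)

lemma form_action_add: "form_action \<T> \<A> (A + B) = form_action \<T> \<A> A + form_action \<T> \<A> B"
  by (auto simp: form_action_def apply_series_add fun_eq_iff)

lemma form_action_zero: "form_action \<T> \<A> 0 = 0"
  by (auto simp: form_action_def apply_series_def fun_eq_iff)

lemma connection_of_form_add:
  "connection_of_form \<T> \<A> (A + B) = connection_of_form \<T> \<A> A + form_action \<T> \<A> B"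
  unfolding connection_of_form_def form_action_add by (auto simp: form_action_def fun_eq_iff)

lemma FDf_zero: "FDf 0 = 0"
  using S.FD_zero by (auto simp: fun_eq_iff)

lemma FDf_add:
  assumes "Y \<in> symplectic_forms" "Y' \<in> symplectic_forms"
  shows "FDf (Y + Y') = FDf Y + FDf Y'"
proof (intro ext)
  fix \<sigma> v n f x
  have "Y \<sigma> v + Y' \<sigma> v = (\<lambda>k f x. 1 * Y \<sigma> v k f x + 1 * Y' \<sigma> v k f x)" by (auto simp: fun_eq_iff)
  then show "FDf (Y + Y') \<sigma> v n f x = (FDf Y + FDf Y') \<sigma> v n f x"
    using S.FD_comb[OF symplectic_form_formal(1)[OF assms(1)] symplectic_form_formal(1)[OF assms(2)], where a = 1 and a' = 1]
    by simp
qed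

abbreviation act :: "('t, 'm) connection \<Rightarrow> ('t, 'm) op_form \<Rightarrow> ('t, 'm) connection" where
  "act \<equiv> add_symplectic_form \<T> \<A> \<omega> c"

lemma act_zero: "act D 0 = D"
  using form_action_zero FDf_zero by (simp add: add_symplectic_form_def)

lemma act_add: "Y \<in> symplectic_forms \<Longrightarrow> Y' \<in> symplectic_forms \<Longrightarrow> act (act D Y) Y' = act D (Y + Y')"
  using FDf_add[of Y Y'] form_action_add[of "FDf Y" "FDf Y'"] by (simp add: add_symplectic_form_def add.assoc)

lemma family_star_sections:
  assumes "f \<in> sections \<T> \<A>" "g \<in> sections \<T> \<A>"
  shows "family_star c f g \<in> sections \<T> \<A>"
  unfolding formal_functions_def
proof (intro CollectI allI)
  fix n
  have h: "(\<lambda>(\<sigma>, x). c \<sigma> k (\<lambda>y. f i (\<sigma>, y)) (\<lambda>y. g j (\<sigma>, y)) x) \<in> Cinf (prod_atlas \<T> \<A>)" for k i j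
    by (rule family_smooth) (use assms in \<open>auto simp: formal_functions_def\<close>)
  have "(\<lambda>z. \<Sum>k\<le>n. \<Sum>i\<le>n - k. (\<lambda>(\<sigma>, x). c \<sigma> k (\<lambda>y. f i (\<sigma>, y)) (\<lambda>y. g (n - k - i) (\<sigma>, y)) x) z)
      \<in> Cinf (prod_atlas \<T> \<A>)"
    by (rule P.Cinf_sum, rule P.Cinf_sum, rule h)
  then show "family_star c f g n \<in> Cinf (prod_atlas \<T> \<A>)"
    by (simp add: family_star_def star_def section_at_def case_prod_unfold)
qed

lemma section_at_family_star:
  "section_at (family_star c f g) \<sigma> = star (c \<sigma>) (section_at f \<sigma>) (section_at g \<sigma>)"
  by (auto simp: section_at_def family_star_def fun_eq_iff)

lemma section_at_form_action:
  "V \<in> vfields \<T> \<Longrightarrow> f \<in> sections \<T> \<A> \<Longrightarrow>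
    section_at (form_action \<T> \<A> B V f) \<sigma> = apply_series (B \<sigma> (vat V \<sigma>)) (section_at f \<sigma>)"
  by (auto simp: section_at_def form_action_def fun_eq_iff)

lemma section_at_add: "section_at (f + g) \<sigma> = (\<lambda>n x. 1 * section_at f \<sigma> n x + 1 * section_at g \<sigma> n x)"
  by (auto simp: section_at_def)

lemma section_eqI: "(\<And>\<sigma> n x. section_at f \<sigma> n x = section_at g \<sigma> n x) \<Longrightarrow> f = g"
  by (auto simp: section_at_def fun_eq_iff)

lemma natural_form_smooth:
  assumes A: "A \<in> natural_forms" and v: "v \<in> tangent \<T> \<sigma>" and f: "f \<in> Cinf \<A>"
  shows "A \<sigma> v n f \<in> Cinf \<A>"
proof -
  obtain V where V: "V \<in> vfields \<T>" "vat V \<sigma> = v" using T.tangent_extend[OF v] by blast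
  show ?thesis using Cinf_slice[OF one_forms_smooth[OF A V(1) Cinf_snd[OF f], where k = n], of \<sigma>] V(2) by simp
qed

lemma connection_smooth:
  assumes A: "A \<in> natural_forms" and V: "V \<in> vfields \<T>" and f: "f \<in> sections \<T> \<A>"
  shows "section_at (connection_of_form \<T> \<A> A V f) \<sigma> \<in> formal_functions \<A>"
proof -
  have "apply_series (A \<sigma> (vat V \<sigma>)) (section_at f \<sigma>) \<in> formal_functions \<A>"
    by (rule S.apply_series_formal[OF natural_form_smooth[OF A T.vfields_tangent[OF V]] section_at_smooth[OF f]])
  then show ?thesis
    using V f section_deriv_smooth[OF V f, of \<sigma>]
    by (auto simp: connection_of_form_def section_at_add section_at_form_action formal_functions_def
        intro: M.Cinf_add)
qed

text \<open>The added form acts in each fibre by derivations of the star product of that fibre.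
  Bilinearity of \<open>star\<close> holds on formal functions, so the images of sections have to be
  shown smooth in each fibre first.\<close>

lemma compatible_act:
  assumes A: "A \<in> natural_forms" and comp: "compatible \<T> \<A> c (connection_of_form \<T> \<A> A)"
    and der: "\<And>\<sigma> v. star_derivation \<A> (c \<sigma>) (B \<sigma> v)"
  shows "compatible \<T> \<A> c (connection_of_form \<T> \<A> A + form_action \<T> \<A> B)"
  unfolding compatible_def
proof (intro ballI)
  fix V :: "('t \<Rightarrow> real) \<Rightarrow> 't \<Rightarrow> real" and f g assume V: "V \<in> vfields \<T>" and f: "f \<in> sections \<T> \<A>" and g: "g \<in> sections \<T> \<A>"
  let ?D = "connection_of_form \<T> \<A> A" and ?F = "form_action \<T> \<A> B"
  have F: "section_at (?F V h) \<sigma> \<in> formal_functions \<A>" if "h \<in> sections \<T> \<A>" for h \<sigma>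
    unfolding section_at_form_action[OF V that]
    by (rule S.apply_series_formal[OF S.star_derivationD(2)[OF der] section_at_smooth[OF that]])
  note D = connection_smooth[OF A V]
  have c: "?D V (family_star c f g) = family_star c (?D V f) g + family_star c f (?D V g)"
    using comp V f g by (simp add: compatible_def)
  show "(?D + ?F) V (family_star c f g) = family_star c ((?D + ?F) V f) g + family_star c f ((?D + ?F) V g)"
  proof (rule section_eqI)
    fix \<sigma> n x
    have "section_at (?F V (family_star c f g)) \<sigma> n x
        = star (c \<sigma>) (section_at (?F V f) \<sigma>) (section_at g \<sigma>) n x
        + star (c \<sigma>) (section_at f \<sigma>) (section_at (?F V g) \<sigma>) n x"
      unfolding section_at_form_action[OF V f] section_at_form_action[OF V g]
        section_at_form_action[OF V family_star_sections[OF f g]] section_at_family_star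
      by (rule S.star_derivation_formal[OF der section_at_smooth[OF f] section_at_smooth[OF g]])
    then show "section_at ((?D + ?F) V (family_star c f g)) \<sigma> n x
        = section_at (family_star c ((?D + ?F) V f) g + family_star c f ((?D + ?F) V g)) \<sigma> n x"
      using S.star_comb_left[OF D[OF f] F[OF f] section_at_smooth[OF g], where a = 1 and b = 1 and n = n and x = x]
        S.star_comb_right[OF D[OF g] F[OF g] section_at_smooth[OF f], where a = 1 and b = 1 and n = n and x = x]
      by (simp add: section_at_add section_at_family_star c)
  qed
qed

lemma FDf_derivation:
  assumes "Y \<in> symplectic_forms"
  shows "star_derivation \<A> (c \<sigma>) (formal_derivation \<A> \<omega> (c \<sigma>) (Y \<sigma> v))"
  using S.FD_derivation[OF symplectic_form_formal(1)[OF assms, of \<sigma> v], of \<sigma>] .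

lemma act_compatible:
  assumes D: "D \<in> compatible_connections \<T> \<A> c" and Y: "Y \<in> symplectic_forms"
  shows "act D Y \<in> compatible_connections \<T> \<A> c"
proof -
  obtain A where A: "A \<in> natural_forms" "D = connection_of_form \<T> \<A> A" "compatible \<T> \<A> c D"
    using D by (auto simp: compatible_connections_def formal_connections_def)
  have "act D Y = connection_of_form \<T> \<A> (A + FDf Y)"
    by (simp add: connection_of_form_add add_symplectic_form_def A(2))
  moreover have "A + FDf Y \<in> natural_forms" by (rule natural_forms_add[OF A(1) FDf_natural[OF Y]])
  moreover have "compatible \<T> \<A> c (act D Y)"
    unfolding add_symplectic_form_def A(2)
    by (rule compatible_act[OF A(1) _ FDf_derivation[OF Y]]) (use A in simp)
  ultimately show ?thesis by (auto simp: compatible_connections_def formal_connections_def)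
qed

text \<open>Test sections: on them a form acts by its operators alone, so they recover the values of
  a form from its action.\<close>

definition const_section :: "(nat \<Rightarrow> 'm \<Rightarrow> complex) \<Rightarrow> ('t, 'm) formal_section" where
  "const_section f = (\<lambda>n z. f n (snd z))"

lemma const_section: "f \<in> formal_functions \<A> \<Longrightarrow> const_section f \<in> sections \<T> \<A>"
  and section_at_const: "section_at (const_section f) \<sigma> = f"
  by (auto simp: const_section_def formal_functions_def section_at_def Cinf_snd)

text \<open>Evaluating the action along a field through \<open>v\<close> on constant sections
  recovers the derivation at \<open>\<sigma>\<close> and \<open>v\<close>, and \<open>FD_inj\<close>
  recovers the vector field.\<close>

lemma act_inj:
  assumes Y: "Y \<in> symplectic_forms" "Y' \<in> symplectic_forms" and eq: "act D Y = act D Y'"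
  shows "Y = Y'"
proof (intro ext)
  fix \<sigma> v
  have "Y \<sigma> v = Y' \<sigma> v"
  proof (cases "v \<in> tangent \<T> \<sigma>")
    case True
    obtain V where V: "V \<in> vfields \<T>" "vat V \<sigma> = v" using T.tangent_extend[OF True] by blast
    have eq': "form_action \<T> \<A> (FDf Y) = form_action \<T> \<A> (FDf Y')"
      using eq by (simp add: add_symplectic_form_def)
    show ?thesis
    proof (rule S.FD_inj[OF symplectic_form_formal(1)[OF Y(1)] symplectic_form_formal(1)[OF Y(2)]])
      show "FDf Y \<sigma> v = FDf Y' \<sigma> v"
      proof (intro ext)
        fix n f x
        show "FDf Y \<sigma> v n f x = FDf Y' \<sigma> v n f x"
        proof (cases "f \<in> Cinf \<A>")
          case f: True
          have s: "const_section (constant_series f) \<in> sections \<T> \<A>"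
            by (rule const_section[OF S.constant_series_formal[OF f]])
          have "apply_series (FDf Z \<sigma> v) (constant_series f) = (\<lambda>n. FDf Z \<sigma> v n f)" if "Z \<in> symplectic_forms" for Z
            by (rule S.apply_series_const[OF S.star_derivationD(2,3)[OF FDf_derivation[OF that]] f])
          then show ?thesis
            using section_at_form_action[OF V(1) s, of "FDf Y" \<sigma>] section_at_form_action[OF V(1) s, of "FDf Y'" \<sigma>] eq' Y V(2)
            by (simp add: section_at_const fun_eq_iff)
        next
          case False
          then show ?thesis
            using S.star_derivationD(1)[OF FDf_derivation[OF Y(1)]] S.star_derivationD(1)[OF FDf_derivation[OF Y(2)]] by simp
        qed
      qed
    qed
  next
    case False
    then show ?thesis
      using one_forms_outside[OF Y(1)[unfolded symplectic_one_forms_def] False]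
        one_forms_outside[OF Y(2)[unfolded symplectic_one_forms_def] False] by simp
  qed
  then show "Y \<sigma> v n f x = Y' \<sigma> v n f x" for n f x by simp
qed

text \<open>On sections that do not depend on the parameter the derivative along \<open>V\<close> vanishes, and on
  their product it is common to both connections, so it cancels in the difference.\<close>

lemma difference_derivation:
  assumes A: "A \<in> natural_forms" "A' \<in> natural_forms"
    and comp: "compatible \<T> \<A> c (connection_of_form \<T> \<A> A)" "compatible \<T> \<A> c (connection_of_form \<T> \<A> A')"
    and v: "v \<in> tangent \<T> \<sigma>"
  shows "star_derivation \<A> (c \<sigma>) (\<lambda>n f x. A' \<sigma> v n f x - A \<sigma> v n f x)"
proof -
  let ?B = "\<lambda>n f x. A' \<sigma> v n f x - A \<sigma> v n f x"
  obtain V where V: "V \<in> vfields \<T>" "vat V \<sigma> = v" using T.tangent_extend[OF v] by blast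
  have dop: "A \<sigma> v k \<in> diff_ops \<A> k" "A' \<sigma> v k \<in> diff_ops \<A> k" for k
    using one_forms_value[OF A(1) v] one_forms_value[OF A(2) v] by auto
  have "?B n f = 0" if "f \<notin> Cinf \<A>" for n f
    using M.diff_ops_nonsmooth[OF dop(1) that] M.diff_ops_nonsmooth[OF dop(2) that] by (auto simp: fun_eq_iff)
  moreover have "?B n f \<in> Cinf \<A>" if "f \<in> Cinf \<A>" for n f
    by (rule M.Cinf_diff[OF natural_form_smooth[OF A(2) v that] natural_form_smooth[OF A(1) v that]])
  moreover have "?B n (\<lambda>x. a * f x + b * g x) = (\<lambda>x. a * ?B n f x + b * ?B n g x)"
    if "f \<in> Cinf \<A>" "g \<in> Cinf \<A>" for n f g a b
    using M.diff_ops_linear[OF dop(1) that, of n a b] M.diff_ops_linear[OF dop(2) that, of n a b]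
    by (simp add: algebra_simps)
  moreover have "apply_series ?B (star (c \<sigma>) f g) = star (c \<sigma>) (apply_series ?B f) g + star (c \<sigma>) f (apply_series ?B g)"
    if fg: "f \<in> formal_functions \<A>" "g \<in> formal_functions \<A>" for f g
  proof (intro ext)
    fix n x
    let ?f = "const_section f" and ?g = "const_section g"
    note sf = const_section[OF fg(1)] and sg = const_section[OF fg(2)]
    have conn: "section_at (connection_of_form \<T> \<A> C V s) \<sigma>
        = (\<lambda>n x. 1 * section_at (section_deriv V s) \<sigma> n x + 1 * apply_series (C \<sigma> v) (section_at s \<sigma>) n x)"
      if "s \<in> sections \<T> \<A>" for C s
      using V that by (simp add: connection_of_form_def section_at_add section_at_form_action)
    have zero: "section_at (section_deriv V (const_section h)) \<sigma> = 0" for h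
      using T.vfields_const[OF V(1)] by (auto simp: section_at_def section_deriv_def const_section_def fun_eq_iff complex_eq_iff)
    have conn': "section_at (connection_of_form \<T> \<A> C V (const_section h)) \<sigma> = apply_series (C \<sigma> v) h"
      if "h \<in> formal_functions \<A>" for C h
      unfolding conn[OF const_section[OF that]] by (simp add: zero section_at_const)
    have main: "section_at (section_deriv V (family_star c ?f ?g)) \<sigma> n x + apply_series (C \<sigma> v) (star (c \<sigma>) f g) n x
        = star (c \<sigma>) (apply_series (C \<sigma> v) f) g n x + star (c \<sigma>) f (apply_series (C \<sigma> v) g) n x"
      if "compatible \<T> \<A> c (connection_of_form \<T> \<A> C)" for C
    proof -
      have "connection_of_form \<T> \<A> C V (family_star c ?f ?g)
          = family_star c (connection_of_form \<T> \<A> C V ?f) ?g + family_star c ?f (connection_of_form \<T> \<A> C V ?g)"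
        using that V(1) sf sg by (simp add: compatible_def)
      then have "section_at (connection_of_form \<T> \<A> C V (family_star c ?f ?g)) \<sigma> n x
          = section_at (family_star c (connection_of_form \<T> \<A> C V ?f) ?g + family_star c ?f (connection_of_form \<T> \<A> C V ?g)) \<sigma> n x"
        by simp
      then show ?thesis
        unfolding conn[OF family_star_sections[OF sf sg]]
        by (simp add: section_at_add section_at_family_star section_at_const conn' fg)
    qed
    have ap: "apply_series ?B h = (\<lambda>n x. 1 * apply_series (A' \<sigma> v) h n x + (-1) * apply_series (A \<sigma> v) h n x)" for h
      by (simp add: apply_series_def sum_subtractf)
    have form: "apply_series (C \<sigma> v) h \<in> formal_functions \<A>"
      if "C \<in> natural_forms" "h \<in> formal_functions \<A>" for C h
    proof (rule S.apply_series_formal[OF _ that(2)])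
      show "C \<sigma> v n f \<in> Cinf \<A>" if "f \<in> Cinf \<A>" for n f
        by (rule natural_form_smooth[OF \<open>C \<in> natural_forms\<close> v that])
    qed
    show "apply_series ?B (star (c \<sigma>) f g) n x
        = (star (c \<sigma>) (apply_series ?B f) g + star (c \<sigma>) f (apply_series ?B g)) n x"
      unfolding ap plus_fun_apply S.star_comb_left[OF form[OF A(2) fg(1)] form[OF A(1) fg(1)] fg(2)]
        S.star_comb_right[OF form[OF A(2) fg(2)] form[OF A(1) fg(2)] fg(1)]
      using main[OF comp(1)] main[OF comp(2)] by algebra
  qed
  ultimately show ?thesis unfolding star_derivation_def by blast
qed

text \<open>The formal vector field is chosen separately for each \<open>\<sigma>\<close> and
  \<open>v\<close>, so linearity and smoothness have to be won back: linearity from uniqueness,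
  smoothness from the recursion for the coefficients.\<close>

lemma act_surj:
  assumes D: "D \<in> compatible_connections \<T> \<A> c" and D': "D' \<in> compatible_connections \<T> \<A> c"
  obtains Y where "Y \<in> symplectic_forms" "D' = act D Y"
proof -
  obtain A where A: "A \<in> natural_forms" "D = connection_of_form \<T> \<A> A" "compatible \<T> \<A> c D"
    using D by (auto simp: compatible_connections_def formal_connections_def)
  obtain A' where A': "A' \<in> natural_forms" "D' = connection_of_form \<T> \<A> A'" "compatible \<T> \<A> c D'"
    using D' by (auto simp: compatible_connections_def formal_connections_def)
  define B where "B = (\<lambda>\<sigma> v n f x. A' \<sigma> v n f x - A \<sigma> v n f x)"
  have Bd: "star_derivation \<A> (c \<sigma>) (B \<sigma> v)" if "v \<in> tangent \<T> \<sigma>" for \<sigma> v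
    unfolding B_def by (rule difference_derivation[OF A(1) A'(1) _ _ that]) (use A A' in auto)
  have B0: "B \<sigma> v 0 = 0" if "v \<in> tangent \<T> \<sigma>" for \<sigma> v
    using one_forms_value[OF A(1) that] one_forms_value[OF A'(1) that] by (auto simp: B_def fun_eq_iff)
  have ex: "\<exists>y. y \<in> formal_symplectic_fields \<A> \<omega> \<and> y 0 = 0 \<and> formal_derivation \<A> \<omega> (c \<sigma>) y = B \<sigma> v"
    if "v \<in> tangent \<T> \<sigma>" for \<sigma> v
    by (rule S.derivation_imp_FD[OF Bd[OF that] B0[OF that]]) blast
  define y where "y \<sigma> v = (SOME y. y \<in> formal_symplectic_fields \<A> \<omega> \<and> y 0 = 0
      \<and> formal_derivation \<A> \<omega> (c \<sigma>) y = B \<sigma> v)" for \<sigma> v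
  have y: "y \<sigma> v \<in> formal_symplectic_fields \<A> \<omega> \<and> y \<sigma> v 0 = 0
      \<and> formal_derivation \<A> \<omega> (c \<sigma>) (y \<sigma> v) = B \<sigma> v" if "v \<in> tangent \<T> \<sigma>" for \<sigma> v
    unfolding y_def by (rule someI_ex[OF ex[OF that]])
  define Y where "Y \<sigma> v = (if v \<in> tangent \<T> \<sigma> then y \<sigma> v else 0)" for \<sigma> v
  have YF: "Y \<sigma> v \<in> formal_symplectic_fields \<A> \<omega>" "Y \<sigma> v 0 = 0" for \<sigma> v
    using y[of v \<sigma>] formal_zero by (auto simp: Y_def)
  have YB: "formal_derivation \<A> \<omega> (c \<sigma>) (Y \<sigma> v) = B \<sigma> v" if "v \<in> tangent \<T> \<sigma>" for \<sigma> v
    using y[OF that] that by (simp add: Y_def)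
  have YS: "Y \<sigma> v k \<in> symplectic_fields \<A> \<omega>" for \<sigma> v k
    using YF(1) by (simp add: formal_symplectic_fields_def)
  \<comment> \<open>Induction along \<open>FD_leading\<close>: the coefficient in degree
    \<open>k\<close> is a combination of the two smooth connection forms and of derivations of
    earlier coefficients, which are smooth by \<open>SD_family_smooth\<close>.\<close>
  have smooth: "(\<lambda>(\<sigma>, x). Y \<sigma> (vat V \<sigma>) k (\<lambda>y. f (\<sigma>, y)) x) \<in> Cinf (prod_atlas \<T> \<A>)"
    if V: "V \<in> vfields \<T>" and f: "f \<in> Cinf (prod_atlas \<T> \<A>)" for V k f
    using f
  proof (induction k arbitrary: f rule: less_induct)
    case (less k)
    have "(\<lambda>(\<sigma>, x). symplectic_derivation \<A> \<omega> (c \<sigma>) (Y \<sigma> (vat V \<sigma>) j) (k - j) (\<lambda>y. f (\<sigma>, y)) x)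
        \<in> Cinf (prod_atlas \<T> \<A>)" if "j \<in> {..<k}" for j
    proof (rule SD_family_smooth[OF YS _ less.prems])
      show "(\<lambda>(\<sigma>, x). Y \<sigma> (vat V \<sigma>) j f x) \<in> Cinf (prod_atlas \<T> \<A>)" if "f \<in> Cinf \<A>" for f
        using less.IH[of j, OF _ Cinf_snd[OF that]] \<open>j \<in> {..<k}\<close> by (simp only: snd_conv lessThan_iff)
    qed
    note sm = P.Cinf_sum[OF this]
    have sm': "(\<lambda>z. - \<i> * (((\<lambda>(\<sigma>, x). A' \<sigma> (vat V \<sigma>) k (\<lambda>y. f (\<sigma>, y)) x) z
          - (\<lambda>(\<sigma>, x). A \<sigma> (vat V \<sigma>) k (\<lambda>y. f (\<sigma>, y)) x) z)
        - (\<Sum>j<k. (\<lambda>(\<sigma>, x). symplectic_derivation \<A> \<omega> (c \<sigma>) (Y \<sigma> (vat V \<sigma>) j) (k - j) (\<lambda>y. f (\<sigma>, y)) x) z)))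
        \<in> Cinf (prod_atlas \<T> \<A>)"
      by (rule P.Cinf_mult[OF P.Cinf_on_const P.Cinf_diff[OF P.Cinf_diff[OF
            one_forms_smooth[OF A'(1) V less.prems] one_forms_smooth[OF A(1) V less.prems]] sm]])
    have eq: "Y \<sigma> (vat V \<sigma>) k (\<lambda>y. f (\<sigma>, y)) x = - \<i> * ((A' \<sigma> (vat V \<sigma>) k (\<lambda>y. f (\<sigma>, y)) x
          - A \<sigma> (vat V \<sigma>) k (\<lambda>y. f (\<sigma>, y)) x)
        - (\<Sum>j<k. symplectic_derivation \<A> \<omega> (c \<sigma>) (Y \<sigma> (vat V \<sigma>) j) (k - j) (\<lambda>y. f (\<sigma>, y)) x))" for \<sigma> x
    proof -
      have "\<i> * Y \<sigma> (vat V \<sigma>) k (\<lambda>y. f (\<sigma>, y)) x = B \<sigma> (vat V \<sigma>) k (\<lambda>y. f (\<sigma>, y)) x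
        - (\<Sum>j<k. symplectic_derivation \<A> \<omega> (c \<sigma>) (Y \<sigma> (vat V \<sigma>) j) (k - j) (\<lambda>y. f (\<sigma>, y)) x)"
        using S.FD_leading[OF YF(1)[of \<sigma> "vat V \<sigma>"] Cinf_slice[OF less.prems, of \<sigma>],
            where \<sigma> = \<sigma> and n = k and x = x] YB[OF T.vfields_tangent[OF V]] by simp
      from arg_cong[OF this, of "\<lambda>u. - \<i> * u"] show ?thesis by (simp add: B_def)
    qed
    show ?case unfolding case_prod_unfold eq using sm' unfolding case_prod_unfold .
  qed
  have "Y \<in> symplectic_forms"
    unfolding symplectic_one_forms_def one_forms_def
  proof (intro CollectI conjI allI impI ballI YF smooth)
    show "Y \<sigma> v = 0" if "v \<notin> tangent \<T> \<sigma>" for \<sigma> v using that by (simp add: Y_def)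
    fix \<sigma> a b and v w :: "('t \<Rightarrow> real) \<Rightarrow> real" assume vw: "v \<in> tangent \<T> \<sigma>" "w \<in> tangent \<T> \<sigma>"
    have t: "(\<lambda>f. a * v f + b * w f) \<in> tangent \<T> \<sigma>" by (rule T.tangent_comb[OF vw])
    have lin: "B \<sigma> (\<lambda>f. a * v f + b * w f) n f x = of_real a * B \<sigma> v n f x + of_real b * B \<sigma> w n f x" for n f x
      using one_forms_lin[OF A(1) vw, of a b] one_forms_lin[OF A'(1) vw, of a b] by (simp add: B_def algebra_simps)
    show "Y \<sigma> (\<lambda>f. a * v f + b * w f) = (\<lambda>k f x. of_real a * Y \<sigma> v k f x + of_real b * Y \<sigma> w k f x)"
    \<comment> \<open>Both sides have the same derivation because \<open>B\<close> is linear in the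
      tangent vector, and the derivation determines the field.\<close>
    proof (rule S.FD_inj[OF YF(1) formal_comb[OF YF(1) YF(1)], of \<sigma>], intro ext)
      fix n f x
      show "formal_derivation \<A> \<omega> (c \<sigma>) (Y \<sigma> (\<lambda>f. a * v f + b * w f)) n f x =
          formal_derivation \<A> \<omega> (c \<sigma>) (\<lambda>k f x. of_real a * Y \<sigma> v k f x + of_real b * Y \<sigma> w k f x) n f x"
        by (simp add: S.FD_comb[OF YF(1) YF(1)] YB[OF t] YB[OF vw(1)] YB[OF vw(2)] lin)
    qed
  qed
  moreover have "D' = act D Y"
  proof -
    have "form_action \<T> \<A> (FDf Y) = form_action \<T> \<A> B"
      by (auto simp: form_action_def YB[OF T.vfields_tangent] fun_eq_iff)
    moreover have "A' = A + B" by (auto simp: B_def fun_eq_iff)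
    ultimately show ?thesis
      using connection_of_form_add[of A B] by (simp add: add_symplectic_form_def A(2) A'(2))
  qed
  ultimately show thesis using that by blast
qed

section \<open>The vector space of symplectic forms and the affine structure\<close>

lemma symplectic_forms_comb:
  assumes "Y \<in> symplectic_forms" "Y' \<in> symplectic_forms"
  shows "(\<lambda>\<sigma> v k f x. a * Y \<sigma> v k f x + b * Y' \<sigma> v k f x) \<in> symplectic_forms"
  unfolding symplectic_one_forms_def
  by (rule one_forms_comb[OF assms[unfolded symplectic_one_forms_def]])
    (auto simp: formal_comb P.Cinf_lin fun_eq_iff)

lemma symplectic_forms_zero: "0 \<in> symplectic_forms"
  unfolding symplectic_one_forms_def one_forms_def
  using formal_zero by (auto simp: fun_eq_iff case_prod_unfold)

lemma vector_space_scale_form: "vector_space (scale_form :: complex \<Rightarrow> ('t, 'm) op_form \<Rightarrow> _)"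
  by unfold_locales (auto simp: scale_form_def fun_eq_iff algebra_simps)

lemma subspace_symplectic_forms: "module.subspace scale_form symplectic_forms"
proof -
  interpret vector_space "scale_form :: complex \<Rightarrow> ('t, 'm) op_form \<Rightarrow> _" by (rule vector_space_scale_form)
  show ?thesis
    unfolding subspace_def
  proof (intro conjI ballI allI symplectic_forms_zero)
    fix Y Y' assume Y: "Y \<in> symplectic_forms" "Y' \<in> symplectic_forms"
    have "Y + Y' = (\<lambda>\<sigma> v k f x. 1 * Y \<sigma> v k f x + 1 * Y' \<sigma> v k f x)" by (auto simp: fun_eq_iff)
    then show "Y + Y' \<in> symplectic_forms" using symplectic_forms_comb[OF Y, of 1 1] by simp
  next
    fix Y and a :: complex assume Y: "Y \<in> symplectic_forms"
    show "scale_form a Y \<in> symplectic_forms"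
      using symplectic_forms_comb[OF Y Y, of a 0] by (simp add: scale_form_def)
  qed
qed

lemma act_bij:
  assumes D: "D \<in> compatible_connections \<T> \<A> c"
  shows "bij_betw (act D) symplectic_forms (compatible_connections \<T> \<A> c)"
proof (rule bij_betwI')
  show "\<And>Y Y'. Y \<in> symplectic_forms \<Longrightarrow> Y' \<in> symplectic_forms \<Longrightarrow> (act D Y = act D Y') = (Y = Y')"
    using act_inj by blast
  show "\<And>Y. Y \<in> symplectic_forms \<Longrightarrow> act D Y \<in> compatible_connections \<T> \<A> c"
    by (rule act_compatible[OF D])
  show "\<exists>Y\<in>symplectic_forms. D' = act D Y" if "D' \<in> compatible_connections \<T> \<A> c" for D'
    by (rule act_surj[OF D that]) blast
qed

end

theorem theorem1p5:
  fixes \<A> :: "('m::{t2_space,second_countable_topology}, 'e::{real_inner,heine_borel,banach}) atlas"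
    and \<T> :: "('t::{t2_space,second_countable_topology}, 'f::{real_inner,heine_borel,banach}) atlas"
    and \<omega> :: "'m form2"
    and c :: "'t \<Rightarrow> 'm star_coeffs"
  assumes "symplectic_manifold \<A> \<omega>"
    and "smooth_atlas \<T>"
    and "smooth_natural_family \<T> \<A> \<omega> c"
    and "compatible_connections \<T> \<A> c \<noteq> {}"
  shows "affine_space_over scale_form (symplectic_one_forms \<T> \<A> \<omega>)
           (compatible_connections \<T> \<A> c) (add_symplectic_form \<T> \<A> \<omega> c) \<and>
         (\<forall>D\<^sub>0 \<in> compatible_connections \<T> \<A> c.
           compatible_connections \<T> \<A> c =
           {add_symplectic_form \<T> \<A> \<omega> c D\<^sub>0 Y | Y. Y \<in> symplectic_one_forms \<T> \<A> \<omega>})"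
proof -
  interpret star_family \<T> \<A> \<omega> c
    by unfold_locales (use assms in \<open>simp_all add: symplectic_manifold_def\<close>)
  \<comment> \<open>Surjectivity of the translation from \<open>D\<close> is the displayed formula,
    with any compatible connection as base point.\<close>
  have "compatible_connections \<T> \<A> c = {act D Y | Y. Y \<in> symplectic_forms}"
    if "D \<in> compatible_connections \<T> \<A> c" for D
    using bij_betw_imp_surj_on[OF act_bij[OF that]] by blast
  then show ?thesis
    unfolding affine_space_over_def
    using vector_space_scale_form subspace_symplectic_forms assms(4) act_zero act_add act_bij by simp
qed

end
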